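(* Let $0<\alpha<2$, let $\psi$ be a Bernstein function regularly varying at zero of index $\alpha/2$ with $\psi(0)=0$ and $\psi(1)=1$, let $S$ be a one-dimensional random walk in the class $\mathscr{S}$ whose steps $X_i$ satisfy $\mathbb{E}X_1=0$ and $\mathrm{Var}(X_1)=1$, and let $S^\psi_n=S_{\tau_n}$ be the subordinate random walk. Assume that $(b_n:n\in\mathbb{N})$ is a sequence of positive numbers such that $$\lim_{n\to\infty}n\,\psi(b_n^{-1})=1.$$ Then the sequence of random elements $\big(b_n^{-1/2}S^\psi_{[nt]}:t\ge0\big)$ converges in law in the Skorohod space $\mathbf{D}([0,\infty),\mathbb{R})$ (with the $J_1$-topology) to the random element $B^\alpha$.
   Context: Class $\mathscr{S}$ on $\mathbb{Z}$: $S_n=\sum_{i=1}^nX_i$, $S_0=0$, with $X_i$ i.i.d. $\mathbb{Z}$-valued with law $p$, where $p$ has finite support and mean zero, and for each $x\in\mathbb{Z}$ there is $n$ with $\mathbb{P}(S_n=x)>0$. A Bernstein function is a function $\psi:[0,\infty)\to[0,\infty)$, continuous on $[0,\infty)$ and smooth on $(0,\infty)$, with $(-1)^n\psi^{(n)}(x)\le0$ for all integers $n\ge1$ and $x>0$. It has a representation $\psi(x)=a+bx+\int_{[0,\infty)}(1-e^{-xs})\,d\nu(s)$ with $a,b\ge0$ and $\int\min\{1,s\}\,d\nu(s)<\infty$. It is regularly varying at zero of index $\beta$ if $\psi(x)=x^{\beta}\ell(1/x)$ near $0$, where $\ell(\lambda x)/\ell(x)\to1$ as $x\to\infty$ for every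 $\lambda>0$. For $k\ge1$ put $c(\psi,k)=\frac1{k!}\int_{[0,\infty)}t^ke^{-t}\,d\nu(t)+b\,\mathbf 1_{\{k=1\}}$. The discrete subordinator is $\tau_0=0$, $\tau_n=R_1+\dots+R_n$ with $R_i$ i.i.d., independent of $S$, $\mathbb{P}(R_i=k)=c(\psi,k)$. $B^\alpha_t=B_{\sigma_t}$, where $B$ is standard one-dimensional Brownian motion ($\mathrm{Var}(B_t)=t$) and $\sigma=(\sigma_t)_{t\ge 0}$ is a non-decreasing L\'evy process independent of $B$ with $\mathbb{E}(e^{-\lambda\sigma_t})=e^{-t\lambda^{\alpha/2}}$, $\lambda\ge0$. $[\cdot]$ is the integer part. *)

theory Defs
  imports "HOL-Probability.Probability"
begin

section \<open>The Skorohod space on the half-line\<close>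

text \<open>Paths are functions on the reals that are \<^const>\<open>undefined\<close> off the half-line, so that equality
  of paths is equality on the half-line.\<close>

definition skorohod_space :: "(real \<Rightarrow> real) set" where
  "skorohod_space = {x \<in> extensional {0..}.
     (\<forall>t\<ge>0. (x \<longlongrightarrow> x t) (at_right t)) \<and> (\<forall>t>0. \<exists>l. (x \<longlongrightarrow> l) (at_left t))}"

text \<open>A strictly increasing surjection of the half-line is automatically continuous and fixes \<open>0\<close>.\<close>

definition time_changes :: "(real \<Rightarrow> real) set" where
  "time_changes = {l. strict_mono_on {0..} l \<and> l ` {0..} = {0..}}"

definition J1_nbhd :: "(real \<Rightarrow> real) \<Rightarrow> real \<Rightarrow> real \<Rightarrow> (real \<Rightarrow> real) set" where
  "J1_nbhd x T e = {y \<in> skorohod_space. \<exists>l\<in>time_changes.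
     (\<forall>t\<ge>0. \<bar>l t - t\<bar> < e) \<and> (\<forall>t\<in>{0..T}. \<bar>y (l t) - x t\<bar> < e)}"

text \<open>The \<open>J\<^sub>1\<close> topology. The sets \<^const>\<open>J1_nbhd\<close> form neighbourhood bases, so that convergence of
  sequences is the usual \<open>J\<^sub>1\<close> convergence; see \<open>limitin_skorohod_J1_iff\<close> below.\<close>

definition skorohod_J1 :: "(real \<Rightarrow> real) topology" where
  "skorohod_J1 = topology (\<lambda>U. U \<subseteq> skorohod_space \<and> (\<forall>x\<in>U. \<exists>T. \<exists>e>0. J1_nbhd x T e \<subseteq> U))"

lemma J1_nbhd_mono: "T' \<le> T \<Longrightarrow> e \<le> e' \<Longrightarrow> J1_nbhd x T e \<subseteq> J1_nbhd x T' e'"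
proof
  fix y assume "T' \<le> T" "e \<le> e'" "y \<in> J1_nbhd x T e"
  then obtain l where "y \<in> skorohod_space" "l \<in> time_changes"
    "\<And>t. t \<ge> 0 \<Longrightarrow> \<bar>l t - t\<bar> < e'" "\<And>t. t \<in> {0..T'} \<Longrightarrow> \<bar>y (l t) - x t\<bar> < e'"
    unfolding J1_nbhd_def by force
  then show "y \<in> J1_nbhd x T' e'" unfolding J1_nbhd_def by blast
qed

lemma openin_skorohod_J1:
  "openin skorohod_J1 U \<longleftrightarrow>
     U \<subseteq> skorohod_space \<and> (\<forall>x\<in>U. \<exists>T. \<exists>e>0. J1_nbhd x T e \<subseteq> U)"
proof -
  let ?P = "\<lambda>U. U \<subseteq> skorohod_space \<and> (\<forall>x\<in>U. \<exists>T. \<exists>e>0. J1_nbhd x T e \<subseteq> U)"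
  have "istopology ?P"
    unfolding istopology_def
  proof (intro conjI allI impI)
    fix S V assume S: "?P S" and V: "?P V"
    show "S \<inter> V \<subseteq> skorohod_space" using S by blast
    show "\<forall>x\<in>S \<inter> V. \<exists>T. \<exists>e>0. J1_nbhd x T e \<subseteq> S \<inter> V"
    proof
      fix x assume x: "x \<in> S \<inter> V"
      obtain T e where 1: "e > 0" "J1_nbhd x T e \<subseteq> S" using S x by blast
      obtain T' e' where 2: "e' > 0" "J1_nbhd x T' e' \<subseteq> V" using V x by blast
      have "J1_nbhd x (max T T') (min e e') \<subseteq> S \<inter> V"
        using J1_nbhd_mono[of T "max T T'" "min e e'" e x]
          J1_nbhd_mono[of T' "max T T'" "min e e'" e' x] 1 2 by auto
      with 1 2 show "\<exists>T. \<exists>e>0. J1_nbhd x T e \<subseteq> S \<inter> V"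
        by (intro exI[of _ "max T T'"] exI[of _ "min e e'"]) auto
    qed
  next
    fix K assume K: "\<forall>U\<in>K. ?P U"
    show "\<Union>K \<subseteq> skorohod_space" using K by blast
    show "\<forall>x\<in>\<Union>K. \<exists>T. \<exists>e>0. J1_nbhd x T e \<subseteq> \<Union>K"
    proof
      fix x assume "x \<in> \<Union>K"
      then obtain U where U: "U \<in> K" "x \<in> U" by blast
      then obtain T e where "e > 0" "J1_nbhd x T e \<subseteq> U" using K by blast
      with U show "\<exists>T. \<exists>e>0. J1_nbhd x T e \<subseteq> \<Union>K" by blast
    qed
  qed
  then show ?thesis
    unfolding skorohod_J1_def by (simp add: topology_inverse')
qed

lemma topspace_skorohod_J1 [simp]: "topspace skorohod_J1 = skorohod_space"
proof -
  have "J1_nbhd x T e \<subseteq> skorohod_space" for x T e by (auto simp: J1_nbhd_def)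
  then have "openin skorohod_J1 skorohod_space"
    unfolding openin_skorohod_J1 by (auto intro!: exI[of _ 1])
  then show ?thesis
    using openin_subset openin_topspace[of skorohod_J1] unfolding openin_skorohod_J1[of "topspace _"]
    by blast
qed

lemma time_changes_nonneg: "l \<in> time_changes \<Longrightarrow> t \<ge> 0 \<Longrightarrow> l t \<ge> 0"
  unfolding time_changes_def by auto

lemma time_changes_id: "(\<lambda>t. t) \<in> time_changes"
  by (auto simp: time_changes_def strict_mono_on_def)

lemma J1_nbhd_self: "x \<in> skorohod_space \<Longrightarrow> e > 0 \<Longrightarrow> x \<in> J1_nbhd x T e"
  unfolding J1_nbhd_def by (intro CollectI conjI bexI[OF _ time_changes_id]) auto

lemma J1_nbhd_trans:
  assumes y: "y \<in> J1_nbhd x T e" and z: "z \<in> J1_nbhd y (T + e) e'"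
  shows "z \<in> J1_nbhd x T (e + e')"
proof -
  obtain l where l: "l \<in> time_changes" "\<And>t. t \<ge> 0 \<Longrightarrow> \<bar>l t - t\<bar> < e"
    "\<And>t. t \<in> {0..T} \<Longrightarrow> \<bar>y (l t) - x t\<bar> < e"
    using y unfolding J1_nbhd_def by blast
  obtain m where m: "m \<in> time_changes" "\<And>t. t \<ge> 0 \<Longrightarrow> \<bar>m t - t\<bar> < e'"
    "\<And>t. t \<in> {0..T+e} \<Longrightarrow> \<bar>z (m t) - y t\<bar> < e'"
    using z unfolding J1_nbhd_def by blast
  have "(m \<circ> l) ` {0..} = {0..}"
    using l(1) m(1) unfolding time_changes_def image_comp [symmetric] by simp
  then have "m \<circ> l \<in> time_changes"
    using l(1) m(1) time_changes_nonneg[OF l(1)]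
    unfolding time_changes_def strict_mono_on_def by simp
  moreover have "\<bar>(m \<circ> l) t - t\<bar> < e + e'" if "t \<ge> 0" for t
    using l(2)[OF that] m(2)[OF time_changes_nonneg[OF l(1) that]] by simp
  moreover have "\<bar>z ((m \<circ> l) t) - x t\<bar> < e + e'" if t: "t \<in> {0..T}" for t
  proof -
    have "l t \<in> {0..T + e}"
      using l(2)[of t] t time_changes_nonneg[OF l(1), of t] by auto
    then show ?thesis using l(3)[OF t] m(3)[of "l t"] by simp
  qed
  moreover have "z \<in> skorohod_space" using z by (auto simp: J1_nbhd_def)
  ultimately show ?thesis unfolding J1_nbhd_def by blast
qed

lemma limitin_skorohod_J1_nbhd:
  "limitin skorohod_J1 xs x F \<longleftrightarrow>
     x \<in> skorohod_space \<and> (\<forall>T. \<forall>e>0. \<forall>\<^sub>F n in F. xs n \<in> J1_nbhd x T e)"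
proof (intro iffI conjI allI impI)
  assume L: "limitin skorohod_J1 xs x F"
  show x: "x \<in> skorohod_space" using L by (simp add: limitin_def)
  fix T e :: real assume e: "e > 0"
  let ?U = "{y \<in> skorohod_space. \<exists>T'. \<exists>e'>0. J1_nbhd y T' e' \<subseteq> J1_nbhd x T e}"
  have "openin skorohod_J1 ?U"
    unfolding openin_skorohod_J1
  proof (intro conjI ballI)
    fix y assume "y \<in> ?U"
    then obtain T' e' where e': "e' > 0" and sub: "J1_nbhd y T' e' \<subseteq> J1_nbhd x T e" by blast
    have "z \<in> ?U" if z: "z \<in> J1_nbhd y T' (e' / 2)" for z
    proof -
      have "J1_nbhd z (T' + e' / 2) (e' / 2) \<subseteq> J1_nbhd y T' e'"
        using J1_nbhd_trans[OF z, of _ "e' / 2"] by auto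
      moreover have "z \<in> skorohod_space" using z by (simp add: J1_nbhd_def)
      moreover have "e' / 2 > 0" using e' by simp
      ultimately show ?thesis using subset_trans[OF _ sub] by blast
    qed
    then show "\<exists>T'. \<exists>e'>0. J1_nbhd y T' e' \<subseteq> ?U" using e' by (meson half_gt_zero subsetI)
  qed auto
  moreover have "x \<in> ?U" using x e by blast
  ultimately have "\<forall>\<^sub>F n in F. xs n \<in> ?U" using L unfolding limitin_def by blast
  then show "\<forall>\<^sub>F n in F. xs n \<in> J1_nbhd x T e"
    by eventually_elim (use J1_nbhd_self in blast)
next
  assume R: "x \<in> skorohod_space \<and> (\<forall>T. \<forall>e>0. \<forall>\<^sub>F n in F. xs n \<in> J1_nbhd x T e)"
  show "limitin skorohod_J1 xs x F"
    unfolding limitin_def topspace_skorohod_J1 openin_skorohod_J1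
  proof (intro conjI allI impI)
    fix U assume U: "(U \<subseteq> skorohod_space \<and> (\<forall>x\<in>U. \<exists>T. \<exists>e>0. J1_nbhd x T e \<subseteq> U)) \<and> x \<in> U"
    then obtain T e where e: "e > 0" "J1_nbhd x T e \<subseteq> U" by blast
    then have "\<forall>\<^sub>F n in F. xs n \<in> J1_nbhd x T e" using R by blast
    then show "\<forall>\<^sub>F n in F. xs n \<in> U" by (rule eventually_mono) (use e(2) in blast)
  qed (use R in blast)
qed

lemma limitin_skorohod_J1_iff:
  assumes xs: "\<And>n. xs n \<in> skorohod_space"
  shows "limitin skorohod_J1 xs x sequentially \<longleftrightarrow> x \<in> skorohod_space \<and>
    (\<exists>l. (\<forall>n. l n \<in> time_changes) \<and> uniform_limit {0..} l (\<lambda>t. t) sequentially \<and>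
         (\<forall>T. uniform_limit {0..T} (\<lambda>n t. xs n (l n t)) x sequentially))"
proof (intro iffI conjI)
  assume L: "limitin skorohod_J1 xs x sequentially"
  show "x \<in> skorohod_space" using L by (simp add: limitin_def)
  define d where "d = (\<lambda>k::nat. 1 / (real k + 1))"
  define good where "good = (\<lambda>(k::nat) n l. (\<forall>t\<ge>0. \<bar>l t - t\<bar> < d k) \<and>
     (\<forall>t\<in>{0..real k}. \<bar>xs n (l t) - x t\<bar> < d k))"
  have d_pos: "d k > 0" and d_anti: "j \<le> k \<Longrightarrow> d k \<le> d j" for j k
    by (auto simp: d_def field_simps)
  have good_anti: "good j n l" if "good k n l" "j \<le> k" for j k n l
  proof -
    have "\<bar>l t - t\<bar> < d j" if "t \<ge> 0" for t
      using \<open>good k n l\<close> that d_anti[OF \<open>j \<le> k\<close>] unfolding good_def by fastforce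
    moreover have "\<bar>xs n (l t) - x t\<bar> < d j" if "t \<in> {0..real j}" for t
      using \<open>good k n l\<close> \<open>j \<le> k\<close> that d_anti[OF \<open>j \<le> k\<close>] unfolding good_def
      by (intro order_less_le_trans[of _ "d k" "d j"]) auto
    ultimately show ?thesis unfolding good_def by blast
  qed
  have "\<exists>l\<in>time_changes. \<forall>k\<le>n. (\<exists>l'\<in>time_changes. good k n l') \<longrightarrow> good k n l" for n
  proof -
    let ?K = "{k. k \<le> n \<and> (\<exists>l'\<in>time_changes. good k n l')}"
    show ?thesis
    proof (cases "?K = {}")
      case True then show ?thesis by (intro bexI[OF _ time_changes_id]) simp
    next
      case False
      have fin: "finite ?K" by simp
      obtain l where l: "l \<in> time_changes" "good (Max ?K) n l"
        using Max_in[OF fin False] by blast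
      have "good k n l" if "k \<in> ?K" for k
        using good_anti[OF l(2) Max_ge[OF fin that]] .
      then show ?thesis by (intro bexI[OF _ l(1)]) simp
    qed
  qed
  then have "\<forall>n. \<exists>l. l \<in> time_changes \<and> (\<forall>k\<le>n. (\<exists>l'\<in>time_changes. good k n l') \<longrightarrow> good k n l)"
    by blast
  from choice[OF this] obtain l where ll: "\<forall>n. l n \<in> time_changes \<and>
      (\<forall>k\<le>n. (\<exists>l'\<in>time_changes. good k n l') \<longrightarrow> good k n (l n))" ..
  then have l: "\<And>n. l n \<in> time_changes" by simp
  have gl: "good k n (l n)" if "k \<le> n" "\<exists>l'\<in>time_changes. good k n l'" for n k
    using ll that by simp
  have ev: "\<forall>\<^sub>F n in sequentially. good k n (l n)" for k
  proof -
    have "\<forall>\<^sub>F n in sequentially. xs n \<in> J1_nbhd x (real k) (d k)"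
      using L d_pos unfolding limitin_skorohod_J1_nbhd by blast
    then show ?thesis
      using eventually_ge_at_top[of k]
    proof eventually_elim
      case (elim n)
      then have "\<exists>l'\<in>time_changes. good k n l'" unfolding J1_nbhd_def good_def by blast
      with elim show ?case by (intro gl)
    qed
  qed
  have small: "\<exists>k. T \<le> real k \<and> d k < e" if e: "e > 0" for T e
  proof -
    obtain k :: nat where k: "real k > max T (1 / e)" using reals_Archimedean2 by blast
    then have "1 < e * real k" using e by (simp add: field_simps)
    then have "d k < e" using e by (simp add: d_def divide_less_eq algebra_simps)
    then show ?thesis using k by (intro exI[of _ k]) auto
  qed
  have "uniform_limit {0..} l (\<lambda>t. t) sequentially"
  proof (rule uniform_limitI)
    fix e :: real assume "e > 0"
    then obtain k where "d k < e" using small[of e 0] by blast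
    have "dist (l n t) t < e" if "good k n (l n)" "t \<in> {0..}" for n t
      using that \<open>d k < e\<close> unfolding good_def dist_real_def by fastforce
    then show "\<forall>\<^sub>F n in sequentially. \<forall>t\<in>{0..}. dist (l n t) t < e"
      by (intro eventually_mono[OF ev[of k]] ballI)
  qed
  moreover have "uniform_limit {0..T} (\<lambda>n t. xs n (l n t)) x sequentially" for T
  proof (rule uniform_limitI)
    fix e :: real assume "e > 0"
    then obtain k where "T \<le> real k" "d k < e" using small[of e T] by blast
    have "dist (xs n (l n t)) (x t) < e" if "good k n (l n)" "t \<in> {0..T}" for n t
    proof -
      have "t \<in> {0..real k}" using that \<open>T \<le> real k\<close> by simp
      then have "dist (xs n (l n t)) (x t) < d k"
        using that unfolding good_def dist_real_def by blast
      then show ?thesis using \<open>d k < e\<close> by simp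
    qed
    then show "\<forall>\<^sub>F n in sequentially. \<forall>t\<in>{0..T}. dist (xs n (l n t)) (x t) < e"
      by (intro eventually_mono[OF ev[of k]] ballI)
  qed
  ultimately show "\<exists>l. (\<forall>n. l n \<in> time_changes) \<and> uniform_limit {0..} l (\<lambda>t. t) sequentially \<and>
      (\<forall>T. uniform_limit {0..T} (\<lambda>n t. xs n (l n t)) x sequentially)"
    using l by (intro exI[of _ l]) blast
next
  assume "x \<in> skorohod_space \<and> (\<exists>l. (\<forall>n. l n \<in> time_changes) \<and>
    uniform_limit {0..} l (\<lambda>t. t) sequentially \<and>
    (\<forall>T. uniform_limit {0..T} (\<lambda>n t. xs n (l n t)) x sequentially))"
  then obtain l where x: "x \<in> skorohod_space" and l: "\<And>n. l n \<in> time_changes"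
    and u: "uniform_limit {0..} l (\<lambda>t. t) sequentially"
    and v: "\<And>T. uniform_limit {0..T} (\<lambda>n t. xs n (l n t)) x sequentially" by blast
  have "\<forall>\<^sub>F n in sequentially. xs n \<in> J1_nbhd x T e" if e: "e > 0" for T e
    using uniform_limitD[OF u e] uniform_limitD[OF v e, of T]
  proof eventually_elim
    case (elim n)
    then show ?case unfolding J1_nbhd_def dist_real_def
      by (intro CollectI conjI bexI[OF _ l[of n]] xs) auto
  qed
  then show "limitin skorohod_J1 xs x sequentially"
    using x unfolding limitin_skorohod_J1_nbhd by blast
qed

section \<open>Convergence in law\<close>

definition borel_of :: "'a topology \<Rightarrow> 'a measure" where
  "borel_of T = sigma (topspace T) {U. openin T U}"

text \<open>Being a random element, i.e. Borel measurability, is part of the definition.\<close>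

definition converges_in_law ::
  "'c topology \<Rightarrow> (nat \<Rightarrow> 'a measure) \<Rightarrow> (nat \<Rightarrow> 'a \<Rightarrow> 'c) \<Rightarrow> 'b measure \<Rightarrow> ('b \<Rightarrow> 'c) \<Rightarrow> bool" where
  "converges_in_law T M X N Y \<longleftrightarrow>
     (\<forall>n. prob_space (M n) \<and> X n \<in> measurable (M n) (borel_of T)) \<and>
     prob_space N \<and> Y \<in> measurable N (borel_of T) \<and>
     (\<forall>f. continuous_map T euclideanreal f \<and> bounded (f ` topspace T) \<longrightarrow>
        (\<lambda>n. \<integral>\<omega>. f (X n \<omega>) \<partial>M n) \<longlonglongrightarrow> (\<integral>\<omega>. f (Y \<omega>) \<partial>N))"

section \<open>Bernstein functions and regular variation\<close>

definition bernstein_function :: "(real \<Rightarrow> real) \<Rightarrow> bool" where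
  "bernstein_function \<psi> \<longleftrightarrow>
     (\<forall>x\<ge>0. \<psi> x \<ge> 0) \<and> continuous_on {0..} \<psi> \<and>
     (\<forall>n. \<forall>x>0. (deriv ^^ n) \<psi> differentiable (at x)) \<and>
     (\<forall>n\<ge>1. \<forall>x>0. (-1) ^ n * (deriv ^^ n) \<psi> x \<le> 0)"

text \<open>The killing rate \<open>a\<close>, the drift \<open>b\<close> and the measure \<open>\<nu>\<close> restricted to the open half-line
  are uniquely determined by \<open>\<psi>\<close>; a mass of \<open>\<nu>\<close> at \<open>0\<close> has no effect on any of the integrals.\<close>

definition bernstein_representation ::
  "(real \<Rightarrow> real) \<Rightarrow> real \<Rightarrow> real \<Rightarrow> real measure \<Rightarrow> bool" where
  "bernstein_representation \<psi> a b \<nu> \<longleftrightarrow>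
     a \<ge> 0 \<and> b \<ge> 0 \<and> sets \<nu> = sets borel \<and> set_integrable \<nu> {0..} (\<lambda>s. min 1 s) \<and>
     (\<forall>x\<ge>0. \<psi> x = a + b * x + (LINT s:{0..}|\<nu>. 1 - exp (- x * s)))"

definition bernstein_coeff :: "real \<Rightarrow> real measure \<Rightarrow> nat \<Rightarrow> real" where
  "bernstein_coeff b \<nu> k =
     1 / fact k * (LINT t:{0..}|\<nu>. t ^ k * exp (- t)) + (if k = 1 then b else 0)"

definition slowly_varying :: "(real \<Rightarrow> real) \<Rightarrow> bool" where
  "slowly_varying l \<longleftrightarrow> (\<forall>c>0. ((\<lambda>x. l (c * x) / l x) \<longlongrightarrow> 1) at_top)"

definition regularly_varying_at_zero :: "(real \<Rightarrow> real) \<Rightarrow> real \<Rightarrow> bool" where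
  "regularly_varying_at_zero \<psi> \<beta> \<longleftrightarrow>
     (\<exists>l. slowly_varying l \<and> (\<forall>\<^sub>F x in at_right 0. \<psi> x = x powr \<beta> * l (1 / x)))"

section \<open>Random walks and subordination\<close>

definition partial_sums :: "(nat \<Rightarrow> 'a \<Rightarrow> 'b::comm_monoid_add) \<Rightarrow> nat \<Rightarrow> 'a \<Rightarrow> 'b" where
  "partial_sums X n \<omega> = (\<Sum>i=1..n. X i \<omega>)"

context prob_space
begin

text \<open>The steps are indexed from \<open>1\<close>; \<open>X 0\<close> is irrelevant.\<close>

definition class_S_steps :: "(nat \<Rightarrow> 'a \<Rightarrow> int) \<Rightarrow> int pmf \<Rightarrow> bool" where
  "class_S_steps X p \<longleftrightarrow>
     indep_vars (\<lambda>_. count_space UNIV) X {1..} \<and>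
     (\<forall>i\<ge>1. distr M (count_space UNIV) (X i) = measure_pmf p) \<and>
     finite (set_pmf p) \<and> measure_pmf.expectation p real_of_int = 0 \<and>
     (\<forall>x. \<exists>n. prob {\<omega> \<in> space M. partial_sums X n \<omega> = x} > 0)"

text \<open>\<open>c k\<close> is only used for \<open>k \<ge> 1\<close>; there it sums to \<open>1\<close> when \<open>\<psi> 0 = 0\<close> and \<open>\<psi> 1 = 1\<close>.\<close>

definition discrete_subordinator_steps :: "(nat \<Rightarrow> 'a \<Rightarrow> nat) \<Rightarrow> (nat \<Rightarrow> real) \<Rightarrow> bool" where
  "discrete_subordinator_steps R c \<longleftrightarrow>
     indep_vars (\<lambda>_. count_space UNIV) R {1..} \<and>
     (\<forall>i\<ge>1. \<forall>k\<ge>1. prob {\<omega> \<in> space M. R i \<omega> = k} = c k)"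

text \<open>Independence of the processes \<open>(X i)\<close>, \<open>i \<in> I\<close>, and \<open>(Y j)\<close>, \<open>j \<in> J\<close>: the generated
  sigma-algebras are independent. (The library's \<^const>\<open>indep_var\<close> needs equal state spaces.)\<close>

definition indep_processes ::
  "'i set \<Rightarrow> 'b measure \<Rightarrow> ('i \<Rightarrow> 'a \<Rightarrow> 'b) \<Rightarrow> 'j set \<Rightarrow> 'c measure \<Rightarrow> ('j \<Rightarrow> 'a \<Rightarrow> 'c) \<Rightarrow> bool" where
  "indep_processes I K X J L Y \<longleftrightarrow>
     indep_set
       (sets (vimage_algebra (space M) (\<lambda>\<omega>. \<lambda>i\<in>I. X i \<omega>) (PiM I (\<lambda>_. K))))
       (sets (vimage_algebra (space M) (\<lambda>\<omega>. \<lambda>j\<in>J. Y j \<omega>) (PiM J (\<lambda>_. L))))"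

section \<open>Brownian motion and the subordinated limit\<close>

definition indep_increments :: "(real \<Rightarrow> 'a \<Rightarrow> real) \<Rightarrow> bool" where
  "indep_increments Z \<longleftrightarrow> (\<forall>n. \<forall>t::nat \<Rightarrow> real. mono t \<and> 0 \<le> t 0 \<longrightarrow>
     indep_vars (\<lambda>_. borel) (\<lambda>i \<omega>. Z (t (Suc i)) \<omega> - Z (t i) \<omega>) {..<n})"

definition brownian_motion :: "(real \<Rightarrow> 'a \<Rightarrow> real) \<Rightarrow> bool" where
  "brownian_motion B \<longleftrightarrow>
     (\<forall>t\<ge>0. random_variable borel (B t)) \<and>
     (\<forall>\<omega>\<in>space M. B 0 \<omega> = 0 \<and> continuous_on {0..} (\<lambda>t. B t \<omega>)) \<and>
     indep_increments B \<and>
     (\<forall>s\<ge>0. \<forall>t>s. distributed M lborel (\<lambda>\<omega>. B t \<omega> - B s \<omega>) (normal_density 0 (sqrt (t - s))))"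

definition levy_process :: "(real \<Rightarrow> 'a \<Rightarrow> real) \<Rightarrow> bool" where
  "levy_process Z \<longleftrightarrow>
     (\<forall>t\<ge>0. random_variable borel (Z t)) \<and>
     (\<forall>\<omega>\<in>space M. Z 0 \<omega> = 0 \<and> (\<lambda>t\<in>{0..}. Z t \<omega>) \<in> skorohod_space) \<and>
     indep_increments Z \<and>
     (\<forall>s\<ge>0. \<forall>h\<ge>0. distr M borel (\<lambda>\<omega>. Z (s + h) \<omega> - Z s \<omega>) = distr M borel (Z h))"

definition stable_subordinator :: "(real \<Rightarrow> 'a \<Rightarrow> real) \<Rightarrow> real \<Rightarrow> bool" where
  "stable_subordinator \<sigma> \<beta> \<longleftrightarrow>
     levy_process \<sigma> \<and> (\<forall>\<omega>\<in>space M. mono_on {0..} (\<lambda>t. \<sigma> t \<omega>)) \<and>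
     (\<forall>t\<ge>0. \<forall>u\<ge>0. expectation (\<lambda>\<omega>. exp (- u * \<sigma> t \<omega>)) = exp (- t * u powr \<beta>))"

end

end

theory Submission
  imports Defs "HOL-Real_Asymp.Real_Asymp"
begin

text \<open>A path whose cells of width \<open>1 / m\<close> contain at most one large jump each is \<open>J\<^sub>1\<close>-close to its step
  approximation on the grid of mesh \<open>1 / m\<close>. Hence convergence in law follows from convergence of the
  values on grids together with a bound, uniform for large \<open>n\<close>, on the probability that some cell contains
  two large fluctuations; neither Prokhorov's theorem nor a metric for the topology is needed.

  The steps \<open>Z k\<close> of the walk \<open>S\<close> observed at the times \<open>\<tau> k\<close> are independent and identically distributed,
  with characteristic function \<open>E (\<phi> \<theta> ^ R 1)\<close>, where \<open>\<phi>\<close> is that of \<open>X 1\<close>. As \<open>E (s ^ R 1) = 1 - \<psi> (1 - s)\<close>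
  and \<open>n \<psi> (\<lambda> / b n) \<rightarrow> \<lambda> powr (\<alpha> / 2)\<close>, the increments over grid cells converge in law to those of \<open>B \<circ> \<sigma>\<close>,
  whose characteristic function is obtained by conditioning on \<open>\<sigma>\<close>. By Chebyshev's inequality given the \<open>R i\<close>,
  a cell of width \<open>1 / m\<close> contains a large fluctuation with probability \<open>O (1 / m)\<close>, so two of them with
  probability \<open>O (1 / m^2)\<close>, and a bounded time interval has only \<open>O (m)\<close> cells.\<close>

section \<open>Step approximations of paths\<close>

text \<open>The law of \<open>R 1\<close> is accessible only through its generating function on
  [0, 1], and its mean is infinite because \<alpha> / 2 < 1. Hence Chebyshev's bound, which is
  linear in the R i, cannot simply be averaged, and the complex number \<phi> \<theta> cannot simply
  be inserted into the generating function. One inequality meets both obstacles: min 1 y \<le> 2 *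
  (1 - exp (- y)) turns a bound by min 1 (c * R) into 2 * (1 - E (q ^ R)) with the real number q =
  exp (- c), that is, into a value of \<psi>. It gives the tail bound for the walk, and it permits
  replacing \<phi> (\<theta> / sqrt (b n)) by exp (- \<theta>^2 / (2 * b n)). On the topological
  side the Borel sets are generated by all J1-open sets. Membership in an open set is therefore
  rewritten as a countable condition on grid values, with tolerance 1 / (k + 1) on [0, k]. The same
  condition yields measurability of the random paths and the lower bounds for probabilities of open
  sets.\<close>

definition grid_index :: "nat \<Rightarrow> real \<Rightarrow> nat" where
  "grid_index m t = nat \<lfloor>real m * t\<rfloor>"

lemma grid_index_eq_iff:
  assumes "m > 0" "t \<ge> 0"
  shows "grid_index m t = j \<longleftrightarrow> real j / real m \<le> t \<and> t < real (Suc j) / real m"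
proof -
  have "grid_index m t = j \<longleftrightarrow> \<lfloor>real m * t\<rfloor> = int j"
    using assms unfolding grid_index_def by (simp add: eq_nat_nat_iff nat_eq_iff)
  also have "\<dots> \<longleftrightarrow> real j \<le> real m * t \<and> real m * t < real j + 1"
    by (simp add: floor_eq_iff)
  finally show ?thesis using assms by (simp add: field_simps)
qed

lemma grid_index_bounds:
  assumes "m > 0" "t \<ge> 0"
  shows "real (grid_index m t) / real m \<le> t" "t < real (Suc (grid_index m t)) / real m"
  using grid_index_eq_iff[OF assms, of "grid_index m t"] by auto

lemma grid_index_mono: "s \<le> t \<Longrightarrow> grid_index m s \<le> grid_index m t"
  unfolding grid_index_def by (intro nat_mono floor_mono mult_left_mono) auto

section \<open>Time changes: piecewise linear interpolation and inversion\<close>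

definition piecewise_linear :: "nat \<Rightarrow> (nat \<Rightarrow> real) \<Rightarrow> real \<Rightarrow> real" where
  "piecewise_linear m w t =
     w (grid_index m t) + (real m * t - real (grid_index m t)) * (w (Suc (grid_index m t)) - w (grid_index m t))"

lemma piecewise_linear_bounds:
  assumes "m > 0" "t \<ge> 0" "strict_mono w"
  shows "w (grid_index m t) \<le> piecewise_linear m w t"
    "piecewise_linear m w t < w (Suc (grid_index m t))"
proof -
  let ?j = "grid_index m t"
  have d: "w (Suc ?j) - w ?j > 0" using assms(3) by (simp add: strict_mono_def)
  have f: "0 \<le> real m * t - real ?j" "real m * t - real ?j < 1"
    using grid_index_bounds[OF assms(1,2)] assms(1) by (auto simp: field_simps)
  show "w ?j \<le> piecewise_linear m w t"
    unfolding piecewise_linear_def using d f by simp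
  have "(real m * t - real ?j) * (w (Suc ?j) - w ?j) < 1 * (w (Suc ?j) - w ?j)"
    by (rule mult_strict_right_mono) (use d f in auto)
  then show "piecewise_linear m w t < w (Suc ?j)" unfolding piecewise_linear_def by simp
qed

lemma piecewise_linear_time_change:
  assumes m: "m > 0" and w: "strict_mono w" "w 0 = 0" "filterlim w at_top sequentially"
  shows "piecewise_linear m w \<in> time_changes"
  unfolding time_changes_def
proof (intro CollectI conjI)
  let ?l = "piecewise_linear m w"
  show "strict_mono_on {0..} ?l"
  proof (intro strict_mono_onI)
    fix s t :: real assume s: "s \<in> {0..}" and t: "t \<in> {0..}" and "s < t"
    let ?i = "grid_index m s" and ?j = "grid_index m t"
    show "?l s < ?l t"
    proof (cases "?i = ?j")
      case True
      have "w ?j < w (Suc ?j)" using w(1) by (simp add: strict_mono_def)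
      moreover have "real m * s - real ?j < real m * t - real ?j" using \<open>s < t\<close> m by simp
      ultimately have "(real m * s - real ?j) * (w (Suc ?j) - w ?j) < (real m * t - real ?j) * (w (Suc ?j) - w ?j)"
        by (intro mult_strict_right_mono) auto
      then show ?thesis unfolding piecewise_linear_def True by simp
    next
      case False
      then have "Suc ?i \<le> ?j" using grid_index_mono[of s t m] \<open>s < t\<close> by simp
      then have "w (Suc ?i) \<le> w ?j" using w(1) by (simp add: strict_mono_less_eq)
      then show ?thesis
        using piecewise_linear_bounds(2)[OF m _ w(1), of s] piecewise_linear_bounds(1)[OF m _ w(1), of t] s t
        by auto
    qed
  qed
  show "?l ` {0..} = {0..}"
  proof (intro equalityI subsetI)
    fix y assume "y \<in> ?l ` {0..}"
    then obtain t where t: "t \<ge> 0" "y = ?l t" by auto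
    have "0 \<le> w (grid_index m t)" using w(1,2) strict_mono_less_eq[OF w(1), of 0] by auto
    then show "y \<in> {0..}" using piecewise_linear_bounds(1)[OF m t(1) w(1)] t by auto
  next
    fix y :: real assume y: "y \<in> {0..}"
    have ex: "\<exists>n. y < w n"
      using w(3) unfolding filterlim_at_top_dense by (metis eventually_sequentially order_refl)
    \<comment> \<open>As \<open>w 0\<close> = 0 \<le> y, this index is a successor
      \<open>Suc j\<close>, and y lies in the image of cell j; \<open>f\<close> below is its
      relative position there.\<close>
    define n where "n = (LEAST n. y < w n)"
    have n: "y < w n" "\<And>k. k < n \<Longrightarrow> w k \<le> y"
      unfolding n_def using LeastI_ex[OF ex] not_less_Least by (auto simp: not_less[symmetric])
    then obtain j where j: "n = Suc j" using w(2) y by (cases n) auto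
    have wj: "w j \<le> y" "y < w (Suc j)" using n j by auto
    define f where "f = (y - w j) / (w (Suc j) - w j)"
    have f: "0 \<le> f" "f < 1" unfolding f_def using wj by (auto simp: divide_simps)
    define t where "t = (real j + f) / real m"
    have t0: "t \<ge> 0" unfolding t_def using f by simp
    have "grid_index m t = j"
      using m f by (subst grid_index_eq_iff[OF m t0]) (auto simp: t_def divide_right_mono divide_strict_right_mono)
    then have "?l t = w j + f * (w (Suc j) - w j)"
      using m unfolding piecewise_linear_def t_def by simp
    also have "\<dots> = y" unfolding f_def using wj by simp
    finally show "y \<in> ?l ` {0..}" using t0 by (intro image_eqI[of _ _ t]) auto
  qed
qed

lemma time_changes_inverse:
  assumes l: "l \<in> time_changes"
  obtains k where "k \<in> time_changes" "\<And>t. t \<ge> 0 \<Longrightarrow> k (l t) = t" "\<And>t. t \<ge> 0 \<Longrightarrow> l (k t) = t"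
proof
  have inj: "inj_on l {0..}" and sm: "strict_mono_on {0..} l" and im: "l ` {0..} = {0..}"
    using l strict_mono_on_imp_inj_on unfolding time_changes_def by blast+
  let ?k = "inv_into {0..} l"
  show lk: "l (?k t) = t" if "t \<ge> 0" for t
    using that im by (intro f_inv_into_f) auto
  show kl: "?k (l t) = t" if "t \<ge> 0" for t
    using that inj by (intro inv_into_f_f) auto
  have k0: "?k t \<ge> 0" if "t \<ge> 0" for t
    using inv_into_into[of t l "{0..}"] im that by auto
  show "?k \<in> time_changes"
    unfolding time_changes_def
  proof (intro CollectI conjI strict_mono_onI)
    fix r s :: real assume "r \<in> {0..}" "s \<in> {0..}" "r < s"
    then show "?k r < ?k s"
      using strict_mono_on_less[OF sm, of "?k r" "?k s"] k0 lk by auto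
  next
    show "?k ` {0..} = {0..}"
    proof (intro equalityI subsetI)
      fix t :: real assume "t \<in> {0..}"
      then show "t \<in> ?k ` {0..}"
        using kl[of t] time_changes_nonneg[OF l, of t] by (intro image_eqI[of _ _ "l t"]) auto
    qed (use k0 in auto)
  qed
qed

text \<open>The inverse time change proves closeness in the other direction. It moves t by less than
  e, so the horizon has to drop by e for \<open>k t\<close> to stay within [0, T].\<close>

lemma J1_nbhd_sym:
  assumes y: "y \<in> J1_nbhd x T e" and x: "x \<in> skorohod_space"
  shows "x \<in> J1_nbhd y (T - e) e"
proof -
  obtain l where l: "l \<in> time_changes" "\<And>t. t \<ge> 0 \<Longrightarrow> \<bar>l t - t\<bar> < e"
    "\<And>t. t \<in> {0..T} \<Longrightarrow> \<bar>y (l t) - x t\<bar> < e"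
    using y unfolding J1_nbhd_def by blast
  obtain k where k: "k \<in> time_changes" "\<And>t. t \<ge> 0 \<Longrightarrow> k (l t) = t" "\<And>t. t \<ge> 0 \<Longrightarrow> l (k t) = t"
    using time_changes_inverse[OF l(1)] by blast
  have 1: "\<bar>k t - t\<bar> < e" if "t \<ge> 0" for t
    using l(2)[OF time_changes_nonneg[OF k(1) that]] k(3)[OF that] by (simp add: abs_minus_commute)
  have "\<bar>x (k t) - y t\<bar> < e" if "t \<in> {0..T - e}" for t
    using l(3)[of "k t"] 1[of t] time_changes_nonneg[OF k(1), of t] k(3)[of t] that
    by (auto simp: abs_minus_commute)
  then show ?thesis unfolding J1_nbhd_def using x k(1) 1 by blast
qed

section \<open>Step paths and cells with at most one jump\<close>

definition step_path :: "nat \<Rightarrow> (nat \<Rightarrow> real) \<Rightarrow> real \<Rightarrow> real" where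
  "step_path m v = (\<lambda>t\<in>{0..}. v (grid_index m t))"

lemma step_path_in_skorohod [simp]:
  assumes m: "m > 0"
  shows "step_path m v \<in> skorohod_space"
  unfolding skorohod_space_def
proof (intro CollectI conjI allI impI)
  show "step_path m v \<in> extensional {0..}" by (simp add: step_path_def)
next
  fix t :: real assume t: "t \<ge> 0"
  have "\<forall>\<^sub>F s in at_right t. s \<in> {t<..<real (Suc (grid_index m t)) / real m}"
    by (rule eventually_at_right_real) (use grid_index_bounds[OF m t] in auto)
  then have "\<forall>\<^sub>F s in at_right t. step_path m v s = step_path m v t"
  proof eventually_elim
    case (elim s)
    then have "grid_index m s = grid_index m t"
      using grid_index_bounds[OF m t] t by (subst grid_index_eq_iff[OF m]) auto
    then show ?case using elim t by (auto simp: step_path_def)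
  qed
  then show "(step_path m v \<longlongrightarrow> step_path m v t) (at_right t)" by (rule tendsto_eventually)
next
  fix t :: real assume t: "t > 0"
  \<comment> \<open>The largest natural number below m * t, so that t lies in (j / m, (j + 1) / m]:
    this is the cell just to the left of t even when t is a grid point.\<close>
  define j where "j = nat \<lceil>real m * t - 1\<rceil>"
  have "real j < real m * t" unfolding j_def using t m by (cases "real m * t > 1") (auto, linarith+)
  then have j1: "real j / real m < t" using m by (simp add: field_simps)
  have "real m * t \<le> real (Suc j)" unfolding j_def by linarith
  then have j2: "t \<le> real (Suc j) / real m" using m by (simp add: field_simps)
  have "\<forall>\<^sub>F s in at_left t. s \<in> {real j / real m<..<t}"
    by (rule eventually_at_left_real) (use j1 in auto)
  then have "\<forall>\<^sub>F s in at_left t. step_path m v s = v j"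
  proof eventually_elim
    case (elim s)
    have s0: "s \<ge> 0" using elim by (smt (verit) divide_nonneg_nonneg greaterThanLessThan_iff of_nat_0_le_iff)
    then have "grid_index m s = j"
      using elim j2 by (subst grid_index_eq_iff[OF m]) auto
    then show ?case using s0 by (auto simp: step_path_def)
  qed
  then show "\<exists>l. (step_path m v \<longlongrightarrow> l) (at_left t)" by (blast intro: tendsto_eventually)
qed

definition grid_values :: "nat \<Rightarrow> (real \<Rightarrow> real) \<Rightarrow> nat \<Rightarrow> real" where
  "grid_values m x j = x (real j / real m)"

text \<open>Since \<open>u\<close> is not the left end of its cell, these times are distinct, and a piecewise linear time
  change can move the jump of the step approximation at the right end of each cell to \<open>u\<close>.\<close>

definition one_jump_cells :: "nat \<Rightarrow> nat \<Rightarrow> real \<Rightarrow> (real \<Rightarrow> real) \<Rightarrow> bool" where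
  "one_jump_cells m K e x \<longleftrightarrow> (\<forall>j<K. \<exists>u. real j / real m < u \<and> u \<le> real (Suc j) / real m \<and>
     (\<forall>s\<in>{real j / real m..<u}. \<bar>x s - x (real j / real m)\<bar> < e) \<and>
     (\<forall>s\<in>{u..real (Suc j) / real m}. \<bar>x s - x (real (Suc j) / real m)\<bar> < e))"

text \<open>The time change takes the right end (j + 1) / m of cell j to u j. A time in cell j thus
  lands between u (j - 1) (or 0 if j = 0) and u j, which meets only the cells j - 1 and j. On either
  side of j / m the path is there within e of x (j / m), the value of the step path. No time moves
  by more than two cell widths, whence 2 / m < e.\<close>

lemma one_jump_cells_J1_nbhd:
  assumes m: "m > 0" and e: "2 / real m < e" and K: "real m * T < real K"
    and x: "x \<in> skorohod_space" and good: "one_jump_cells m K e x"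
  shows "x \<in> J1_nbhd (step_path m (grid_values m x)) T e"
proof -
  \<comment> \<open>From \<open>K\<close> on the closeness conditions are dropped, so that a
    \<open>u j\<close> exists for every cell and the time change covers the whole half-line.\<close>
  define P where "P = (\<lambda>j u. real j / real m < u \<and> u \<le> real (Suc j) / real m \<and> (j < K \<longrightarrow>
     (\<forall>s\<in>{real j / real m..<u}. \<bar>x s - x (real j / real m)\<bar> < e) \<and>
     (\<forall>s\<in>{u..real (Suc j) / real m}. \<bar>x s - x (real (Suc j) / real m)\<bar> < e)))"
  have "\<exists>u. P j u" for j
  proof (cases "j < K")
    case True
    then show ?thesis using good unfolding one_jump_cells_def P_def by blast
  next
    case False
    then show ?thesis unfolding P_def using m
      by (intro exI[of _ "real (Suc j) / real m"]) (auto simp: divide_strict_right_mono)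
  qed
  then obtain u where u: "\<And>j. P j (u j)" by metis
  have u1: "real j / real m < u j" "u j \<le> real (Suc j) / real m" for j
    using u[of j] unfolding P_def by auto
  have u2: "\<bar>x s - x (real j / real m)\<bar> < e" if "j < K" "s \<in> {real j / real m..<u j}" for j s
    using u[of j] that unfolding P_def by blast
  have u3: "\<bar>x s - x (real (Suc j) / real m)\<bar> < e" if "j < K" "s \<in> {u j..real (Suc j) / real m}" for j s
    using u[of j] that unfolding P_def by blast
  define w where "w = (\<lambda>j. case j of 0 \<Rightarrow> 0 | Suc i \<Rightarrow> u i)"
  have w0: "w 0 = 0" and wS: "w (Suc i) = u i" for i by (auto simp: w_def)
  have w_le: "w j \<le> real j / real m" for j
    using u1 by (cases j) (auto simp: w_def simp del: of_nat_Suc)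
  have w_ge: "(real j - 1) / real m \<le> w j" for j
    using u1(1)[of "j - 1"] m by (cases j) (auto simp: w_def)
  have "w j < w (Suc j)" for j using w_le[of j] u1(1)[of j] wS by simp
  then have sm: "strict_mono w" by (simp add: strict_mono_Suc_iff)
  have "filterlim (\<lambda>j. (real j - 1) / real m) at_top sequentially"
    using m by real_asymp
  then have "filterlim w at_top sequentially"
    by (rule filterlim_at_top_mono) (use w_ge in auto)
  with m sm w0 have tc: "piecewise_linear m w \<in> time_changes"
    by (intro piecewise_linear_time_change)
  have "\<bar>piecewise_linear m w t - t\<bar> < e" if t: "t \<ge> 0" for t
  proof -
    let ?j = "grid_index m t"
    have "\<bar>piecewise_linear m w t - t\<bar> \<le> 2 / real m"
      using piecewise_linear_bounds[OF m t sm] grid_index_bounds[OF m t] w_ge[of ?j] u1(2)[of ?j] wS[of ?j]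
      by (simp add: abs_le_iff add_divide_distrib diff_divide_distrib)
    then show ?thesis using e by simp
  qed
  moreover have "\<bar>x (piecewise_linear m w t) - step_path m (grid_values m x) t\<bar> < e" if t: "t \<in> {0..T}" for t
  proof -
    let ?j = "grid_index m t" and ?s = "piecewise_linear m w t"
    have t0: "t \<ge> 0" using t by simp
    have "real ?j \<le> real m * t" using grid_index_bounds(1)[OF m t0] m by (simp add: field_simps)
    also have "\<dots> \<le> real m * T" using t by (simp add: mult_left_mono)
    finally have jK: "?j < K" using K by simp
    have b: "w ?j \<le> ?s" "?s < u ?j" using piecewise_linear_bounds[OF m t0 sm] wS by auto
    have v: "step_path m (grid_values m x) t = x (real ?j / real m)"
      using t by (simp add: step_path_def grid_values_def)
    show ?thesis
    proof (cases "?s < real ?j / real m")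
      case True
      then obtain i where i: "?j = Suc i" using b w0 by (cases ?j) auto
      have "\<bar>x ?s - x (real (Suc i) / real m)\<bar> < e"
        using jK i b True wS by (intro u3) auto
      then show ?thesis unfolding v i .
    next
      case False
      then show ?thesis unfolding v using jK b by (intro u2) auto
    qed
  qed
  ultimately show ?thesis unfolding J1_nbhd_def using x tc by blast
qed

text \<open>One-sided limits give every t a ball on each side of which x oscillates by less than e,
  so that only t itself can carry a large jump. A Lebesgue number of the cover of [0, k] by these
  balls is a mesh below which each cell fits into one ball.\<close>

lemma skorohod_eventually_one_jump_cells:
  assumes x: "x \<in> skorohod_space" and e: "e > 0"
  shows "\<forall>\<^sub>F m in sequentially. one_jump_cells m (m * k) e x"
proof -
  have "\<exists>d>0. (\<forall>s r. t - d < s \<and> s < t \<and> t - d < r \<and> r < t \<and> 0 \<le> s \<and> 0 \<le> r \<longrightarrow> \<bar>x s - x r\<bar> < e) \<and>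
     (\<forall>s r. t \<le> s \<and> s < t + d \<and> t \<le> r \<and> r < t + d \<longrightarrow> \<bar>x s - x r\<bar> < e)" if t: "t \<in> {0..real k}" for t
  proof -
    have "(x \<longlongrightarrow> x t) (at_right t)" using x t by (simp add: skorohod_space_def)
    then have "\<forall>\<^sub>F s in at_right t. dist (x s) (x t) < e / 2" by (rule tendstoD) (use e in simp)
    then obtain d1 where d1: "d1 > t" "\<And>s. t < s \<Longrightarrow> s < d1 \<Longrightarrow> dist (x s) (x t) < e / 2"
      unfolding eventually_at_right_field by blast
    have d1': "dist (x s) (x t) < e / 2" if "t \<le> s" "s < d1" for s
      using d1(2)[of s] that e by (cases "s = t") auto
    have "\<exists>d2<t. \<forall>s r. d2 < s \<and> s < t \<and> d2 < r \<and> r < t \<and> 0 \<le> s \<and> 0 \<le> r \<longrightarrow> \<bar>x s - x r\<bar> < e"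
    proof (cases "t > 0")
      case True
      then obtain l where "(x \<longlongrightarrow> l) (at_left t)" using x by (auto simp: skorohod_space_def)
      then have "\<forall>\<^sub>F s in at_left t. dist (x s) l < e / 2" by (rule tendstoD) (use e in simp)
      then obtain d2 where d2: "d2 < t" "\<And>s. d2 < s \<Longrightarrow> s < t \<Longrightarrow> dist (x s) l < e / 2"
        unfolding eventually_at_left_field by blast
      have "\<bar>x s - x r\<bar> < e" if "d2 < s" "s < t" "d2 < r" "r < t" for s r
        using d2(2)[OF that(1,2)] d2(2)[OF that(3,4)] unfolding dist_real_def by linarith
      then show ?thesis using d2(1) by blast
    next
      case False
      then show ?thesis by (intro exI[of _ "t - 1"]) auto
    qed
    then obtain d2 where d2: "d2 < t"
      "\<And>s r. d2 < s \<Longrightarrow> s < t \<Longrightarrow> d2 < r \<Longrightarrow> r < t \<Longrightarrow> 0 \<le> s \<Longrightarrow> 0 \<le> r \<Longrightarrow> \<bar>x s - x r\<bar> < e" by blast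
    have "\<bar>x s - x r\<bar> < e" if "t \<le> s" "s < d1" "t \<le> r" "r < d1" for s r
      using d1'[OF that(1,2)] d1'[OF that(3,4)] unfolding dist_real_def by linarith
    then show ?thesis using d1(1) d2
      by (intro exI[of _ "min (d1 - t) (t - d2)"]) auto
  qed
  then have "\<forall>t\<in>{0..real k}. \<exists>d>0. (\<forall>s r. t - d < s \<and> s < t \<and> t - d < r \<and> r < t \<and> 0 \<le> s \<and> 0 \<le> r \<longrightarrow> \<bar>x s - x r\<bar> < e) \<and>
     (\<forall>s r. t \<le> s \<and> s < t + d \<and> t \<le> r \<and> r < t + d \<longrightarrow> \<bar>x s - x r\<bar> < e)" by blast
  from bchoice[OF this] obtain d where d: "\<And>t. t \<in> {0..real k} \<Longrightarrow> d t > 0"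
    and dl: "\<And>t s r. t \<in> {0..real k} \<Longrightarrow> t - d t < s \<Longrightarrow> s < t \<Longrightarrow> t - d t < r \<Longrightarrow> r < t \<Longrightarrow> 0 \<le> s \<Longrightarrow> 0 \<le> r \<Longrightarrow> \<bar>x s - x r\<bar> < e"
    and dr: "\<And>t s r. t \<in> {0..real k} \<Longrightarrow> t \<le> s \<Longrightarrow> s < t + d t \<Longrightarrow> t \<le> r \<Longrightarrow> r < t + d t \<Longrightarrow> \<bar>x s - x r\<bar> < e"
    by blast
  let ?C = "(\<lambda>t. ball t (d t)) ` {0..real k}"
  obtain \<rho> where \<rho>: "\<rho> > 0" "\<And>A. A \<subseteq> {0..real k} \<Longrightarrow> diameter A < \<rho> \<Longrightarrow> \<exists>B\<in>?C. A \<subseteq> B"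
  proof (rule Lebesgue_number_lemma[of "{0..real k}" ?C])
    show "{0..real k} \<subseteq> \<Union> ?C" using d by force
  qed auto
  have "\<forall>\<^sub>F m in sequentially. 1 / real m < \<rho>" using \<rho>(1) by real_asymp
  then show ?thesis
    using eventually_gt_at_top[of 0]
  proof eventually_elim
    case (elim m)
    show ?case
      unfolding one_jump_cells_def
    proof (intro allI impI)
      fix j assume j: "j < m * k"
      let ?a = "real j / real m" and ?b = "real (Suc j) / real m"
      have ab: "?a < ?b" "?b - ?a = 1 / real m" using elim by (auto simp: field_simps)
      have "real (Suc j) \<le> real (m * k)" using j by (simp only: of_nat_le_iff)
      then have bk: "?b \<le> real k" using elim by (simp add: field_simps)
      have a0: "0 \<le> ?a" by simp
      have "{?a..?b} \<subseteq> {0..real k}" using bk a0 by (auto simp del: of_nat_Suc)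
      moreover have "diameter {?a..?b} < \<rho>" using ab elim by (subst diameter_closed_interval) auto
      ultimately obtain t where t: "t \<in> {0..real k}" and sub: "{?a..?b} \<subseteq> ball t (d t)"
        using \<rho>(2) by blast
      have in': "t - d t < s \<and> s < t + d t" if "s \<in> {?a..?b}" for s
        using sub that by (force simp: ball_def dist_real_def)
      show "\<exists>u. ?a < u \<and> u \<le> ?b \<and> (\<forall>s\<in>{?a..<u}. \<bar>x s - x ?a\<bar> < e) \<and> (\<forall>s\<in>{u..?b}. \<bar>x s - x ?b\<bar> < e)"
      \<comment> \<open>A jump at t = ?a counts for the preceding cell. In that case, as when t lies
        outside the cell, all of [?a, ?b) is on one side of t and the right end serves as break
        point.\<close>
      proof (cases "?a < t \<and> t \<le> ?b")
        case True
        have "\<bar>x s - x ?a\<bar> < e" if "s \<in> {?a..<t}" for s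
          using that True in'[of s] in'[of ?a] ab a0 by (intro dl[OF t]) (auto simp del: of_nat_Suc intro: order_trans[OF a0])
        moreover have "\<bar>x s - x ?b\<bar> < e" if "s \<in> {t..?b}" for s
          using that True in'[of s] in'[of ?b] ab by (intro dr[OF t]) (auto simp del: of_nat_Suc)
        ultimately show ?thesis using True by blast
      next
        case False
        have "\<bar>x s - x ?a\<bar> < e" if s: "s \<in> {?a..<?b}" for s
        proof (cases "t \<le> ?a")
          case True
          then show ?thesis using s in'[of s] in'[of ?a] ab by (intro dr[OF t]) (auto simp del: of_nat_Suc)
        next
          case nle: False
          then show ?thesis using False s in'[of s] in'[of ?a] ab a0 by (intro dl[OF t]) (auto simp del: of_nat_Suc intro: order_trans[OF a0])
        qed
        moreover have "\<bar>x s - x ?b\<bar> < e" if "s \<in> {?b..?b}" for s using that e by simp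
        ultimately show ?thesis using ab by blast
      qed
    qed
  qed
qed

section \<open>The Borel sets of the Skorohod topology\<close>

text \<open>The sets \<open>J1_nbhd\<close> are neighbourhoods but are not shown to be open. This
  interior is open, by the triangle inequality \<open>J1_nbhd_trans\<close>.\<close>

definition J1_interior :: "(real \<Rightarrow> real) set \<Rightarrow> (real \<Rightarrow> real) set" where
  "J1_interior A = {y \<in> skorohod_space. \<exists>T. \<exists>e>0. J1_nbhd y T e \<subseteq> A}"

lemma openin_J1_interior: "openin skorohod_J1 (J1_interior A)"
  unfolding openin_skorohod_J1
proof (intro conjI ballI)
  fix y assume "y \<in> J1_interior A"
  then obtain T e where e: "e > 0" and sub: "J1_nbhd y T e \<subseteq> A" unfolding J1_interior_def by blast
  have "z \<in> J1_interior A" if z: "z \<in> J1_nbhd y T (e / 2)" for z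
  proof -
    have "J1_nbhd z (T + e / 2) (e / 2) \<subseteq> J1_nbhd y T e"
      using J1_nbhd_trans[OF z, of _ "e / 2"] by auto
    moreover have "z \<in> skorohod_space" using z by (simp add: J1_nbhd_def)
    moreover have "e / 2 > 0" using e by simp
    ultimately show ?thesis unfolding J1_interior_def using subset_trans[OF _ sub] by blast
  qed
  then show "\<exists>T. \<exists>e>0. J1_nbhd y T e \<subseteq> J1_interior A" using e by (meson half_gt_zero subsetI)
qed (auto simp: J1_interior_def)

lemma J1_interior_subset: "J1_interior A \<subseteq> A"
  unfolding J1_interior_def using J1_nbhd_self by blast

text \<open>With the identity as time change, changing the values in finitely many cells up to T by
  less than e stays in the neighbourhood. So open sets of paths pull back to open sets of sequences
  in the product topology.\<close>

lemma open_vimage_step_path: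
  assumes U: "openin skorohod_J1 U" and m: "m > 0"
  shows "open {v. step_path m v \<in> U}"
proof (subst open_subopen, intro ballI)
  fix v assume "v \<in> {v. step_path m v \<in> U}"
  then obtain T e where e: "e > 0" and sub: "J1_nbhd (step_path m v) T e \<subseteq> U"
    using U unfolding openin_skorohod_J1 by blast
  define W where "W = (\<Inter>j\<in>{..grid_index m T}. {v'. dist (v' j) (v j) < e})"
  have "open W"
    unfolding W_def by (intro open_INT ballI open_Collect_less continuous_intros) auto
  moreover have "v \<in> W" unfolding W_def using e by simp
  moreover have "W \<subseteq> {v. step_path m v \<in> U}"
  proof
    fix v' assume v': "v' \<in> W"
    have "step_path m v' \<in> J1_nbhd (step_path m v) T e"
      unfolding J1_nbhd_def
    proof (intro CollectI conjI bexI[OF _ time_changes_id] ballI)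
      fix t assume t: "t \<in> {0..T}"
      then have "grid_index m t \<in> {..grid_index m T}" using grid_index_mono[of t T m] by simp
      then have "dist (v' (grid_index m t)) (v (grid_index m t)) < e"
        using v' unfolding W_def by blast
      then show "\<bar>step_path m v' t - step_path m v t\<bar> < e"
        using t by (simp add: step_path_def dist_real_def)
    qed (use e m in auto)
    then show "v' \<in> {v. step_path m v \<in> U}" using sub by blast
  qed
  ultimately show "\<exists>S. open S \<and> v \<in> S \<and> S \<subseteq> {v. step_path m v \<in> U}" by blast
qed

text \<open>Stands in for the points of \<open>U\<close> at distance more than \<open>1 / Suc k\<close> from the complement.\<close>

definition J1_core :: "nat \<Rightarrow> (real \<Rightarrow> real) set \<Rightarrow> (real \<Rightarrow> real) set" where
  "J1_core k U = J1_interior {y \<in> skorohod_space. J1_nbhd y (real k) (1 / real (Suc k)) \<subseteq> U}"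

lemma openin_J1_core: "openin skorohod_J1 (J1_core k U)"
  unfolding J1_core_def by (rule openin_J1_interior)

lemma J1_coreD: "y \<in> J1_core k U \<Longrightarrow> J1_nbhd y (real k) (1 / real (Suc k)) \<subseteq> U"
  unfolding J1_core_def using J1_interior_subset by blast

lemma J1_core_mono:
  assumes "j \<le> k" shows "J1_core j U \<subseteq> J1_core k U"
proof -
  have "J1_nbhd y (real k) (1 / real (Suc k)) \<subseteq> J1_nbhd y (real j) (1 / real (Suc j))" for y
    using assms by (intro J1_nbhd_mono) (auto simp: frac_le)
  then have "{y \<in> skorohod_space. J1_nbhd y (real j) (1 / real (Suc j)) \<subseteq> U}
      \<subseteq> {y \<in> skorohod_space. J1_nbhd y (real k) (1 / real (Suc k)) \<subseteq> U}" by blast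
  then show ?thesis unfolding J1_core_def J1_interior_def by blast
qed

text \<open>One half of e is spent on moving from y to a nearby z, the other half on the
  neighbourhood of z of radius 1 / Suc k.\<close>

lemma J1_core_exhausts:
  assumes U: "openin skorohod_J1 U" and y: "y \<in> U"
  shows "\<exists>k. y \<in> J1_core k U"
proof -
  obtain T e where e: "e > 0" and sub: "J1_nbhd y T e \<subseteq> U" and ys: "y \<in> skorohod_space"
    using U y unfolding openin_skorohod_J1 by blast
  obtain k :: nat where k: "real k > max (T + e / 2) (2 / e)" using reals_Archimedean2 by blast
  have "1 / real (Suc k) \<le> e / 2" using k e by (simp add: field_simps)
  have "z \<in> {y \<in> skorohod_space. J1_nbhd y (real k) (1 / real (Suc k)) \<subseteq> U}"
    if z: "z \<in> J1_nbhd y T (e / 2)" for z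
  proof -
    have "J1_nbhd z (real k) (1 / real (Suc k)) \<subseteq> J1_nbhd z (T + e / 2) (e / 2)"
      using k \<open>1 / real (Suc k) \<le> e / 2\<close> by (intro J1_nbhd_mono) auto
    also have "\<dots> \<subseteq> J1_nbhd y T e" using J1_nbhd_trans[OF z, of _ "e / 2"] by auto
    finally show ?thesis using sub z unfolding J1_nbhd_def by blast
  qed
  moreover have "e / 2 > 0" using e by simp
  ultimately show ?thesis unfolding J1_core_def J1_interior_def using ys by blast
qed

lemma limitin_step_path:
  assumes x: "x \<in> skorohod_space"
  shows "limitin skorohod_J1 (\<lambda>m. step_path m (grid_values m x)) x sequentially"
  unfolding limitin_skorohod_J1_nbhd
proof (intro conjI allI impI x)
  fix T e :: real assume e: "e > 0"
  \<comment> \<open>The horizon exceeds T by e because \<open>J1_nbhd_sym\<close> will lose e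
    again.\<close>
  obtain k :: nat where k: "real k > T + e" using reals_Archimedean2 by blast
  have "\<forall>\<^sub>F m in sequentially. 2 / real m < e" using e by real_asymp
  then show "\<forall>\<^sub>F m in sequentially. step_path m (grid_values m x) \<in> J1_nbhd x T e"
    using skorohod_eventually_one_jump_cells[OF x e, of k] eventually_gt_at_top[of 0]
  proof eventually_elim
    case (elim m)
    then have "x \<in> J1_nbhd (step_path m (grid_values m x)) (T + e) e"
      using k x by (intro one_jump_cells_J1_nbhd[of m e "T + e" "m * k"]) auto
    then have "step_path m (grid_values m x) \<in> J1_nbhd x (T + e - e) e"
      using elim by (intro J1_nbhd_sym step_path_in_skorohod)
    then show ?case by simp
  qed
qed

text \<open>The condition on the right involves only countably many grid values, which makes it fit
  both for measurability and for the limit theorem. It works with a single \<open>k\<close> because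
  the core has a uniform tolerance: for fine meshes x is within 1 / Suc k of its step path on
  [0, k], so a step path in \<open>J1_core k U\<close> forces x into U. Conversely U is exhausted by
  open cores increasing in k, and the step paths converge to x. Writing \<open>Suc m\<close>
  excludes the meaningless mesh 1 / 0.\<close>

lemma in_open_iff_eventually_step_path_in_core:
  assumes U: "openin skorohod_J1 U" and x: "x \<in> skorohod_space"
  shows "x \<in> U \<longleftrightarrow> (\<exists>k. \<forall>m\<ge>k. step_path (Suc m) (grid_values (Suc m) x) \<in> J1_core k U)"
proof
  assume "x \<in> U"
  then obtain j where j: "x \<in> J1_core j U" using J1_core_exhausts[OF U] by blast
  have "\<forall>\<^sub>F m in sequentially. step_path m (grid_values m x) \<in> J1_core j U"
    using limitin_step_path[OF x] openin_J1_core j unfolding limitin_def by blast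
  then obtain i where i: "\<And>m. m \<ge> i \<Longrightarrow> step_path m (grid_values m x) \<in> J1_core j U"
    unfolding eventually_sequentially by blast
  then have "step_path (Suc m) (grid_values (Suc m) x) \<in> J1_core (max i j) U" if "m \<ge> max i j" for m
    using that i[of "Suc m"] J1_core_mono[of j "max i j" U] by auto
  then show "\<exists>k. \<forall>m\<ge>k. step_path (Suc m) (grid_values (Suc m) x) \<in> J1_core k U" by blast
next
  assume "\<exists>k. \<forall>m\<ge>k. step_path (Suc m) (grid_values (Suc m) x) \<in> J1_core k U"
  then obtain k where k: "\<And>m. m \<ge> k \<Longrightarrow> step_path (Suc m) (grid_values (Suc m) x) \<in> J1_core k U" by blast
  define e where "e = 1 / real (Suc k)"
  have e: "e > 0" unfolding e_def by simp
  have "\<forall>\<^sub>F m in sequentially. 2 / real m < e" using e by real_asymp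
  then have "\<forall>\<^sub>F m in sequentially. x \<in> U"
    using skorohod_eventually_one_jump_cells[OF x e, of "Suc k"] eventually_gt_at_top[of k]
  proof eventually_elim
    case (elim m)
    then have "x \<in> J1_nbhd (step_path m (grid_values m x)) (real k) e"
      using x by (intro one_jump_cells_J1_nbhd[of m e "real k" "m * Suc k"]) auto
    moreover obtain i where "m = Suc i" "i \<ge> k" using elim by (cases m) auto
    ultimately show ?case using J1_coreD[OF k[of i]] unfolding e_def by blast
  qed
  then show "x \<in> U" by simp
qed

lemma openin_in_borel_of: "openin T U \<Longrightarrow> U \<in> sets (borel_of T)"
  unfolding borel_of_def using openin_subset by (subst sets_measure_of) (auto intro: sigma_sets.Basic)

lemma measurable_continuous_map_borel_of:
  assumes "continuous_map T euclidean f" shows "f \<in> borel_measurable (borel_of T)"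
proof (rule borel_measurableI)
  fix S :: "'b set" assume "open S"
  then have "openin T {x \<in> topspace T. f x \<in> S}" using assms by (intro openin_continuous_map_preimage) auto
  moreover have "f -` S \<inter> space (borel_of T) = {x \<in> topspace T. f x \<in> S}"
    unfolding borel_of_def by (subst space_measure_of) (use openin_subset in auto)
  ultimately show "f -` S \<inter> space (borel_of T) \<in> sets (borel_of T)" using openin_in_borel_of by metis
qed

lemma grid_values_measurable:
  assumes "\<And>t. t \<ge> 0 \<Longrightarrow> (\<lambda>\<omega>. x \<omega> t) \<in> borel_measurable M"
  shows "(\<lambda>\<omega>. grid_values m (x \<omega>)) \<in> borel_measurable M"
  unfolding grid_values_def by (rule measurable_coordinatewise_then_product) (use assms in auto)

lemma step_path_event:
  assumes x: "\<And>t. t \<ge> 0 \<Longrightarrow> (\<lambda>\<omega>. x \<omega> t) \<in> borel_measurable M"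
    and U: "openin skorohod_J1 U" and m: "m > 0"
  shows "{\<omega> \<in> space M. step_path m (grid_values m (x \<omega>)) \<in> U} \<in> sets M"
proof -
  have "{\<omega> \<in> space M. step_path m (grid_values m (x \<omega>)) \<in> U}
      = (\<lambda>\<omega>. grid_values m (x \<omega>)) -` {v. step_path m v \<in> U} \<inter> space M" by auto
  then show ?thesis
    using measurable_sets[OF grid_values_measurable[OF x] borel_open[OF open_vimage_step_path[OF U m]]]
    by simp
qed

text \<open>Measurable coordinates make a random element for the Borel sets of J1, since preimages
  of open sets are countable unions of countable intersections of events about grid values.\<close>

lemma skorohod_measurable:
  assumes x: "\<And>\<omega>. \<omega> \<in> space M \<Longrightarrow> x \<omega> \<in> skorohod_space"
    and xm: "\<And>t. t \<ge> 0 \<Longrightarrow> (\<lambda>\<omega>. x \<omega> t) \<in> borel_measurable M"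
  shows "x \<in> measurable M (borel_of skorohod_J1)"
  unfolding borel_of_def
proof (rule measurable_measure_of)
  fix U assume "U \<in> {U. openin skorohod_J1 U}"
  then have U: "openin skorohod_J1 U" by simp
  have "x -` U \<inter> space M
      = (\<Union>k. \<Inter>m\<in>{k..}. {\<omega> \<in> space M. step_path (Suc m) (grid_values (Suc m) (x \<omega>)) \<in> J1_core k U})"
    using in_open_iff_eventually_step_path_in_core[OF U x] by fastforce
  also have "\<dots> \<in> sets M"
    by (intro sets.countable_UN sets.countable_INT subsetI image_subsetI) (auto intro!: step_path_event xm openin_J1_core)
  finally show "x -` U \<inter> space M \<in> sets M" .
qed (use x openin_subset[of skorohod_J1] in auto)

section \<open>A criterion for convergence in law\<close>

text \<open>The portmanteau implication from open sets to bounded continuous functions, in any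
  topological space. Composing with f carries the question to the real line, where lower bounds on
  open sets give convergence on all continuity sets and hence weak convergence.\<close>

lemma converges_in_law_open_sets:
  fixes X :: "nat \<Rightarrow> 'a \<Rightarrow> 'c" and Y :: "'b \<Rightarrow> 'c"
  assumes M: "\<And>n. prob_space (M n)" and X: "\<And>n. X n \<in> measurable (M n) (borel_of T)"
    and N: "prob_space N" and Y: "Y \<in> measurable N (borel_of T)"
    and liminf: "\<And>U c. openin T U \<Longrightarrow> c < measure N (Y -` U \<inter> space N) \<Longrightarrow>
        \<forall>\<^sub>F n in sequentially. c < measure (M n) (X n -` U \<inter> space (M n))"
  shows "converges_in_law T M X N Y"
  unfolding converges_in_law_def
proof (intro conjI allI impI M X N Y)
  fix f assume f: "continuous_map T euclideanreal f \<and> bounded (f ` topspace T)"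
  then have fm: "f \<in> borel_measurable (borel_of T)" by (intro measurable_continuous_map_borel_of) simp
  obtain C where C: "\<And>x. x \<in> topspace T \<Longrightarrow> \<bar>f x\<bar> \<le> C"
    using f unfolding bounded_real by blast
  have fX [measurable]: "(\<lambda>\<omega>. f (X n \<omega>)) \<in> borel_measurable (M n)" for n
    using measurable_compose[OF X fm] .
  have fY [measurable]: "(\<lambda>\<omega>. f (Y \<omega>)) \<in> borel_measurable N" using measurable_compose[OF Y fm] .
  have sp: "space (borel_of T) = topspace T"
    unfolding borel_of_def by (subst space_measure_of) (use openin_subset in auto)
  define \<mu> where "\<mu> = (\<lambda>n. distr (M n) borel (\<lambda>\<omega>. f (X n \<omega>)))"
  define \<mu>' where "\<mu>' = distr N borel (\<lambda>\<omega>. f (Y \<omega>))"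
  have \<mu>: "real_distribution (\<mu> n)" for n
    unfolding \<mu>_def by (intro prob_space.real_distribution_distr M) simp
  have \<mu>': "real_distribution \<mu>'"
    unfolding \<mu>'_def by (intro prob_space.real_distribution_distr N) simp
  interpret \<mu>': real_distribution \<mu>' by (rule \<mu>')
  have op: "\<forall>\<^sub>F n in sequentially. c < measure (\<mu> n) V" if V: "open V" and c: "c < measure \<mu>' V" for V c
  proof -
    let ?U = "{x \<in> topspace T. f x \<in> V}"
    have U: "openin T ?U" using f V by (intro openin_continuous_map_preimage) auto
    have "measure \<mu>' V = measure N (Y -` ?U \<inter> space N)"
      unfolding \<mu>'_def using V measurable_space[OF Y]
      by (subst measure_distr) (auto simp: sp intro!: arg_cong[where f="measure N"])
    moreover have "measure (\<mu> n) V = measure (M n) (X n -` ?U \<inter> space (M n))" for n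
      unfolding \<mu>_def using V measurable_space[OF X]
      by (subst measure_distr) (auto simp: sp intro!: arg_cong[where f="measure (M n)"])
    ultimately show ?thesis using liminf[OF U] c by simp
  qed
  \<comment> \<open>A null frontier lets the interior, an open set, replace A. Applied to the
    complement as well, this gives the upper bound too.\<close>
  have low: "\<forall>\<^sub>F n in sequentially. c < measure (\<mu> n) A"
    if A: "A \<in> sets borel" "measure \<mu>' (frontier A) = 0" and c: "c < measure \<mu>' A" for A c
  proof -
    have "measure \<mu>' A \<le> measure \<mu>' (interior A \<union> frontier A)"
      using A by (intro \<mu>'.finite_measure_mono) (auto simp: frontier_def closure_subset[THEN subsetD])
    also have "\<dots> \<le> measure \<mu>' (interior A) + measure \<mu>' (frontier A)"
      by (intro measure_Un_le) auto
    finally have "c < measure \<mu>' (interior A)" using A c by simp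
    then have "\<forall>\<^sub>F n in sequentially. c < measure (\<mu> n) (interior A)" by (intro op) auto
    then show ?thesis
    proof eventually_elim
      case (elim n)
      interpret \<mu>: real_distribution "\<mu> n" by (rule \<mu>)
      have "measure (\<mu> n) (interior A) \<le> measure (\<mu> n) A"
        using A by (intro \<mu>.finite_measure_mono interior_subset) auto
      then show ?case using elim by simp
    qed
  qed
  have "(\<lambda>n. measure (\<mu> n) A) \<longlonglongrightarrow> measure \<mu>' A"
    if A: "A \<in> sets borel" "measure \<mu>' (frontier A) = 0" for A
  proof (rule order_tendstoI)
    fix c assume "c < measure \<mu>' A" then show "\<forall>\<^sub>F n in sequentially. c < measure (\<mu> n) A"
      by (rule low[OF A])
  next
    fix c assume c: "measure \<mu>' A < c"
    have "measure \<mu>' (- A) = 1 - measure \<mu>' A" using \<mu>'.prob_compl[of A] A by (simp add: Compl_eq_Diff_UNIV)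
    then have "\<forall>\<^sub>F n in sequentially. 1 - c < measure (\<mu> n) (- A)"
      using A c by (intro low) (auto simp: frontier_complement)
    then show "\<forall>\<^sub>F n in sequentially. measure (\<mu> n) A < c"
    proof eventually_elim
      case (elim n)
      interpret \<mu>: real_distribution "\<mu> n" by (rule \<mu>)
      show ?case using \<mu>.prob_compl[of A] A elim by (simp add: Compl_eq_Diff_UNIV)
    qed
  qed
  then have wc: "weak_conv_m \<mu> \<mu>'"
    using \<mu> \<mu>' by (intro continuity_set_conv_imp_weak_conv) (auto simp: measure_def)
  \<comment> \<open>The identity clipped to [-C, C], where f takes its values: a test function that
    is bounded and continuous on the whole line.\<close>
  define h where "h = (\<lambda>x. max (- C) (min C x))"
  have h: "continuous_on UNIV h" unfolding h_def by (intro continuous_intros)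
  have "(\<lambda>n. LINT x|\<mu> n. h x) \<longlonglongrightarrow> (LINT x|\<mu>'. h x)"
  proof (rule weak_conv_imp_integral_bdd_continuous_conv[OF \<mu> \<mu>' wc])
    show "norm (h x) \<le> \<bar>C\<bar>" for x unfolding h_def by auto
    show "isCont h x" for x using h by (simp add: continuous_on_eq_continuous_at)
  qed
  moreover have "(LINT x|\<mu> n. h x) = (LINT \<omega>|M n. f (X n \<omega>))" for n
  proof -
    have "(LINT x|\<mu> n. h x) = (LINT \<omega>|M n. h (f (X n \<omega>)))"
      unfolding \<mu>_def by (rule integral_distr) (auto simp: h_def)
    also have "\<dots> = (LINT \<omega>|M n. f (X n \<omega>))"
      using C measurable_space[OF X] unfolding sp h_def by (intro Bochner_Integration.integral_cong) (auto simp: abs_le_iff, force+)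
    finally show ?thesis .
  qed
  moreover have "(LINT x|\<mu>'. h x) = (LINT \<omega>|N. f (Y \<omega>))"
  proof -
    have "(LINT x|\<mu>'. h x) = (LINT \<omega>|N. h (f (Y \<omega>)))"
      unfolding \<mu>'_def by (rule integral_distr) (auto simp: h_def)
    also have "\<dots> = (LINT \<omega>|N. f (Y \<omega>))"
      using C measurable_space[OF Y] unfolding sp h_def by (intro Bochner_Integration.integral_cong) (auto simp: abs_le_iff, force+)
    finally show ?thesis .
  qed
  ultimately show "(\<lambda>n. LINT \<omega>|M n. f (X n \<omega>)) \<longlonglongrightarrow> (LINT \<omega>|N. f (Y \<omega>))" by simp
qed

text \<open>The events \<open>E k\<close>, on which all step paths of Y of index at least k lie in
  \<open>J1_core k U\<close>, increase to the event that Y is in U. Hence one k and one fine grid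
  already give nearly the whole probability. On that fixed grid the convergence of grid values
  transfers the bound to \<open>X n\<close>. Off the exceptional set F, \<open>X n\<close> is so
  close to its step path that a step path in the core forces \<open>X n\<close> into U.\<close>

lemma converges_in_law_skorohod_J1:
  fixes X :: "nat \<Rightarrow> 'a \<Rightarrow> real \<Rightarrow> real" and Y :: "'b \<Rightarrow> real \<Rightarrow> real"
  assumes M: "prob_space M" and N: "prob_space N"
    and X: "\<And>n \<omega>. \<omega> \<in> space M \<Longrightarrow> X n \<omega> \<in> skorohod_space"
      "\<And>n t. t \<ge> 0 \<Longrightarrow> (\<lambda>\<omega>. X n \<omega> t) \<in> borel_measurable M"
    and Y: "\<And>\<omega>. \<omega> \<in> space N \<Longrightarrow> Y \<omega> \<in> skorohod_space"
      "\<And>t. t \<ge> 0 \<Longrightarrow> (\<lambda>\<omega>. Y \<omega> t) \<in> borel_measurable N"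
    and fdd: "\<And>m G c. m > 0 \<Longrightarrow> open G \<Longrightarrow> c < measure N {\<omega> \<in> space N. grid_values m (Y \<omega>) \<in> G} \<Longrightarrow>
      \<forall>\<^sub>F n in sequentially. c < measure M {\<omega> \<in> space M. grid_values m (X n \<omega>) \<in> G}"
    and jumps: "\<And>K e d. e > 0 \<Longrightarrow> d > 0 \<Longrightarrow> \<forall>\<^sub>F m in sequentially. \<forall>\<^sub>F n in sequentially.
      \<exists>F\<in>sets M. measure M F < d \<and> (\<forall>\<omega>\<in>space M - F. one_jump_cells m (m * K) e (X n \<omega>))"
  shows "converges_in_law skorohod_J1 (\<lambda>_. M) X N Y"
proof (rule converges_in_law_open_sets[OF M _ N])
  interpret M: prob_space M by (rule M)
  interpret N: prob_space N by (rule N)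
  show Xm: "X n \<in> measurable M (borel_of skorohod_J1)" for n by (intro skorohod_measurable X)
  show Ym: "Y \<in> measurable N (borel_of skorohod_J1)" by (intro skorohod_measurable Y)
  fix U c assume U: "openin skorohod_J1 U" and c: "c < measure N (Y -` U \<inter> space N)"
  \<comment> \<open>The gap c' - c is the probability allowed for the exceptional set.\<close>
  obtain c' where c': "c < c'" "c' < measure N (Y -` U \<inter> space N)" using dense[OF c] by blast
  define D where "D = (\<lambda>k m. {\<omega> \<in> space N. step_path (Suc m) (grid_values (Suc m) (Y \<omega>)) \<in> J1_core k U})"
  have D: "D k m \<in> sets N" for k m
    unfolding D_def by (intro step_path_event Y openin_J1_core zero_less_Suc)
  define E where "E = (\<lambda>k. \<Inter>m\<in>{k..}. D k m)"
  have E: "E k \<in> sets N" for k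
    unfolding E_def using D by (intro sets.countable_INT) auto
  have "D k m \<subseteq> D (Suc k) m" for k m
    unfolding D_def using J1_core_mono[of k "Suc k" U] by auto
  then have "E k \<subseteq> E (Suc k)" for k
    unfolding E_def by fastforce
  then have inc: "incseq E" by (rule incseq_SucI)
  have "(\<Union>k. E k) = Y -` U \<inter> space N"
    using in_open_iff_eventually_step_path_in_core[OF U Y(1)] unfolding E_def D_def by fastforce
  then have "(\<lambda>k. measure N (E k)) \<longlonglongrightarrow> measure N (Y -` U \<inter> space N)"
    using N.finite_Lim_measure_incseq[of E] inc E by auto
  then have "\<forall>\<^sub>F k in sequentially. c' < measure N (E k)" using c' by (intro order_tendstoD)
  then obtain k where k: "c' < measure N (E k)" unfolding eventually_sequentially by blast
  have kD: "c' < measure N (D k m)" if "m \<ge> k" for m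
    using k N.finite_measure_mono[of "E k" "D k m"] D[of k m] that unfolding E_def by fastforce
  define e where "e = 1 / real (Suc k)"
  have e: "e > 0" unfolding e_def by simp
  have "\<forall>\<^sub>F m in sequentially. 2 / real m < e" using e by real_asymp
  then have "\<forall>\<^sub>F m in sequentially. m > k \<and> 2 / real m < e \<and> (\<forall>\<^sub>F n in sequentially.
      \<exists>F\<in>sets M. measure M F < c' - c \<and> (\<forall>\<omega>\<in>space M - F. one_jump_cells m (m * Suc k) e (X n \<omega>)))"
    using eventually_gt_at_top[of k] jumps[OF e, of "c' - c" "Suc k"] c'
    by (intro eventually_conj) auto
  then obtain m where m: "m > k" "2 / real m < e" and F: "\<forall>\<^sub>F n in sequentially.
      \<exists>F\<in>sets M. measure M F < c' - c \<and> (\<forall>\<omega>\<in>space M - F. one_jump_cells m (m * Suc k) e (X n \<omega>))"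
    unfolding eventually_sequentially by blast
  have m0: "m > 0" using m by simp
  obtain i where i: "m = Suc i" "i \<ge> k" using m by (cases m) auto
  have "\<forall>\<^sub>F n in sequentially. c' < measure M {\<omega> \<in> space M. grid_values m (X n \<omega>) \<in> {v. step_path m v \<in> J1_core k U}}"
    using kD[OF i(2)] unfolding D_def i(1)[symmetric]
    by (intro fdd open_vimage_step_path openin_J1_core m0) simp
  then show "\<forall>\<^sub>F n in sequentially. c < measure M (X n -` U \<inter> space M)"
    using F
  proof eventually_elim
    case (elim n)
    then obtain F where F: "F \<in> sets M" "measure M F < c' - c"
      "\<And>\<omega>. \<omega> \<in> space M - F \<Longrightarrow> one_jump_cells m (m * Suc k) e (X n \<omega>)" by blast
    let ?A = "{\<omega> \<in> space M. grid_values m (X n \<omega>) \<in> {v. step_path m v \<in> J1_core k U}}"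
    have XU: "X n -` U \<inter> space M \<in> sets M" using Xm openin_in_borel_of[OF U] by (rule measurable_sets)
    have "?A \<subseteq> (X n -` U \<inter> space M) \<union> F"
    proof
      fix \<omega> assume \<omega>: "\<omega> \<in> ?A"
      show "\<omega> \<in> (X n -` U \<inter> space M) \<union> F"
      proof (cases "\<omega> \<in> F")
        case False
        then have "X n \<omega> \<in> J1_nbhd (step_path m (grid_values m (X n \<omega>))) (real k) e"
          using \<omega> m m0 X(1) F(3) by (intro one_jump_cells_J1_nbhd[of m e "real k" "m * Suc k"]) auto
        moreover have "J1_nbhd (step_path m (grid_values m (X n \<omega>))) (real k) e \<subseteq> U"
          using \<omega> J1_coreD unfolding e_def by blast
        ultimately show ?thesis using \<omega> by auto
      qed simp
    qed
    then have "measure M ?A \<le> measure M ((X n -` U \<inter> space M) \<union> F)"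
      using XU F by (intro M.finite_measure_mono) auto
    also have "\<dots> \<le> measure M (X n -` U \<inter> space M) + measure M F"
      using XU F by (intro measure_Un_le)
    finally show ?case using elim(1) F(2) by simp
  qed
qed

section \<open>Independence\<close>

context prob_space
begin

lemma expectation_freeze:
  fixes T :: "'a \<Rightarrow> 'c::countable" and f :: "'c \<Rightarrow> 'a \<Rightarrow> 'b::{banach, second_countable_topology}"
  assumes T [measurable]: "random_variable (count_space UNIV) T"
    and f [measurable]: "\<And>r. random_variable borel (f r)"
    and C: "\<And>r \<omega>. \<omega> \<in> space M \<Longrightarrow> norm (f r \<omega>) \<le> C"
    and ind: "\<And>r. (\<integral>\<omega>. indicat_real {\<omega>. T \<omega> = r} \<omega> *\<^sub>R f r \<omega> \<partial>M) =
      prob {\<omega> \<in> space M. T \<omega> = r} *\<^sub>R expectation (f r)"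
  shows "expectation (\<lambda>\<omega>. f (T \<omega>) \<omega>) = expectation (\<lambda>\<omega>. expectation (f (T \<omega>)))"
proof -
  define A where "A = (\<lambda>i::nat. {\<omega> \<in> space M. to_nat (T \<omega>) = i})"
  have A [measurable]: "A i \<in> events" for i unfolding A_def by simp
  have UA: "(\<Union>i. A i) = space M" unfolding A_def by auto
  have disj: "A i \<inter> A j = {}" if "i \<noteq> j" for i j unfolding A_def using that by auto
  have fT [measurable]: "(\<lambda>\<omega>. f (T \<omega>) \<omega>) \<in> borel_measurable M"
    by (rule measurable_compose_countable[OF f T])
  have eT [measurable]: "(\<lambda>\<omega>. expectation (f (T \<omega>))) \<in> borel_measurable M"
    by (rule measurable_compose[OF T]) simp
  have C0: "C \<ge> 0" using not_empty C[of _ undefined] norm_ge_zero order_trans by (metis ex_in_conv)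
  have eC: "norm (expectation (f r)) \<le> C" for r
  proof -
    have "norm (expectation (f r)) \<le> expectation (\<lambda>\<omega>. norm (f r \<omega>))" by (rule integral_norm_bound)
    also have "\<dots> \<le> expectation (\<lambda>_. C)"
      using C0 C by (intro integral_mono_AE integrable_const_bound[of _ C]) auto
    finally show ?thesis by (simp add: prob_space)
  qed
  have i1: "integrable M (\<lambda>\<omega>. f (T \<omega>) \<omega>)" using C by (intro integrable_const_bound[of _ C]) auto
  have i2: "integrable M (\<lambda>\<omega>. expectation (f (T \<omega>)))" using eC by (intro integrable_const_bound[of _ C]) auto
  have s: "expectation g = (\<Sum>i. LINT \<omega>:A i|M. g \<omega>)" if "integrable M g" for g :: "'a \<Rightarrow> 'b"
  proof -
    have "expectation g = (LINT \<omega>:(\<Union>i. A i)|M. g \<omega>)" unfolding UA by (rule set_integral_space[OF that, symmetric])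
    also have "\<dots> = (\<Sum>i. LINT \<omega>:A i|M. g \<omega>)"
      using that by (intro lebesgue_integral_countable_add A disj) (auto simp: UA set_integrable_def intro!: integrable_mult_indicator)
    finally show ?thesis .
  qed
  have "(LINT \<omega>:A i|M. f (T \<omega>) \<omega>) = (LINT \<omega>:A i|M. expectation (f (T \<omega>)))" for i
  proof (cases "\<exists>r::'c. to_nat r = i")
    case True
    then obtain r :: 'c where r: "to_nat r = i" by blast
    have "(LINT \<omega>:A i|M. f (T \<omega>) \<omega>) = (\<integral>\<omega>. indicat_real {\<omega>. T \<omega> = r} \<omega> *\<^sub>R f r \<omega> \<partial>M)"
      unfolding set_lebesgue_integral_def A_def
      by (rule Bochner_Integration.integral_cong) (auto simp: indicator_def r[symmetric])
    also have "\<dots> = prob {\<omega> \<in> space M. T \<omega> = r} *\<^sub>R expectation (f r)" by (rule ind)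
    also have "\<dots> = (\<integral>\<omega>. indicat_real {\<omega> \<in> space M. T \<omega> = r} \<omega> *\<^sub>R expectation (f r) \<partial>M)"
      by (subst integral_scaleR_left) (auto simp: less_top[symmetric] intro!: integrable_real_indicator)
    also have "\<dots> = (LINT \<omega>:A i|M. expectation (f (T \<omega>)))"
      unfolding set_lebesgue_integral_def A_def
      by (rule Bochner_Integration.integral_cong) (auto simp: indicator_def r[symmetric])
    finally show ?thesis .
  next
    case False
    then have "A i = {}" unfolding A_def by auto
    then show ?thesis by (simp add: set_lebesgue_integral_def)
  qed
  then show ?thesis by (simp add: s[OF i1] s[OF i2])
qed

lemma indep_processes_indep_var:
  assumes ind: "indep_processes I K X J L Y"
    and X: "\<And>i. i \<in> I \<Longrightarrow> random_variable K (X i)" and Y: "\<And>j. j \<in> J \<Longrightarrow> random_variable L (Y j)"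
    and F: "F \<in> measurable (PiM I (\<lambda>_. K)) S" and G: "G \<in> measurable (PiM J (\<lambda>_. L)) T"
  shows "indep_var S (\<lambda>\<omega>. F (\<lambda>i\<in>I. X i \<omega>)) T (\<lambda>\<omega>. G (\<lambda>j\<in>J. Y j \<omega>))"
  unfolding indep_var_eq
proof (intro conjI)
  let ?X = "\<lambda>\<omega>. \<lambda>i\<in>I. X i \<omega>" and ?Y = "\<lambda>\<omega>. \<lambda>j\<in>J. Y j \<omega>"
  have mX: "random_variable (PiM I (\<lambda>_. K)) ?X" and mY: "random_variable (PiM J (\<lambda>_. L)) ?Y"
    using X Y by (auto intro!: measurable_restrict)
  show "random_variable S (\<lambda>\<omega>. F (?X \<omega>))" using mX F by (rule measurable_compose)
  show "random_variable T (\<lambda>\<omega>. G (?Y \<omega>))" using mY G by (rule measurable_compose)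
  let ?VX = "vimage_algebra (space M) ?X (PiM I (\<lambda>_. K))" and ?VY = "vimage_algebra (space M) ?Y (PiM J (\<lambda>_. L))"
  have vX: "(\<lambda>\<omega>. F (?X \<omega>)) \<in> measurable ?VX S"
    by (rule measurable_compose[OF measurable_vimage_algebra1 F]) (use measurable_space[OF mX] in auto)
  have vY: "(\<lambda>\<omega>. G (?Y \<omega>)) \<in> measurable ?VY T"
    by (rule measurable_compose[OF measurable_vimage_algebra1 G]) (use measurable_space[OF mY] in auto)
  have "sigma_sets (space M) {(\<lambda>\<omega>. F (?X \<omega>)) -` A \<inter> space M |A. A \<in> sets S} \<subseteq> sets ?VX"
    using measurable_sets[OF vX] by (intro sets.sigma_sets_subset[of _ ?VX, simplified]) auto
  moreover have "sigma_sets (space M) {(\<lambda>\<omega>. G (?Y \<omega>)) -` A \<inter> space M |A. A \<in> sets T} \<subseteq> sets ?VY"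
    using measurable_sets[OF vY] by (intro sets.sigma_sets_subset[of _ ?VY, simplified]) auto
  ultimately show "indep_set (sigma_sets (space M) {(\<lambda>\<omega>. F (?X \<omega>)) -` A \<inter> space M |A. A \<in> sets S})
     (sigma_sets (space M) {(\<lambda>\<omega>. G (?Y \<omega>)) -` A \<inter> space M |A. A \<in> sets T})"
    using ind unfolding indep_processes_def indep_set_def
    by (elim indep_sets_mono_sets) (auto split: bool.split)
qed

text \<open>Indicators of closed sets are limits of continuous functions, and the closed sets are an
  intersection-stable generator of the Borel sets. Allowing continuous test functions only matters
  for \<open>Y\<close>, whose product formula arises as a limit over discretised times.\<close>

lemma indep_vars_if_expectation_prod:
  fixes V :: "nat \<Rightarrow> 'a \<Rightarrow> real"
  assumes V [measurable]: "\<And>i. random_variable borel (V i)"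
    and eq: "\<And>n g. (\<And>i::nat. continuous_on UNIV (g i)) \<Longrightarrow> (\<And>i x. \<bar>g i x\<bar> \<le> 1) \<Longrightarrow>
      expectation (\<lambda>\<omega>. \<Prod>i<n. g i (V i \<omega>) :: real) = (\<Prod>i<n. expectation (\<lambda>\<omega>. g i (V i \<omega>)))"
  shows "indep_vars (\<lambda>_. borel) V UNIV"
proof -
  define F where "F = (\<lambda>i. {V i -` A \<inter> space M | A. A \<in> Collect closed})"
  have "indep_sets F UNIV"
  proof (rule indep_setsI)
    show "F i \<subseteq> events" for i unfolding F_def by auto
  next
    fix A and J :: "nat set" assume J: "J \<noteq> {}" "J \<subseteq> UNIV" "finite J" and A: "\<forall>j\<in>J. A j \<in> F j"
    obtain n where n: "J \<subseteq> {..<n}" using finite_nat_iff_bounded J(3) by blast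
    have "\<forall>j\<in>J. \<exists>C. closed C \<and> A j = V j -` C \<inter> space M" using A unfolding F_def by blast
    from bchoice[OF this] obtain C' where C': "\<And>j. j \<in> J \<Longrightarrow> closed (C' j) \<and> A j = V j -` C' j \<inter> space M" by blast
    \<comment> \<open>Indices outside J receive the whole line, so that the product over the initial
      segment reduces to the one over J.\<close>
    define C where "C = (\<lambda>j. if j \<in> J then C' j else UNIV)"
    have C: "closed (C j)" for j using C' unfolding C_def by simp
    have Cm [measurable]: "C j \<in> sets borel" for j using C by simp
    \<comment> \<open>Decreases to the indicator of \<open>C j\<close> as k grows. The empty set is
      treated apart because \<open>infdist x {}\<close> is 0, which would give the constant
      1.\<close>
    define g where "g = (\<lambda>(k::nat) j x. if C j = {} then 0 else max 0 (1 - real k * infdist x (C j)))"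
    have gc: "continuous_on UNIV (g k j)" for k j
      unfolding g_def by (cases "C j = {}") (auto intro!: continuous_intros)
    have g1: "\<bar>g k j x\<bar> \<le> 1" for k j x
      unfolding g_def using infdist_nonneg[of x "C j"] by auto
    have glim: "(\<lambda>k. g k j x) \<longlonglongrightarrow> indicator (C j) x" for j x
    proof (cases "x \<in> C j")
      case True
      then have "g k j x = 1" for k unfolding g_def by auto
      then show ?thesis using True by simp
    next
      case F: False
      show ?thesis
      proof (cases "C j = {}")
        case True then show ?thesis unfolding g_def by simp
      next
        case False
        then have "infdist x (C j) > 0"
          using F C infdist_pos_not_in_closed by blast
        then have "\<forall>\<^sub>F k in sequentially. 1 - real k * infdist x (C j) < 0" by real_asymp
        then have "\<forall>\<^sub>F k in sequentially. g k j x = 0"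
          by eventually_elim (auto simp: g_def)
        then show ?thesis using F by (simp add: tendsto_eventually)
      qed
    qed
    have [measurable]: "g k j \<in> borel_measurable borel" for k j
      using gc by (rule borel_measurable_continuous_onI)
    have L: "(\<lambda>k. expectation (\<lambda>\<omega>. \<Prod>i<n. g k i (V i \<omega>))) \<longlonglongrightarrow> expectation (\<lambda>\<omega>. \<Prod>i<n. indicator (C i) (V i \<omega>))"
    proof (rule integral_dominated_convergence[where w="\<lambda>_. 1"])
      show "AE \<omega> in M. norm (\<Prod>i<n. g k i (V i \<omega>)) \<le> 1" for k
        using g1 by (auto simp: abs_prod intro!: prod_le_1)
      show "AE \<omega> in M. (\<lambda>k. \<Prod>i<n. g k i (V i \<omega>)) \<longlonglongrightarrow> (\<Prod>i<n. indicator (C i) (V i \<omega>))"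
        by (intro AE_I2 tendsto_prod glim)
    qed (use C in auto)
    have R: "(\<lambda>k. \<Prod>i<n. expectation (\<lambda>\<omega>. g k i (V i \<omega>))) \<longlonglongrightarrow> (\<Prod>i<n. expectation (\<lambda>\<omega>. indicator (C i) (V i \<omega>)))"
      by (intro tendsto_prod integral_dominated_convergence[where w="\<lambda>_. 1"]) (use C glim g1 in auto)
    have "expectation (\<lambda>\<omega>. \<Prod>i<n. indicator (C i) (V i \<omega>)) = (\<Prod>i<n. expectation (\<lambda>\<omega>. indicat_real (C i) (V i \<omega>)))"
      using LIMSEQ_unique[OF L] R eq[OF gc g1] by simp
    also have "\<dots> = (\<Prod>i<n. prob (V i -` C i \<inter> space M))"
    proof (rule prod.cong[OF refl])
      fix i
      have "expectation (\<lambda>\<omega>. indicat_real (C i) (V i \<omega>)) = expectation (indicator (V i -` C i \<inter> space M))"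
        by (rule Bochner_Integration.integral_cong) (auto simp: indicator_def)
      then show "expectation (\<lambda>\<omega>. indicat_real (C i) (V i \<omega>)) = prob (V i -` C i \<inter> space M)"
        by simp
    qed
    also have "\<dots> = (\<Prod>i\<in>J. prob (A i))"
      using n C' by (intro prod.mono_neutral_cong_right) (auto simp: C_def prob_space)
    finally have 1: "expectation (\<lambda>\<omega>. \<Prod>i<n. indicat_real (C i) (V i \<omega>)) = (\<Prod>i\<in>J. prob (A i))" .
    have "(\<Inter>j\<in>J. A j) \<subseteq> space M" using J(1) C' by blast
    then have "expectation (\<lambda>\<omega>. \<Prod>i<n. indicat_real (C i) (V i \<omega>)) = expectation (indicator (\<Inter>j\<in>J. A j))"
    proof (intro Bochner_Integration.integral_cong refl)
      fix \<omega> assume \<omega>: "\<omega> \<in> space M"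
      have "(\<Prod>i<n. indicat_real (C i) (V i \<omega>)) = (\<Prod>i\<in>J. indicat_real (C' i) (V i \<omega>))"
        using n by (intro prod.mono_neutral_cong_right) (auto simp: C_def)
      also have "\<dots> = indicator (\<Inter>j\<in>J. A j) \<omega>"
        using C' \<omega> J(3) by (auto simp: indicator_def)
      finally show "(\<Prod>i<n. indicat_real (C i) (V i \<omega>)) = indicator (\<Inter>j\<in>J. A j) \<omega>" .
    qed
    moreover have "(\<Inter>j\<in>J. A j) \<in> events" using J C' by (intro sets.finite_INT) auto
    ultimately show "prob (\<Inter>j\<in>J. A j) = (\<Prod>j\<in>J. prob (A j))" using 1 by simp
  qed
  moreover have "Int_stable (F i)" for i
  proof (rule Int_stableI)
    fix a b assume "a \<in> F i" "b \<in> F i"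
    then obtain A B where "closed A" "closed B" "a = V i -` A \<inter> space M" "b = V i -` B \<inter> space M"
      unfolding F_def by blast
    then show "a \<inter> b \<in> F i" unfolding F_def by (auto intro!: exI[of _ "A \<inter> B"])
  qed
  ultimately have "indep_sets (\<lambda>i. sigma_sets (space M) (F i)) UNIV" by (rule indep_sets_sigma)
  moreover have "{V i -` A \<inter> space M | A. A \<in> sets borel} = sigma_sets (space M) (F i)" for i
    unfolding F_def borel_eq_closed
    by (subst sigma_sets_vimage_commute[symmetric, of _ _ UNIV]) auto
  ultimately show ?thesis unfolding indep_vars_def2 using V by simp
qed

end

section \<open>Weak convergence of sequences of independent variables\<close>

lemma indep_coordinates_PiM:
  assumes "\<And>i. prob_space (\<Omega> i)"
  shows "prob_space.indep_vars (PiM UNIV \<Omega>) \<Omega> (\<lambda>i x. x i) UNIV"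
proof -
  interpret P: prob_space "PiM UNIV \<Omega>" by (intro prob_space_PiM assms)
  show ?thesis
    by (subst P.indep_vars_iff_distr_eq_PiM) (auto simp: distr_PiM_component assms restrict_def distr_id cong: PiM_cong)
qed

text \<open>Levy's continuity theorem gives weak convergence of each coordinate, and Skorohod's
  representation turns it into pointwise convergence on a space of its own. On the product of these
  spaces the coordinates are independent, so the joint laws are the original ones, while the
  sequences converge pointwise in the product topology. For an open G the claim is then Fatou's
  lemma for events.\<close>

lemma indep_char_tendsto_liminf_open:
  fixes V :: "nat \<Rightarrow> nat \<Rightarrow> 'a \<Rightarrow> real" and W :: "nat \<Rightarrow> 'b \<Rightarrow> real"
  assumes M: "prob_space M" and N: "prob_space N"
    and V: "\<And>n. prob_space.indep_vars M (\<lambda>_. borel) (V n) UNIV"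
    and W: "prob_space.indep_vars N (\<lambda>_. borel) W UNIV"
    and conv: "\<And>i \<theta>. (\<lambda>n. char (distr M borel (V n i)) \<theta>) \<longlonglongrightarrow> char (distr N borel (W i)) \<theta>"
    and G: "open G" and c: "c < measure N {\<omega> \<in> space N. (\<lambda>i. W i \<omega>) \<in> G}"
  shows "\<forall>\<^sub>F n in sequentially. c < measure M {\<omega> \<in> space M. (\<lambda>i. V n i \<omega>) \<in> G}"
proof -
  interpret M: prob_space M by (rule M)
  interpret N: prob_space N by (rule N)
  have Vm [measurable]: "V n i \<in> borel_measurable M" for n i using V unfolding M.indep_vars_def2 by simp
  have Wm [measurable]: "W i \<in> borel_measurable N" for i using W unfolding N.indep_vars_def2 by simp
  have "\<exists>(\<Omega>::real measure) (Ys::nat \<Rightarrow> real \<Rightarrow> real) Y. prob_space \<Omega> \<and> (\<forall>n. Ys n \<in> measurable \<Omega> borel) \<and>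
      (\<forall>n. distr \<Omega> borel (Ys n) = distr M borel (V n i)) \<and> Y \<in> measurable \<Omega> lborel \<and>
      distr \<Omega> borel Y = distr N borel (W i) \<and> (\<forall>x\<in>space \<Omega>. (\<lambda>n. Ys n x) \<longlonglongrightarrow> Y x)" (is "?Sk i") for i
  proof (rule Skorohod)
    show 1: "real_distribution (distr M borel (V n i))" for n by (rule M.real_distribution_distr) simp
    show 2: "real_distribution (distr N borel (W i))" by (rule N.real_distribution_distr) simp
    show "weak_conv_m (\<lambda>n. distr M borel (V n i)) (distr N borel (W i))"
      by (rule levy_continuity[OF 1 2 conv])
  qed
  then have "\<forall>i. ?Sk i" by blast
  then obtain \<Omega> :: "nat \<Rightarrow> real measure" and Ys :: "nat \<Rightarrow> nat \<Rightarrow> real \<Rightarrow> real" and Y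
    where *: "\<forall>i. prob_space (\<Omega> i) \<and> (\<forall>n. Ys i n \<in> measurable (\<Omega> i) borel) \<and>
      (\<forall>n. distr (\<Omega> i) borel (Ys i n) = distr M borel (V n i)) \<and> Y i \<in> measurable (\<Omega> i) lborel \<and>
      distr (\<Omega> i) borel (Y i) = distr N borel (W i) \<and> (\<forall>x\<in>space (\<Omega> i). (\<lambda>n. Ys i n x) \<longlonglongrightarrow> Y i x)"
    unfolding choice_iff by blast
  have \<Omega>: "prob_space (\<Omega> i)" for i using * by blast
  have Ysm [measurable]: "Ys i n \<in> borel_measurable (\<Omega> i)" for i n using * by blast
  have Yd: "distr (\<Omega> i) borel (Ys i n) = distr M borel (V n i)" "distr (\<Omega> i) borel (Y i) = distr N borel (W i)" for i n
    using * by blast+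
  have Ym [measurable]: "Y i \<in> borel_measurable (\<Omega> i)" for i using * by simp
  have lim: "(\<lambda>n. Ys i n x) \<longlonglongrightarrow> Y i x" if "x \<in> space (\<Omega> i)" for i x using * that by blast
  define P where "P = PiM UNIV \<Omega>"
  interpret P: prob_space P unfolding P_def by (intro prob_space_PiM \<Omega>)
  have co [measurable]: "(\<lambda>x. x i) \<in> measurable P (\<Omega> i)" for i unfolding P_def by simp
  \<comment> \<open>The joint law of an independent sequence is the product of its marginals, so the
    representing variables on P have the law of the given sequence.\<close>
  have transfer: "measure Q {\<omega> \<in> space Q. (\<lambda>i. U i \<omega>) \<in> G} = measure P {x \<in> space P. (\<lambda>i. y i (x i)) \<in> G}"
    if Q: "prob_space Q" and U: "prob_space.indep_vars Q (\<lambda>_. borel) U UNIV"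
      and y: "\<And>i. y i \<in> borel_measurable (\<Omega> i)"
      and d: "\<And>i. distr (\<Omega> i) borel (y i) = distr Q borel (U i)"
    for Q :: "'d measure" and U :: "nat \<Rightarrow> 'd \<Rightarrow> real" and y
  proof -
    interpret Q: prob_space Q by (rule Q)
    have Um [measurable]: "U i \<in> borel_measurable Q" for i using U unfolding Q.indep_vars_def2 by simp
    note y [measurable]
    have ym: "(\<lambda>x. y i (x i)) \<in> borel_measurable P" for i using measurable_compose[OF co y] .
    have di: "distr P borel (\<lambda>x. y i (x i)) = distr Q borel (U i)" for i
    proof -
      have "distr P borel (\<lambda>x. y i (x i)) = distr (distr P (\<Omega> i) (\<lambda>x. x i)) borel (y i)"
        by (subst distr_distr) (auto simp: comp_def)
      also have "distr P (\<Omega> i) (\<lambda>x. x i) = \<Omega> i" unfolding P_def by (rule distr_PiM_component[OF \<Omega>]) simp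
      finally show ?thesis using d by simp
    qed
    have "P.indep_vars (\<lambda>_. borel) (\<lambda>i x. y i (x i)) UNIV"
      unfolding P_def
      by (rule prob_space.indep_vars_compose2[OF prob_space_PiM[OF \<Omega>] indep_coordinates_PiM[OF \<Omega>]]) (auto intro: y)
    then have "distr P (PiM UNIV (\<lambda>_. borel)) (\<lambda>x. \<lambda>i\<in>UNIV. y i (x i)) = PiM UNIV (\<lambda>i. distr P borel (\<lambda>x. y i (x i)))"
      using ym by (subst (asm) P.indep_vars_iff_distr_eq_PiM) auto
    also have "\<dots> = PiM UNIV (\<lambda>i. distr Q borel (U i))" by (simp add: di)
    also have "PiM UNIV (\<lambda>i. distr Q borel (U i)) = distr Q (PiM UNIV (\<lambda>_. borel)) (\<lambda>\<omega>. \<lambda>i\<in>UNIV. U i \<omega>)"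
      using U by (subst (asm) Q.indep_vars_iff_distr_eq_PiM) auto
    finally have eq: "distr P (PiM UNIV (\<lambda>_. borel)) (\<lambda>x i. y i (x i)) = distr Q (PiM UNIV (\<lambda>_. borel)) (\<lambda>\<omega> i. U i \<omega>)"
      by (simp add: restrict_def)
    have Gm: "G \<in> sets (PiM UNIV (\<lambda>_. borel))"
      using borel_open[OF G] sets_PiM_equal_borel by blast
    have 1: "(\<lambda>x i. y i (x i)) \<in> measurable P (PiM UNIV (\<lambda>_. borel))"
      using ym by (intro measurable_PiM_single') auto
    have 2: "(\<lambda>\<omega> i. U i \<omega>) \<in> measurable Q (PiM UNIV (\<lambda>_. borel))"
      by (intro measurable_PiM_single') auto
    have "measure (distr P (PiM UNIV (\<lambda>_. borel)) (\<lambda>x i. y i (x i))) G = measure (distr Q (PiM UNIV (\<lambda>_. borel)) (\<lambda>\<omega> i. U i \<omega>)) G"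
      using eq by simp
    then show ?thesis
      by (simp add: measure_distr[OF 1 Gm] measure_distr[OF 2 Gm] vimage_def Int_def conj_commute)
  qed
  have ev: "{x \<in> space P. (\<lambda>i. y i (x i)) \<in> G} \<in> sets P" if "\<And>i. y i \<in> borel_measurable (\<Omega> i)" for y
  proof -
    have "(\<lambda>x i. y i (x i)) \<in> borel_measurable P"
      using measurable_compose[OF co that] by (rule measurable_coordinatewise_then_product)
    from measurable_sets[OF this borel_open[OF G]] show ?thesis
      by (simp add: vimage_def Int_def conj_commute)
  qed
  define A where "A = (\<lambda>n. {x \<in> space P. (\<lambda>i. Ys i n (x i)) \<in> G})"
  \<comment> \<open>A convergent sequence with limit in the open set G is eventually in G, so the
    limit event is contained in the increasing union of the \<open>E j\<close>, while
    \<open>E j\<close> is contained in \<open>A j\<close>.\<close>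
  define E where "E = (\<lambda>j. \<Inter>n\<in>{j..}. A n)"
  have A: "A n \<in> sets P" for n unfolding A_def by (rule ev) simp
  have E: "E j \<in> sets P" for j unfolding E_def using A by (intro sets.countable_INT) auto
  have inc: "incseq E" unfolding E_def by (intro incseq_SucI) fastforce
  have sub: "{x \<in> space P. (\<lambda>i. Y i (x i)) \<in> G} \<subseteq> (\<Union>j. E j)"
  proof
    fix x assume x: "x \<in> {x \<in> space P. (\<lambda>i. Y i (x i)) \<in> G}"
    then have "x i \<in> space (\<Omega> i)" for i unfolding P_def by (auto simp: space_PiM)
    then have "(\<lambda>n i. Ys i n (x i)) \<longlonglongrightarrow> (\<lambda>i. Y i (x i))"
      using lim unfolding limitin_canonical_iff[symmetric] euclidean_product_topology[symmetric] limitin_componentwise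
      by auto
    then have "\<forall>\<^sub>F n in sequentially. (\<lambda>i. Ys i n (x i)) \<in> G"
      using x G by (intro topological_tendstoD) auto
    then show "x \<in> (\<Union>j. E j)" using x unfolding E_def A_def eventually_sequentially by auto
  qed
  have "c < P.prob {x \<in> space P. (\<lambda>i. Y i (x i)) \<in> G}"
    using c transfer[OF N W Ym Yd(2)] by simp
  also have "\<dots> \<le> P.prob (\<Union>j. E j)" using sub E by (intro P.finite_measure_mono) auto
  finally have "c < P.prob (\<Union>j. E j)" .
  moreover have "(\<lambda>j. P.prob (E j)) \<longlonglongrightarrow> P.prob (\<Union>j. E j)"
    using inc E by (intro P.finite_Lim_measure_incseq) auto
  ultimately have "\<forall>\<^sub>F j in sequentially. c < P.prob (E j)" by (rule order_tendstoD(1)[rotated])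
  then show ?thesis
  proof eventually_elim
    case (elim j)
    have "P.prob (E j) \<le> P.prob (A j)" unfolding E_def using A by (intro P.finite_measure_mono) (auto simp: E_def)
    also have "\<dots> = M.prob {\<omega> \<in> space M. (\<lambda>i. V j i \<omega>) \<in> G}"
      unfolding A_def using transfer[OF M V Ysm Yd(1)] by simp
    finally show ?case using elim by simp
  qed
qed

section \<open>Two large fluctuations of a sum of independent variables\<close>

context prob_space
begin

lemma indep_past_future:
  fixes Z :: "nat \<Rightarrow> 'a \<Rightarrow> real"
  assumes Z: "indep_vars (\<lambda>_. borel) Z {1..}"
    and p: "{z \<in> space (PiM {a<..r} (\<lambda>_. borel)). p z} \<in> sets (PiM {a<..r} (\<lambda>_. borel))"
    and f: "{z \<in> space (PiM {r<..b} (\<lambda>_. borel)). f z} \<in> sets (PiM {r<..b} (\<lambda>_. borel))"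
  shows "prob {\<omega> \<in> space M. p (\<lambda>k\<in>{a<..r}. Z k \<omega>) \<and> f (\<lambda>k\<in>{r<..b}. Z k \<omega>)} =
    prob {\<omega> \<in> space M. p (\<lambda>k\<in>{a<..r}. Z k \<omega>)} * prob {\<omega> \<in> space M. f (\<lambda>k\<in>{r<..b}. Z k \<omega>)}"
proof -
  let ?A = "\<lambda>\<omega>. \<lambda>k\<in>{a<..r}. Z k \<omega>" and ?B = "\<lambda>\<omega>. \<lambda>k\<in>{r<..b}. Z k \<omega>"
  have "indep_var (PiM {a<..r} (\<lambda>_. borel)) ?A (PiM {r<..b} (\<lambda>_. borel)) ?B"
    by (rule indep_var_restrict[OF Z]) auto
  from indep_varD[OF this p f] show ?thesis
    by (simp add: vimage_def Int_def space_PiM conj_commute)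
qed

definition first_crossing :: "(nat \<Rightarrow> 'a \<Rightarrow> real) \<Rightarrow> nat \<Rightarrow> real \<Rightarrow> nat \<Rightarrow> 'a \<Rightarrow> bool" where
  "first_crossing Z a d r \<omega> \<longleftrightarrow> d \<le> \<bar>\<Sum>k\<in>{a<..r}. Z k \<omega>\<bar> \<and> (\<forall>s\<in>{a..<r}. \<bar>\<Sum>k\<in>{a<..s}. Z k \<omega>\<bar> < d)"

lemma first_crossing_unique:
  assumes "first_crossing Z a d r \<omega>" "first_crossing Z a d s \<omega>" "a \<le> r" "a \<le> s"
  shows "r = s"
proof (rule ccontr)
  assume "r \<noteq> s"
  then consider "r < s" | "s < r" by linarith
  then show False using assms unfolding first_crossing_def by cases force+
qed

lemma first_crossing_exists:
  assumes "s \<in> {a..b}" "d \<le> \<bar>\<Sum>k\<in>{a<..s}. Z k \<omega>\<bar>"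
  shows "\<exists>r\<in>{a..b}. first_crossing Z a d r \<omega>"
proof -
  let ?P = "\<lambda>r. a \<le> r \<and> d \<le> \<bar>\<Sum>k\<in>{a<..r}. Z k \<omega>\<bar>"
  define r where "r = (LEAST r. ?P r)"
  have P: "?P s" using assms by simp
  have "?P r" unfolding r_def by (rule LeastI[of ?P, OF P])
  moreover have "r \<le> s" unfolding r_def by (rule Least_le[of ?P, OF P])
  moreover have "\<bar>\<Sum>k\<in>{a<..r'}. Z k \<omega>\<bar> < d" if "r' \<in> {a..<r}" for r'
    using not_less_Least[of r' ?P] that unfolding r_def by auto
  ultimately show ?thesis using assms(1) unfolding first_crossing_def by (intro bexI[of _ r]) auto
qed

text \<open>The strong Markov property at the first crossing, written as a sum over its possible
  values r: whether r is the first crossing depends on the steps up to r, and \<open>f r\<close>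
  only on the steps after r.\<close>

lemma first_crossing_decomposition:
  fixes Z :: "nat \<Rightarrow> 'a \<Rightarrow> real"
  assumes Z: "indep_vars (\<lambda>_. borel) Z {1..}"
    and f: "\<And>r. r \<in> {a..b} \<Longrightarrow> {z \<in> space (PiM {r<..b} (\<lambda>_. borel)). f r z} \<in> sets (PiM {r<..b} (\<lambda>_. borel))"
  shows "{\<omega> \<in> space M. \<exists>r\<in>{a..b}. first_crossing Z a d r \<omega> \<and> f r (\<lambda>k\<in>{r<..b}. Z k \<omega>)} \<in> events"
    "prob {\<omega> \<in> space M. \<exists>r\<in>{a..b}. first_crossing Z a d r \<omega> \<and> f r (\<lambda>k\<in>{r<..b}. Z k \<omega>)} =
      (\<Sum>r\<in>{a..b}. prob {\<omega> \<in> space M. first_crossing Z a d r \<omega>} * prob {\<omega> \<in> space M. f r (\<lambda>k\<in>{r<..b}. Z k \<omega>)})"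
proof -
  have Zm: "random_variable borel (Z k)" if "k \<ge> 1" for k
    using Z that unfolding indep_vars_def2 by simp
  \<comment> \<open>The first-crossing condition as a predicate on the past alone, the form that
    \<open>indep_past_future\<close> takes.\<close>
  define p where "p = (\<lambda>r z. d \<le> \<bar>\<Sum>k\<in>{a<..r}. z k\<bar> \<and> (\<forall>s\<in>{a..<r}. \<bar>\<Sum>k\<in>{a<..s}. z k :: real\<bar> < d))"
  have pm: "{z \<in> space (PiM {a<..r} (\<lambda>_. borel)). p r z} \<in> sets (PiM {a<..r} (\<lambda>_. borel))" for r
  proof -
    have [measurable]: "(\<lambda>z. \<Sum>k\<in>{a<..s}. z k :: real) \<in> borel_measurable (PiM {a<..r} (\<lambda>_. borel))" if "s \<le> r" for s
      using that by (intro borel_measurable_sum measurable_component_singleton) auto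
    have *: "{z \<in> space (PiM {a<..r} (\<lambda>_. borel)). \<forall>s\<in>{a..<r}. \<bar>\<Sum>k\<in>{a<..s}. z k :: real\<bar> < d}
        \<in> sets (PiM {a<..r} (\<lambda>_. borel))"
      by (intro sets.sets_Collect_finite_All) auto
    have "{z \<in> space (PiM {a<..r} (\<lambda>_. borel)). d \<le> \<bar>\<Sum>k\<in>{a<..r}. z k :: real\<bar>} \<in> sets (PiM {a<..r} (\<lambda>_. borel))"
      by measurable
    from sets.sets_Collect_conj[OF * this] show ?thesis unfolding p_def .
  qed
  have pc: "p r (\<lambda>k\<in>{a<..r}. Z k \<omega>) \<longleftrightarrow> first_crossing Z a d r \<omega>" for r \<omega>
  proof -
    have "(\<Sum>k\<in>{a<..s}. (\<lambda>k\<in>{a<..r}. Z k \<omega>) k) = (\<Sum>k\<in>{a<..s}. Z k \<omega>)" if "s \<le> r" for s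
      using that by (intro sum.cong) auto
    then show ?thesis unfolding p_def first_crossing_def by auto
  qed
  have rm: "(\<lambda>\<omega>. \<lambda>k\<in>{r<..s}. Z k \<omega>) \<in> measurable M (PiM {r<..s} (\<lambda>_. borel))" for r s
    by (intro measurable_restrict Zm) auto
  have Em: "{\<omega> \<in> space M. first_crossing Z a d r \<omega>} \<in> events" for r
    using measurable_sets[OF rm pm] by (simp add: vimage_def Int_def space_PiM pc conj_commute)
  have Fm: "{\<omega> \<in> space M. f r (\<lambda>k\<in>{r<..b}. Z k \<omega>)} \<in> events" if "r \<in> {a..b}" for r
    using measurable_sets[OF rm f[OF that]] by (simp add: vimage_def Int_def space_PiM conj_commute)
  define D where "D = (\<lambda>r. {\<omega> \<in> space M. first_crossing Z a d r \<omega> \<and> f r (\<lambda>k\<in>{r<..b}. Z k \<omega>)})"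
  have Dm: "D r \<in> events" if "r \<in> {a..b}" for r
    unfolding D_def by (rule sets.sets_Collect_conj[OF Fm[OF that] Em])
  have U: "{\<omega> \<in> space M. \<exists>r\<in>{a..b}. first_crossing Z a d r \<omega> \<and> f r (\<lambda>k\<in>{r<..b}. Z k \<omega>)} = (\<Union>r\<in>{a..b}. D r)"
    unfolding D_def by auto
  show "{\<omega> \<in> space M. \<exists>r\<in>{a..b}. first_crossing Z a d r \<omega> \<and> f r (\<lambda>k\<in>{r<..b}. Z k \<omega>)} \<in> events"
    unfolding U using Dm by (intro sets.finite_UN) auto
  have "disjoint_family_on D {a..b}"
    unfolding disjoint_family_on_def D_def using first_crossing_unique by fastforce
  then have "prob (\<Union>r\<in>{a..b}. D r) = (\<Sum>r\<in>{a..b}. prob (D r))"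
    using Dm by (intro finite_measure_finite_Union) auto
  also have "\<dots> = (\<Sum>r\<in>{a..b}. prob {\<omega> \<in> space M. first_crossing Z a d r \<omega>} * prob {\<omega> \<in> space M. f r (\<lambda>k\<in>{r<..b}. Z k \<omega>)})"
    unfolding D_def using indep_past_future[OF Z pm f] by (intro sum.cong) (simp_all add: pc)
  finally show "prob {\<omega> \<in> space M. \<exists>r\<in>{a..b}. first_crossing Z a d r \<omega> \<and> f r (\<lambda>k\<in>{r<..b}. Z k \<omega>)} =
      (\<Sum>r\<in>{a..b}. prob {\<omega> \<in> space M. first_crossing Z a d r \<omega>} * prob {\<omega> \<in> space M. f r (\<lambda>k\<in>{r<..b}. Z k \<omega>)})"
    unfolding U .
qed

text \<open>After a crossing of level 2 * c at r, the remaining sum from r to b is below c with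
  probability at least 1 - q \<ge> 1 / 2, independently of the past, and then the total sum still
  exceeds c. So half the crossing probability is at most q.\<close>

lemma Ottaviani_inequality:
  fixes Z :: "nat \<Rightarrow> 'a \<Rightarrow> real"
  assumes Z: "indep_vars (\<lambda>_. borel) Z {1..}"
    and q: "\<And>i. a \<le> i \<Longrightarrow> i \<le> b \<Longrightarrow> prob {\<omega> \<in> space M. c \<le> \<bar>\<Sum>k\<in>{i<..b}. Z k \<omega>\<bar>} \<le> q" "q \<le> 1 / 2" and ab: "a \<le> b"
  shows "{\<omega> \<in> space M. \<exists>r\<in>{a..b}. first_crossing Z a (2 * c) r \<omega>} \<in> events"
    "prob {\<omega> \<in> space M. \<exists>r\<in>{a..b}. first_crossing Z a (2 * c) r \<omega>} \<le> 2 * q"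
proof -
  let ?C = "\<lambda>d. {\<omega> \<in> space M. \<exists>r\<in>{a..b}. first_crossing Z a (d * c) r \<omega>}"
  have Zm: "random_variable borel (Z k)" if "k \<ge> 1" for k
    using Z that unfolding indep_vars_def2 by simp
  have Sm: "(\<lambda>\<omega>. \<Sum>k\<in>{i<..b}. Z k \<omega>) \<in> borel_measurable M" for i
    by (intro borel_measurable_sum Zm) auto
  let ?f = "\<lambda>r z. \<bar>\<Sum>k\<in>{r<..b}. z k :: real\<bar> < c"
  have f: "{z \<in> space (PiM {r<..b} (\<lambda>_. borel)). ?f r z} \<in> sets (PiM {r<..b} (\<lambda>_. borel))" for r
    by measurable
  have T: "{z \<in> space (PiM {r<..b} (\<lambda>_. borel)). True} \<in> sets (PiM {r<..b} (\<lambda>_. borel))" for r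
    by simp
  note all = first_crossing_decomposition[OF Z T, where a=a and d="2 * c", simplified]
  note late = first_crossing_decomposition[OF Z f, where a=a and d="2 * c"]
  show "(?C 2) \<in> events"
    using all(1) by simp
  have half: "1 / 2 \<le> prob {\<omega> \<in> space M. ?f r (\<lambda>k\<in>{r<..b}. Z k \<omega>)}" if "r \<in> {a..b}" for r
  proof -
    have "{\<omega> \<in> space M. c \<le> \<bar>\<Sum>k\<in>{r<..b}. Z k \<omega>\<bar>} \<in> events" using Sm[of r] by measurable
    from prob_compl[OF this] have "prob (space M - {\<omega> \<in> space M. c \<le> \<bar>\<Sum>k\<in>{r<..b}. Z k \<omega>\<bar>}) \<ge> 1 / 2"
      using q(1)[of r] q(2) that by simp
    also have "space M - {\<omega> \<in> space M. c \<le> \<bar>\<Sum>k\<in>{r<..b}. Z k \<omega>\<bar>} = {\<omega> \<in> space M. ?f r (\<lambda>k\<in>{r<..b}. Z k \<omega>)}"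
      by auto
    finally show ?thesis .
  qed
  have "prob (?C 2) * (1 / 2)
      = (\<Sum>r\<in>{a..b}. prob {\<omega> \<in> space M. first_crossing Z a (2 * c) r \<omega>} * (1 / 2))"
    using all(2) by (simp add: prob_space sum_distrib_right)
  also have "\<dots> \<le> (\<Sum>r\<in>{a..b}. prob {\<omega> \<in> space M. first_crossing Z a (2 * c) r \<omega>} * prob {\<omega> \<in> space M. ?f r (\<lambda>k\<in>{r<..b}. Z k \<omega>)})"
    by (intro sum_mono mult_left_mono half) auto
  also have "\<dots> = prob {\<omega> \<in> space M. \<exists>r\<in>{a..b}. first_crossing Z a (2 * c) r \<omega> \<and> ?f r (\<lambda>k\<in>{r<..b}. Z k \<omega>)}"
    by (rule late(2)[symmetric])
  also have "\<dots> \<le> prob {\<omega> \<in> space M. c \<le> \<bar>\<Sum>k\<in>{a<..b}. Z k \<omega>\<bar>}"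
  proof (intro finite_measure_mono subsetI)
    fix \<omega> assume "\<omega> \<in> {\<omega> \<in> space M. \<exists>r\<in>{a..b}. first_crossing Z a (2 * c) r \<omega> \<and> ?f r (\<lambda>k\<in>{r<..b}. Z k \<omega>)}"
    then obtain r where r: "\<omega> \<in> space M" "r \<in> {a..b}" "first_crossing Z a (2 * c) r \<omega>" "\<bar>\<Sum>k\<in>{r<..b}. Z k \<omega>\<bar> < c" by auto
    have "(\<Sum>k\<in>{a<..b}. Z k \<omega>) = (\<Sum>k\<in>{a<..r}. Z k \<omega>) + (\<Sum>k\<in>{r<..b}. Z k \<omega>)"
      using r(2) by (subst sum.union_disjoint[symmetric]) (auto intro!: sum.cong)
    then show "\<omega> \<in> {\<omega> \<in> space M. c \<le> \<bar>\<Sum>k\<in>{a<..b}. Z k \<omega>\<bar>}"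
      using r unfolding first_crossing_def by auto
  next
    show "{\<omega> \<in> space M. c \<le> \<bar>\<Sum>k\<in>{a<..b}. Z k \<omega>\<bar>} \<in> events" using Sm[of a] by measurable
  qed
  also have "\<dots> \<le> q" using ab by (intro q) auto
  finally show "prob (?C 2) \<le> 2 * q" by simp
qed

text \<open>By independence after the first crossing of level \<open>4 * c\<close>, a second fluctuation costs another factor \<open>2 * q\<close>.\<close>

lemma two_fluctuations:
  fixes Z :: "nat \<Rightarrow> 'a \<Rightarrow> real"
  assumes Z: "indep_vars (\<lambda>_. borel) Z {1..}"
    and q: "\<And>i. a \<le> i \<Longrightarrow> i \<le> b \<Longrightarrow> prob {\<omega> \<in> space M. c \<le> \<bar>\<Sum>k\<in>{i<..b}. Z k \<omega>\<bar>} \<le> q" "q \<le> 1 / 2"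
    and ab: "a \<le> b" and c: "c \<ge> 0"
  shows "\<exists>F\<in>events. prob F \<le> (2 * q)\<^sup>2 \<and>
    (\<forall>\<omega>\<in>space M - F. \<forall>r\<in>{a..b}. first_crossing Z a (4 * c) r \<omega> \<longrightarrow>
       (\<forall>s\<in>{r..b}. \<bar>\<Sum>k\<in>{r<..s}. Z k \<omega>\<bar> < 2 * c))"
proof -
  let ?C = "\<lambda>d. {\<omega> \<in> space M. \<exists>r\<in>{a..b}. first_crossing Z a (d * c) r \<omega>}"
  have q0: "q \<ge> 0" using q(1)[OF ab] measure_nonneg order_trans by blast
  let ?f = "\<lambda>r z. \<exists>s\<in>{r..b}. 2 * c \<le> \<bar>\<Sum>k\<in>{r<..s}. z k :: real\<bar>"
  have f: "{z \<in> space (PiM {r<..b} (\<lambda>_. borel)). ?f r z} \<in> sets (PiM {r<..b} (\<lambda>_. borel))" for r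
  proof -
    have [measurable]: "(\<lambda>z. \<Sum>k\<in>{r<..s}. z k :: real) \<in> borel_measurable (PiM {r<..b} (\<lambda>_. borel))" if "s \<le> b" for s
      using that by (intro borel_measurable_sum measurable_component_singleton) auto
    show ?thesis by (intro sets.sets_Collect_finite_Ex) auto
  qed
  have T: "{z \<in> space (PiM {r<..b} (\<lambda>_. borel)). True} \<in> sets (PiM {r<..b} (\<lambda>_. borel))" for r
    by simp
  note D = first_crossing_decomposition[OF Z f, where a=a and d="4 * c"]
  note all = first_crossing_decomposition[OF Z T, where a=a and d="4 * c", simplified]
  have fe: "?f r (\<lambda>k\<in>{r<..b}. Z k \<omega>) \<longleftrightarrow> (\<exists>s\<in>{r..b}. 2 * c \<le> \<bar>\<Sum>k\<in>{r<..s}. Z k \<omega>\<bar>)" for r \<omega>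
  proof -
    have "(\<Sum>k\<in>{r<..s}. (\<lambda>k\<in>{r<..b}. Z k \<omega>) k) = (\<Sum>k\<in>{r<..s}. Z k \<omega>)" if "s \<in> {r..b}" for s
      using that by (intro sum.cong) auto
    then show ?thesis by (intro bex_cong) simp_all
  qed
  have O1: "prob {\<omega> \<in> space M. ?f r (\<lambda>k\<in>{r<..b}. Z k \<omega>)} \<le> 2 * q" if r: "r \<in> {a..b}" for r
  proof -
    have O: "{\<omega> \<in> space M. \<exists>s\<in>{r..b}. first_crossing Z r (2 * c) s \<omega>} \<in> events"
      "prob {\<omega> \<in> space M. \<exists>s\<in>{r..b}. first_crossing Z r (2 * c) s \<omega>} \<le> 2 * q"
      using r q by (intro Ottaviani_inequality[OF Z, of r b c q]; simp)+
    have "prob {\<omega> \<in> space M. ?f r (\<lambda>k\<in>{r<..b}. Z k \<omega>)} \<le> prob {\<omega> \<in> space M. \<exists>s\<in>{r..b}. first_crossing Z r (2 * c) s \<omega>}"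
      using first_crossing_exists[of _ r b "2 * c" Z] O(1) unfolding fe
      by (intro finite_measure_mono) blast+
    then show ?thesis using O(2) by simp
  qed
  have O2: "(?C 2) \<in> events"
    "prob (?C 2) \<le> 2 * q"
    using ab q by (intro Ottaviani_inequality[OF Z, of a b c q]; simp)+
  let ?F = "{\<omega> \<in> space M. \<exists>r\<in>{a..b}. first_crossing Z a (4 * c) r \<omega> \<and> ?f r (\<lambda>k\<in>{r<..b}. Z k \<omega>)}"
  have "prob ?F = (\<Sum>r\<in>{a..b}. prob {\<omega> \<in> space M. first_crossing Z a (4 * c) r \<omega>} * prob {\<omega> \<in> space M. ?f r (\<lambda>k\<in>{r<..b}. Z k \<omega>)})"
    by (rule D(2))
  also have "\<dots> \<le> (\<Sum>r\<in>{a..b}. prob {\<omega> \<in> space M. first_crossing Z a (4 * c) r \<omega>} * (2 * q))"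
    by (intro sum_mono mult_left_mono O1) auto
  also have "\<dots> = prob (?C 4) * (2 * q)"
    using all(2) by (simp add: prob_space sum_distrib_right)
  also have "\<dots> \<le> prob (?C 2) * (2 * q)"
  proof (intro mult_right_mono finite_measure_mono subsetI O2(1))
    fix \<omega> assume "\<omega> \<in> (?C 4)"
    then obtain r where r: "\<omega> \<in> space M" "r \<in> {a..b}" "first_crossing Z a (4 * c) r \<omega>" by blast
    then have "2 * c \<le> \<bar>\<Sum>k\<in>{a<..r}. Z k \<omega>\<bar>" using c unfolding first_crossing_def by linarith
    then show "\<omega> \<in> (?C 2)"
      using first_crossing_exists[OF r(2)] r(1) by blast
  qed (use q0 in auto)
  also have "\<dots> \<le> (2 * q) * (2 * q)" using O2(2) q0 by (intro mult_right_mono) auto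
  finally have "prob ?F \<le> (2 * q)\<^sup>2" by (simp add: power2_eq_square)
  moreover have "?F \<in> events" by (rule D(1))
  moreover have "\<forall>\<omega>\<in>space M - ?F. \<forall>r\<in>{a..b}. first_crossing Z a (4 * c) r \<omega> \<longrightarrow>
       (\<forall>s\<in>{r..b}. \<bar>\<Sum>k\<in>{r<..s}. Z k \<omega>\<bar> < 2 * c)"
    unfolding fe by (auto simp: not_le)
  ultimately show ?thesis by blast
qed

end

section \<open>Bernstein functions\<close>

lemma one_minus_exp_le:
  assumes "s \<ge> 0" "x \<ge> (0::real)"
  shows "1 - exp (- x * s) \<le> max 1 x * min 1 s"
proof (cases "s \<le> 1")
  case True
  have "1 - exp (- x * s) \<le> x * s" using exp_ge_add_one_self[of "- x * s"] by simp
  also have "\<dots> \<le> max 1 x * s" using assms by (intro mult_right_mono) auto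
  finally show ?thesis using True by simp
next
  case False
  have "1 - exp (- x * s) \<le> 1" by simp
  also have "\<dots> \<le> max 1 x * min 1 s" using False by simp
  finally show ?thesis .
qed

lemma bernstein_integrable:
  assumes \<psi>: "bernstein_representation \<psi> a b \<nu>" and x: "x \<ge> 0"
  shows "set_integrable \<nu> {0..} (\<lambda>s. 1 - exp (- x * s))"
proof -
  have sets [measurable_cong]: "sets \<nu> = sets borel" using \<psi> by (simp add: bernstein_representation_def)
  have "set_integrable \<nu> {0..} (\<lambda>s. min 1 s)" using \<psi> by (simp add: bernstein_representation_def)
  then have "set_integrable \<nu> {0..} (\<lambda>s. max 1 x * min 1 s)" by (rule set_integrable_mult_right)
  then show ?thesis
    unfolding set_integrable_def
  proof (rule Bochner_Integration.integrable_bound)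
    show "(\<lambda>s. indicat_real {0..} s *\<^sub>R (1 - exp (- x * s))) \<in> borel_measurable \<nu>" by measurable
    have "norm (indicat_real {0..} s *\<^sub>R (1 - exp (- x * s))) \<le> norm (indicat_real {0..} s *\<^sub>R (max 1 x * min 1 s))" for s
    proof (cases "s \<ge> 0")
      case True
      then have "0 \<le> 1 - exp (- x * s)" using x by simp
      then show ?thesis using True one_minus_exp_le[OF True x] by auto
    qed simp
    then show "AE s in \<nu>. norm (indicat_real {0..} s *\<^sub>R (1 - exp (- x * s))) \<le> norm (indicat_real {0..} s *\<^sub>R (max 1 x * min 1 s))"
      by blast
  qed
qed

lemma bernstein_mono:
  assumes \<psi>: "bernstein_representation \<psi> a b \<nu>" and "0 \<le> x" "x \<le> y"
  shows "\<psi> x \<le> \<psi> y"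
proof -
  have "(LINT s:{0..}|\<nu>. 1 - exp (- x * s)) \<le> (LINT s:{0..}|\<nu>. 1 - exp (- y * s))"
    using assms by (intro set_integral_mono bernstein_integrable[OF \<psi>]) (auto simp: mult_right_mono)
  moreover have "b * x \<le> b * y" using assms by (auto simp: bernstein_representation_def intro: mult_left_mono)
  ultimately show ?thesis using assms by (simp add: bernstein_representation_def)
qed

text \<open>As \<psi> 1 = 1, the right side is \<psi> 1 - \<psi> (1 - s), in which the killing rate
  \<open>a\<close> cancels. What remains is b * s plus the integral of (exp (t * s) - 1) * exp (-
  t), whose power series in s has nonnegative terms and may be integrated term by term. The drift
  contributes to k = 1 only.\<close>

lemma bernstein_coeff_sums:
  assumes \<psi>: "bernstein_representation \<psi> a b \<nu>" "\<psi> 1 = 1" and s: "0 \<le> s" "s \<le> 1"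
  shows "(\<lambda>k. bernstein_coeff b \<nu> (Suc k) * s ^ Suc k) sums (1 - \<psi> (1 - s))"
proof -
  let ?F = "\<lambda>r t. (1 - exp (- 1 * t)) - (1 - exp (- (1 - r) * t :: real))"
  have sets [measurable_cong]: "sets \<nu> = sets borel" using \<psi> by (simp add: bernstein_representation_def)
  define f where "f = (\<lambda>k t. 1 / fact (Suc k) * (t ^ Suc k * exp (- t)) :: real)"
  have f0: "f k t \<ge> 0" if "t \<ge> 0" for k t using that by (auto simp: f_def)
  have sums: "(\<lambda>k. f k t * r ^ Suc k) sums ?F r t" for t r :: real
  proof -
    have "(\<lambda>k. (t * r) ^ k /\<^sub>R fact k) sums exp (t * r)" by (rule exp_converges)
    then have "(\<lambda>k. (t * r) ^ Suc k /\<^sub>R fact (Suc k)) sums (exp (t * r) - 1)"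
      by (subst sums_Suc_iff) simp
    then have "(\<lambda>k. (t * r) ^ Suc k /\<^sub>R fact (Suc k) * exp (- t)) sums ((exp (t * r) - 1) * exp (- t))"
      by (rule sums_mult2)
    moreover have "(t * r) ^ Suc k /\<^sub>R fact (Suc k) * exp (- t) = f k t * r ^ Suc k" for k
      unfolding f_def power_mult_distrib by (simp add: divide_inverse scaleR_conv_of_real mult_ac del: power_Suc fact_Suc)
    moreover have "(exp (t * r) - 1) * exp (- t) = ?F r t"
      by (simp add: algebra_simps exp_add[symmetric])
    ultimately show ?thesis by (simp only:)
  qed
  have diff_int: "set_integrable \<nu> {0..} (\<lambda>t. ?F r t)" if "r \<le> 1" for r
    using that by (intro set_integral_diff bernstein_integrable[OF \<psi>(1)]) auto
  have partial: "0 \<le> (\<Sum>k<n. f k t * r ^ Suc k)"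
    "(\<Sum>k<n. f k t * r ^ Suc k) \<le> ?F r t" if "t \<ge> 0" "r \<ge> 0" for t n and r :: real
  proof -
    show "0 \<le> (\<Sum>k<n. f k t * r ^ Suc k)" using that f0 by (intro sum_nonneg mult_nonneg_nonneg) auto
    show "(\<Sum>k<n. f k t * r ^ Suc k) \<le> ?F r t"
      using sums[of t r] that f0 by (metis (no_types, lifting) mult_nonneg_nonneg sum_le_suminf sums_iff finite_lessThan zero_le_power)
  qed
  have f_int: "set_integrable \<nu> {0..} (f k)" for k
  proof -
    \<comment> \<open>At r = 1 the series sums to 1 - exp (- t), which is integrable and dominates
      each single term \<open>f k\<close>.\<close>
    have "set_integrable \<nu> {0..} (\<lambda>t. ?F 1 t)" by (rule diff_int) simp
    then show ?thesis
      unfolding set_integrable_def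
    proof (rule Bochner_Integration.integrable_bound)
      show "(\<lambda>t. indicat_real {0..} t *\<^sub>R f k t) \<in> borel_measurable \<nu>" unfolding f_def by measurable
      have "f k t \<le> ?F 1 t" if "t \<ge> 0" for t
      proof -
        have "f k t \<le> (\<Sum>i<Suc k. f i t * 1 ^ Suc i)" using f0[OF that] by (simp add: sum_nonneg)
        also have "\<dots> \<le> ?F 1 t"
          using partial(2)[OF that, of 1 "Suc k"] by simp
        finally show ?thesis .
      qed
      then show "AE t in \<nu>. norm (indicat_real {0..} t *\<^sub>R f k t) \<le> norm (indicat_real {0..} t *\<^sub>R (?F 1 t))"
        using f0 by (auto simp: indicator_def)
    qed
  qed
  have c: "(LINT t:{0..}|\<nu>. f k t) = 1 / fact (Suc k) * (LINT t:{0..}|\<nu>. t ^ Suc k * exp (- t))" for k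
    unfolding f_def by (rule set_integral_mult_right)
  have "(\<lambda>n. LINT t:{0..}|\<nu>. \<Sum>k<n. f k t * s ^ Suc k) \<longlonglongrightarrow> (LINT t:{0..}|\<nu>. ?F s t)"
    unfolding set_lebesgue_integral_def
  proof (rule integral_dominated_convergence)
    show "integrable \<nu> (\<lambda>t. indicat_real {0..} t *\<^sub>R ?F s t)"
      using diff_int[OF s(2)] by (simp add: set_integrable_def)
    show "AE t in \<nu>. (\<lambda>n. indicat_real {0..} t *\<^sub>R (\<Sum>k<n. f k t * s ^ Suc k)) \<longlonglongrightarrow> indicat_real {0..} t *\<^sub>R ?F s t"
      using sums unfolding sums_def by (intro AE_I2 tendsto_intros) simp
    show "AE t in \<nu>. norm (indicat_real {0..} t *\<^sub>R (\<Sum>k<n. f k t * s ^ Suc k)) \<le> indicat_real {0..} t *\<^sub>R ?F s t" for n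
      using partial s by (auto simp: indicator_def)
  qed (unfold f_def, measurable)
  moreover have "(LINT t:{0..}|\<nu>. \<Sum>k<n. f k t * s ^ Suc k) = (\<Sum>k<n. (LINT t:{0..}|\<nu>. f k t) * s ^ Suc k)" for n
  proof -
    have "(LINT t:{0..}|\<nu>. \<Sum>k<n. f k t * s ^ Suc k) = (LINT t|\<nu>. (\<Sum>k<n. (indicat_real {0..} t *\<^sub>R f k t) * s ^ Suc k))"
      unfolding set_lebesgue_integral_def by (intro Bochner_Integration.integral_cong) (auto simp: sum_distrib_left mult.assoc)
    also have "\<dots> = (\<Sum>k<n. (LINT t:{0..}|\<nu>. f k t) * s ^ Suc k)"
      unfolding set_lebesgue_integral_def using f_int
      by (subst Bochner_Integration.integral_sum) (auto simp: set_integrable_def)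
    finally show ?thesis .
  qed
  ultimately have "(\<lambda>k. (LINT t:{0..}|\<nu>. f k t) * s ^ Suc k) sums (LINT t:{0..}|\<nu>. ?F s t)"
    unfolding sums_def by simp
  moreover have "(\<lambda>k. (if k = 0 then b * s else 0)) sums (b * s)" by (rule sums_single)
  ultimately have "(\<lambda>k. (LINT t:{0..}|\<nu>. f k t) * s ^ Suc k + (if k = 0 then b * s else 0)) sums
      ((LINT t:{0..}|\<nu>. ?F s t) + b * s)"
    by (rule sums_add)
  moreover have "(LINT t:{0..}|\<nu>. f k t) * s ^ Suc k + (if k = 0 then b * s else 0) = bernstein_coeff b \<nu> (Suc k) * s ^ Suc k" for k
    unfolding c bernstein_coeff_def by (auto simp: algebra_simps)
  moreover have "(LINT t:{0..}|\<nu>. ?F s t) + b * s = 1 - \<psi> (1 - s)"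
  proof -
    have "(LINT t:{0..}|\<nu>. ?F s t)
        = (LINT t:{0..}|\<nu>. 1 - exp (- 1 * t)) - (LINT t:{0..}|\<nu>. 1 - exp (- (1 - s) * t))"
      using s by (intro set_integral_diff bernstein_integrable[OF \<psi>(1)]) auto
    moreover have "\<psi> 1 = a + b * 1 + (LINT t:{0..}|\<nu>. 1 - exp (- 1 * t))"
      "\<psi> (1 - s) = a + b * (1 - s) + (LINT t:{0..}|\<nu>. 1 - exp (- (1 - s) * t))"
      using \<psi>(1) s unfolding bernstein_representation_def by (blast intro: diff_ge_0_iff_ge[THEN iffD2] zero_le_one)+
    ultimately show ?thesis using \<psi>(2) by (simp add: algebra_simps)
  qed
  ultimately show ?thesis by simp
qed

lemma (in prob_space) expectation_nat_valued_sums: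
  fixes g :: "nat \<Rightarrow> real"
  assumes T [measurable]: "random_variable (count_space UNIV) T" and g: "\<And>k. \<bar>g k\<bar> \<le> C"
  shows "(\<lambda>k. prob {\<omega> \<in> space M. T \<omega> = k} * g k) sums expectation (\<lambda>\<omega>. g (T \<omega>))"
proof -
  have "(\<lambda>n. expectation (\<lambda>\<omega>. if T \<omega> < n then g (T \<omega>) else 0)) \<longlonglongrightarrow> expectation (\<lambda>\<omega>. g (T \<omega>))"
  proof (rule integral_dominated_convergence[where w="\<lambda>_. C"])
    show "AE \<omega> in M. (\<lambda>n. if T \<omega> < n then g (T \<omega>) else 0) \<longlonglongrightarrow> g (T \<omega>)"
    proof (rule AE_I2)
      fix \<omega>
      have "\<forall>\<^sub>F n in sequentially. (if T \<omega> < n then g (T \<omega>) else 0) = g (T \<omega>)"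
        using eventually_gt_at_top[of "T \<omega>"] by eventually_elim simp
      then show "(\<lambda>n. if T \<omega> < n then g (T \<omega>) else 0) \<longlonglongrightarrow> g (T \<omega>)" by (rule tendsto_eventually)
    qed
    show "AE \<omega> in M. norm (if T \<omega> < n then g (T \<omega>) else 0) \<le> C" for n
      using g order_trans[OF abs_ge_zero g[of 0]] by (intro AE_I2) auto
  qed auto
  moreover have "expectation (\<lambda>\<omega>. if T \<omega> < n then g (T \<omega>) else 0) = (\<Sum>k<n. prob {\<omega> \<in> space M. T \<omega> = k} * g k)" for n
  proof -
    have "expectation (\<lambda>\<omega>. if T \<omega> < n then g (T \<omega>) else 0)
        = expectation (\<lambda>\<omega>. \<Sum>k<n. indicat_real {\<omega> \<in> space M. T \<omega> = k} \<omega> * g k)"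
    proof (rule Bochner_Integration.integral_cong[OF refl])
      fix \<omega> assume "\<omega> \<in> space M"
      then have "(\<Sum>k<n. indicat_real {\<omega> \<in> space M. T \<omega> = k} \<omega> * g k) = (\<Sum>k<n. if k = T \<omega> then g k else 0)"
        by (intro sum.cong) (auto simp: indicator_def)
      also have "\<dots> = (if T \<omega> < n then g (T \<omega>) else 0)" by (subst sum.delta) auto
      finally show "(if T \<omega> < n then g (T \<omega>) else 0) = (\<Sum>k<n. indicat_real {\<omega> \<in> space M. T \<omega> = k} \<omega> * g k)" by simp
    qed
    also have "\<dots> = (\<Sum>k<n. prob {\<omega> \<in> space M. T \<omega> = k} * g k)"
      by (subst Bochner_Integration.integral_sum) (auto simp: less_top[symmetric])
    finally show ?thesis .
  qed
  ultimately show ?thesis unfolding sums_def by simp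
qed

text \<open>The law of T is prescribed for k \<ge> 1 only. Evaluating the generating function at 1,
  where \<psi> (1 - 1) = 0, shows that no mass is left for 0.\<close>

lemma (in prob_space) subordinator_step:
  assumes \<psi>: "bernstein_representation \<psi> a b \<nu>" "\<psi> 0 = 0" "\<psi> 1 = 1"
    and R: "random_variable (count_space UNIV) T" "\<And>k. k \<ge> 1 \<Longrightarrow> prob {\<omega> \<in> space M. T \<omega> = k} = bernstein_coeff b \<nu> k"
  shows subordinator_step_nonzero: "prob {\<omega> \<in> space M. T \<omega> = 0} = 0"
    and subordinator_step_generating_function: "\<And>s. 0 \<le> s \<Longrightarrow> s \<le> 1 \<Longrightarrow> expectation (\<lambda>\<omega>. s ^ T \<omega>) = 1 - \<psi> (1 - s)"
proof -
  let ?p = "\<lambda>k. prob {\<omega> \<in> space M. T \<omega> = k}"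
  have E: "expectation (\<lambda>\<omega>. r ^ T \<omega>) = 1 - \<psi> (1 - r) + ?p 0" if "0 \<le> r" "r \<le> 1" for r
  proof -
    have "\<bar>r ^ k\<bar> \<le> 1" for k using that by (simp add: power_le_one)
    then have "(\<lambda>k. ?p k * r ^ k) sums expectation (\<lambda>\<omega>. r ^ T \<omega>)"
      by (rule expectation_nat_valued_sums[OF R(1)])
    then have "(\<lambda>k. ?p (Suc k) * r ^ Suc k) sums (expectation (\<lambda>\<omega>. r ^ T \<omega>) - ?p 0)"
      by (subst sums_Suc_iff) simp
    moreover have "(\<lambda>k. ?p (Suc k) * r ^ Suc k) sums (1 - \<psi> (1 - r))"
      using bernstein_coeff_sums[OF \<psi>(1,3) that] R(2) by simp
    ultimately have "expectation (\<lambda>\<omega>. r ^ T \<omega>) - ?p 0 = 1 - \<psi> (1 - r)" by (rule sums_unique2)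
    then show ?thesis by simp
  qed
  show p0: "?p 0 = 0" using E[of 1] \<psi>(2) by (simp add: prob_space)
  show "expectation (\<lambda>\<omega>. s ^ T \<omega>) = 1 - \<psi> (1 - s)" if "0 \<le> s" "s \<le> 1" for s
    using E[OF that] p0 by simp
qed

section \<open>Regular variation and the scaling sequence\<close>

locale regular_scaling =
  fixes \<psi> :: "real \<Rightarrow> real" and \<beta> :: real and b :: "nat \<Rightarrow> real"
  assumes \<psi>_mono: "\<And>x y. 0 \<le> x \<Longrightarrow> x \<le> y \<Longrightarrow> \<psi> x \<le> \<psi> y" and \<psi>_0: "\<psi> 0 = 0"
    and regular: "regularly_varying_at_zero \<psi> \<beta>" and \<beta>: "\<beta> > 0"
    and b_pos: "\<And>n. n \<ge> 1 \<Longrightarrow> 0 < b n" and b_lim: "(\<lambda>n. real n * \<psi> (inverse (b n))) \<longlonglongrightarrow> 1"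
begin

lemma \<psi>_nonneg: "x \<ge> 0 \<Longrightarrow> \<psi> x \<ge> 0"
  using \<psi>_mono[of 0 x] \<psi>_0 by simp

lemma \<psi>_ratio:
  assumes \<kappa>: "\<kappa> > 0"
  shows "((\<lambda>x. \<psi> (\<kappa> * x) / \<psi> x) \<longlongrightarrow> \<kappa> powr \<beta>) (at_right 0)"
    and "\<forall>\<^sub>F x in at_right 0. \<psi> x \<noteq> 0"
proof -
  obtain l where l: "slowly_varying l" "\<forall>\<^sub>F x in at_right 0. \<psi> x = x powr \<beta> * l (1 / x)"
    using regular unfolding regularly_varying_at_zero_def by blast
  have inv: "filterlim (\<lambda>x::real. 1 / x) at_top (at_right 0)" by real_asymp
  have r: "((\<lambda>x. l (c * (1 / x)) / l (1 / x)) \<longlongrightarrow> 1) (at_right 0)" if "c > 0" for c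
    using l(1) that unfolding slowly_varying_def by (intro filterlim_compose[OF _ inv]) auto
  \<comment> \<open>Slow variation with factor 1 says that l / l tends to 1; since 0 / 0 = 0, this
    forces l to be nonzero eventually.\<close>
  have nz: "\<forall>\<^sub>F x in at_right 0. l (1 / x) \<noteq> 0"
    using order_tendstoD(1)[OF r[of 1], of 0] by (auto elim!: eventually_mono)
  have sc: "filterlim (\<lambda>x::real. \<kappa> * x) (at_right 0) (at_right 0)" using \<kappa> by real_asymp
  have "\<forall>\<^sub>F x in at_right 0. \<psi> (\<kappa> * x) = (\<kappa> * x) powr \<beta> * l (1 / (\<kappa> * x))"
    using l(2) sc by (rule eventually_compose_filterlim)
  then have ev: "\<forall>\<^sub>F x in at_right 0. \<kappa> powr \<beta> * (l (1 / \<kappa> * (1 / x)) / l (1 / x)) = \<psi> (\<kappa> * x) / \<psi> x"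
    using l(2) nz eventually_at_right_less[of 0]
  proof eventually_elim
    case (elim x)
    then show ?case using \<kappa> by (simp add: powr_mult)
  qed
  have "((\<lambda>x. \<kappa> powr \<beta> * (l (1 / \<kappa> * (1 / x)) / l (1 / x))) \<longlongrightarrow> \<kappa> powr \<beta> * 1) (at_right 0)"
    using \<kappa> by (intro tendsto_intros r) simp
  then show "((\<lambda>x. \<psi> (\<kappa> * x) / \<psi> x) \<longlongrightarrow> \<kappa> powr \<beta>) (at_right 0)"
    using ev by (simp add: tendsto_cong)
  show "\<forall>\<^sub>F x in at_right 0. \<psi> x \<noteq> 0"
    using l(2) nz eventually_at_right_less[of 0] by eventually_elim simp
qed

text \<open>The normalisation forces \<psi> (1 / b n) to 0. Since \<psi> is monotone and positive
  just to the right of 0, its arguments must tend to 0 as well.\<close>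

lemma inverse_b_tendsto: "filterlim (\<lambda>n. inverse (b n)) (at_right 0) sequentially"
proof -
  have "(\<lambda>n. 1 / real n * (real n * \<psi> (inverse (b n)))) \<longlonglongrightarrow> 0 * 1"
    by (intro tendsto_mult b_lim lim_1_over_n)
  moreover have "\<forall>\<^sub>F n in sequentially. 1 / real n * (real n * \<psi> (inverse (b n))) = \<psi> (inverse (b n))"
    using eventually_gt_at_top[of 0] by eventually_elim simp
  ultimately have z: "(\<lambda>n. \<psi> (inverse (b n))) \<longlonglongrightarrow> 0" by (simp add: tendsto_cong)
  have pos: "\<forall>\<^sub>F n in sequentially. inverse (b n) > 0"
    using eventually_ge_at_top[of 1] by eventually_elim (simp add: b_pos)
  have "(\<lambda>n. inverse (b n)) \<longlonglongrightarrow> 0"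
  proof (rule order_tendstoI)
    fix e :: real assume "e > 0"
    obtain d where d: "d > 0" "\<And>x. 0 < x \<Longrightarrow> x < d \<Longrightarrow> \<psi> x \<noteq> 0"
      using \<psi>_ratio(2)[of 1] unfolding eventually_at_right_field by auto
    define x where "x = min e (d / 2)"
    have x: "0 < x" "x < d" "x \<le> e" using d(1) \<open>e > 0\<close> by (auto simp: x_def)
    then have "\<psi> x > 0" using d(2)[of x] \<psi>_nonneg[of x] by simp
    then have "\<forall>\<^sub>F n in sequentially. \<psi> (inverse (b n)) < \<psi> x" using z by (intro order_tendstoD)
    then show "\<forall>\<^sub>F n in sequentially. inverse (b n) < e"
    proof eventually_elim
      case (elim n)
      then show ?case using \<psi>_mono[of x "inverse (b n)"] x by (cases "inverse (b n) < e") auto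
    qed
  next
    fix e :: real assume "e < 0"
    show "\<forall>\<^sub>F n in sequentially. e < inverse (b n)"
      using pos by eventually_elim (use \<open>e < 0\<close> in linarith)
  qed
  moreover have "\<forall>\<^sub>F n in sequentially. inverse (b n) \<in> {0<..} \<and> inverse (b n) \<noteq> 0"
    using pos by eventually_elim auto
  ultimately show ?thesis unfolding filterlim_at by blast
qed

lemma b_at_top: "filterlim b at_top sequentially"
  using filterlim_compose[OF filterlim_inverse_at_top_right inverse_b_tendsto] by simp

lemma scaled_\<psi>_tendsto:
  assumes \<kappa>: "\<kappa> > 0"
  shows "(\<lambda>n. real n * \<psi> (\<kappa> * inverse (b n))) \<longlonglongrightarrow> \<kappa> powr \<beta>"
proof -
  have "(\<lambda>n. \<psi> (\<kappa> * inverse (b n)) / \<psi> (inverse (b n)) * (real n * \<psi> (inverse (b n)))) \<longlonglongrightarrow> \<kappa> powr \<beta> * 1"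
    by (intro tendsto_mult b_lim filterlim_compose[OF \<psi>_ratio(1)[OF \<kappa>] inverse_b_tendsto])
  moreover have "\<forall>\<^sub>F n in sequentially. \<psi> (inverse (b n)) \<noteq> 0"
    by (rule eventually_compose_filterlim[OF \<psi>_ratio(2)[OF zero_less_one] inverse_b_tendsto])
  then have "\<forall>\<^sub>F n in sequentially. \<psi> (\<kappa> * inverse (b n)) / \<psi> (inverse (b n)) * (real n * \<psi> (inverse (b n)))
      = real n * \<psi> (\<kappa> * inverse (b n))"
    by eventually_elim simp
  ultimately show ?thesis by (simp add: tendsto_cong)
qed

text \<open>Monotonicity of \<psi> takes the place of the uniform convergence theorem for regular
  variation: eventually x n lies between y / b n for constants y slightly below and slightly above
  \<kappa>.\<close>

lemma scaled_\<psi>_tendsto':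
  assumes \<kappa>: "\<kappa> > 0" and x: "(\<lambda>n. b n * x n) \<longlonglongrightarrow> \<kappa>"
  shows "(\<lambda>n. real n * \<psi> (x n)) \<longlonglongrightarrow> \<kappa> powr \<beta>"
proof -
  have cont: "((\<lambda>y. y powr \<beta>) \<longlongrightarrow> \<kappa> powr \<beta>) (at \<kappa>)"
    using \<kappa> by (intro tendsto_intros) auto
  have bp: "\<forall>\<^sub>F n in sequentially. b n > 0"
    using eventually_ge_at_top[of 1] by eventually_elim (simp add: b_pos)
  show ?thesis
  proof (rule order_tendstoI)
    fix c assume "c < \<kappa> powr \<beta>"
    then have "\<forall>\<^sub>F y in at_left \<kappa>. c < y powr \<beta>"
      using cont by (intro order_tendstoD(1)) (auto simp: filterlim_at_split)
    moreover have "\<forall>\<^sub>F y in at_left \<kappa>. y \<in> {0<..<\<kappa>}" using \<kappa> by (rule eventually_at_left_real)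
    ultimately obtain y where y: "c < y powr \<beta>" "0 < y" "y < \<kappa>"
      using eventually_happens[OF eventually_conj] by (metis (mono_tags, lifting) greaterThanLessThan_iff trivial_limit_at_left_real)
    have "\<forall>\<^sub>F n in sequentially. c < real n * \<psi> (y * inverse (b n))"
      using scaled_\<psi>_tendsto[OF y(2)] y(1) by (rule order_tendstoD)
    then show "\<forall>\<^sub>F n in sequentially. c < real n * \<psi> (x n)"
      using order_tendstoD(1)[OF x y(3)] bp
    proof eventually_elim
      case (elim n)
      have "\<psi> (y * inverse (b n)) \<le> \<psi> (x n)" using elim y by (intro \<psi>_mono) (auto simp: field_simps)
      then have "real n * \<psi> (y * inverse (b n)) \<le> real n * \<psi> (x n)" by (intro mult_left_mono) auto
      then show ?case using elim by simp
    qed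
  next
    fix c assume "\<kappa> powr \<beta> < c"
    then have "\<forall>\<^sub>F y in at_right \<kappa>. y powr \<beta> < c"
      using cont by (intro order_tendstoD(2)) (auto simp: filterlim_at_split)
    moreover have "\<forall>\<^sub>F y in at_right \<kappa>. y > \<kappa>" by (rule eventually_at_right_less)
    ultimately obtain y where y: "y powr \<beta> < c" "\<kappa> < y"
      using eventually_happens[OF eventually_conj] by (metis (mono_tags, lifting) trivial_limit_at_right_real)
    have "\<forall>\<^sub>F n in sequentially. real n * \<psi> (y * inverse (b n)) < c"
      using scaled_\<psi>_tendsto[of y] y \<kappa> by (intro order_tendstoD) auto
    then show "\<forall>\<^sub>F n in sequentially. real n * \<psi> (x n) < c"
      using order_tendstoD(2)[OF x y(2)] order_tendstoD(1)[OF x \<kappa>] bp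
    proof eventually_elim
      case (elim n)
      have "\<psi> (x n) \<le> \<psi> (y * inverse (b n))" using elim by (intro \<psi>_mono) (auto simp: field_simps zero_less_mult_iff)
      then have "real n * \<psi> (x n) \<le> real n * \<psi> (y * inverse (b n))" by (intro mult_left_mono) auto
      then show ?case using elim by simp
    qed
  qed
qed

lemma scaled_\<psi>_exp_tendsto:
  assumes \<kappa>: "\<kappa> > 0"
  shows "(\<lambda>n. real n * \<psi> (1 - exp (- \<kappa> / b n))) \<longlonglongrightarrow> \<kappa> powr \<beta>"
proof (rule scaled_\<psi>_tendsto'[OF \<kappa>])
  have "((\<lambda>x::real. x * (1 - exp (- \<kappa> / x))) \<longlongrightarrow> \<kappa>) at_top" using \<kappa> by real_asymp
  then show "(\<lambda>n. b n * (1 - exp (- \<kappa> / b n))) \<longlonglongrightarrow> \<kappa>"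
    by (rule filterlim_compose[OF _ b_at_top])
qed

end

section \<open>The subordinated walk as a sum of independent steps\<close>

context prob_space
begin

lemma expectation_freeze_processes:
  fixes f :: "'e::countable \<Rightarrow> ('i \<Rightarrow> 'b) \<Rightarrow> 'd::{real_normed_field, banach, second_countable_topology}"
  assumes ind: "indep_processes I K X J L Y"
    and X: "\<And>i. i \<in> I \<Longrightarrow> random_variable K (X i)" and Y: "\<And>j. j \<in> J \<Longrightarrow> random_variable L (Y j)"
    and G: "G \<in> measurable (PiM J (\<lambda>_. L)) (count_space UNIV)"
    and f: "\<And>r. f r \<in> borel_measurable (PiM I (\<lambda>_. K))"
    and C: "\<And>r x. norm (f r x) \<le> C"
  shows "expectation (\<lambda>\<omega>. f (G (\<lambda>j\<in>J. Y j \<omega>)) (\<lambda>i\<in>I. X i \<omega>)) =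
    expectation (\<lambda>\<omega>. expectation (\<lambda>\<omega>'. f (G (\<lambda>j\<in>J. Y j \<omega>)) (\<lambda>i\<in>I. X i \<omega>')))"
proof (rule expectation_freeze[where f="\<lambda>r \<omega>. f r (\<lambda>i\<in>I. X i \<omega>)" and T="\<lambda>\<omega>. G (\<lambda>j\<in>J. Y j \<omega>)" and C=C])
  let ?X = "\<lambda>\<omega>. \<lambda>i\<in>I. X i \<omega>" and ?Y = "\<lambda>\<omega>. \<lambda>j\<in>J. Y j \<omega>"
  have mX: "random_variable (PiM I (\<lambda>_. K)) ?X" and mY: "random_variable (PiM J (\<lambda>_. L)) ?Y"
    using X Y by (auto intro!: measurable_restrict)
  show T [measurable]: "random_variable (count_space UNIV) (\<lambda>\<omega>. G (?Y \<omega>))" using mY G by (rule measurable_compose)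
  show fX [measurable]: "random_variable borel (\<lambda>\<omega>. f r (?X \<omega>))" for r using mX f by (rule measurable_compose)
  fix r
  \<comment> \<open>The product rule for expectations wants both factors in the same field, so the
    indicator is embedded into 'd.\<close>
  let ?i = "\<lambda>y. of_real (indicat_real {r} (G y)) :: 'd"
  have "?i \<in> borel_measurable (PiM J (\<lambda>_. L))"
    by (intro measurable_compose[OF G]) simp
  from indep_processes_indep_var[OF ind X Y f this]
  have "indep_var borel (\<lambda>\<omega>. f r (?X \<omega>)) borel (\<lambda>\<omega>. ?i (?Y \<omega>))" .
  moreover have "integrable M (\<lambda>\<omega>. f r (?X \<omega>))" using C by (intro integrable_const_bound[of _ C]) auto
  moreover have "integrable M (\<lambda>\<omega>. ?i (?Y \<omega>))"
    by (intro integrable_const_bound[of _ 1] measurable_compose[OF T]) (auto simp: indicator_def)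
  ultimately have "expectation (\<lambda>\<omega>. f r (?X \<omega>) * ?i (?Y \<omega>)) = expectation (\<lambda>\<omega>. f r (?X \<omega>)) * expectation (\<lambda>\<omega>. ?i (?Y \<omega>))"
    by (rule indep_var_lebesgue_integral)
  moreover have "expectation (\<lambda>\<omega>. ?i (?Y \<omega>)) = of_real (prob {\<omega> \<in> space M. G (?Y \<omega>) = r})"
  proof -
    have "expectation (\<lambda>\<omega>. ?i (?Y \<omega>)) = of_real (expectation (\<lambda>\<omega>. indicat_real {r} (G (?Y \<omega>))))"
      by (rule integral_of_real) (intro integrable_const_bound[of _ 1] AE_I2 measurable_compose[OF T]; simp add: indicator_def)
    also have "expectation (\<lambda>\<omega>. indicat_real {r} (G (?Y \<omega>))) = expectation (indicator {\<omega> \<in> space M. G (?Y \<omega>) = r})"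
      by (rule Bochner_Integration.integral_cong) (auto simp: indicator_def)
    also have "\<dots> = prob {\<omega> \<in> space M. G (?Y \<omega>) = r}" by simp
    finally show ?thesis .
  qed
  moreover have "expectation (\<lambda>\<omega>. indicat_real {\<omega>. G (?Y \<omega>) = r} \<omega> *\<^sub>R f r (?X \<omega>)) = expectation (\<lambda>\<omega>. f r (?X \<omega>) * ?i (?Y \<omega>))"
    by (rule Bochner_Integration.integral_cong) (auto simp: indicator_def scaleR_conv_of_real)
  ultimately show "expectation (\<lambda>\<omega>. indicat_real {\<omega>. G (?Y \<omega>) = r} \<omega> *\<^sub>R f r (?X \<omega>)) =
      prob {\<omega> \<in> space M. G (?Y \<omega>) = r} *\<^sub>R expectation (\<lambda>\<omega>. f r (?X \<omega>))"
    by (simp add: scaleR_conv_of_real mult.commute)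
qed (use C in auto)

lemma indep_vars_sums:
  fixes Z :: "'i \<Rightarrow> 'a \<Rightarrow> real"
  assumes Z: "indep_vars (\<lambda>_. borel) Z I" and K: "\<And>j. j \<in> L \<Longrightarrow> K j \<subseteq> I" and disj: "disjoint_family_on K L"
  shows "indep_vars (\<lambda>_. borel) (\<lambda>j \<omega>. \<Sum>i\<in>K j. Z i \<omega>) L"
proof -
  have "indep_vars (\<lambda>_. borel) (\<lambda>j \<omega>. \<Sum>i\<in>K j. (\<lambda>i\<in>K j. Z i \<omega>) i) L"
    by (rule indep_vars_compose2[OF indep_vars_restrict[OF Z K disj], where Y="\<lambda>j z. \<Sum>i\<in>K j. z i"]) measurable
  then show ?thesis by simp
qed

lemma indep_vars_block_sums:
  fixes Z :: "nat \<Rightarrow> 'a \<Rightarrow> real" and s :: "nat \<Rightarrow> nat"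
  assumes Z: "indep_vars (\<lambda>_. borel) Z {1..}" and s: "mono s"
  shows "indep_vars (\<lambda>_. borel) (\<lambda>k \<omega>. \<Sum>i\<in>{s k<..s (Suc k)}. Z i \<omega>) UNIV"
proof (rule indep_vars_sums[OF Z])
  show "disjoint_family_on (\<lambda>k. {s k<..s (Suc k)}) UNIV"
    unfolding disjoint_family_on_def
  proof (intro ballI impI)
    fix j k :: nat assume "j \<noteq> k"
    then consider "Suc j \<le> k" | "Suc k \<le> j" by linarith
    then show "{s j<..s (Suc j)} \<inter> {s k<..s (Suc k)} = {}"
      using monoD[OF s, of "Suc j" k] monoD[OF s, of "Suc k" j] by cases auto
  qed
qed auto

end

text \<open>From exp y \<ge> 1 + y one gets 1 - exp (- y) \<ge> y / (1 + y) \<ge> min 1 y / 2. With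
  y a multiple of the number of steps, the right side becomes a generating function.\<close>

lemma min_one_le_exp:
  fixes y :: real
  assumes y: "y \<ge> 0" shows "min 1 y \<le> 2 * (1 - exp (- y))"
proof -
  have "exp (- y) \<le> 1 / (1 + y)"
    using exp_ge_add_one_self[of y] y by (simp add: exp_minus field_simps)
  then have "2 * (1 - 1 / (1 + y)) \<le> 2 * (1 - exp (- y))" by simp
  moreover have "min 1 y \<le> 2 * (1 - 1 / (1 + y))"
  proof (cases "y \<le> 1")
    case True
    then have "y * y \<le> y" using y by (simp add: mult_left_le)
    then show ?thesis using y True by (simp add: field_simps)
  qed (use y in \<open>simp add: field_simps\<close>)
  ultimately show ?thesis by linarith
qed

locale subordinated_walk = prob_space M for M :: "'a measure" +
  fixes X :: "nat \<Rightarrow> 'a \<Rightarrow> int" and p :: "int pmf" and R :: "nat \<Rightarrow> 'a \<Rightarrow> nat" and \<psi> :: "real \<Rightarrow> real"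
  assumes X: "class_S_steps X p" "expectation (\<lambda>\<omega>. real_of_int (X 1 \<omega>)) = 0"
      "variance (\<lambda>\<omega>. real_of_int (X 1 \<omega>)) = 1"
    and R: "indep_vars (\<lambda>_. count_space UNIV) R {1..}"
    and R_gf: "\<And>i s. i \<ge> 1 \<Longrightarrow> 0 \<le> s \<Longrightarrow> s \<le> 1 \<Longrightarrow> expectation (\<lambda>\<omega>. s ^ R i \<omega>) = 1 - \<psi> (1 - s)"
    and R_distr: "\<And>i. i \<ge> 1 \<Longrightarrow> distr M (count_space UNIV) (R i) = distr M (count_space UNIV) (R 1)"
    and XR: "indep_processes {1..} (count_space UNIV) X {1..} (count_space UNIV) R"
begin

definition x :: "nat \<Rightarrow> 'a \<Rightarrow> real" where "x i \<omega> = real_of_int (X i \<omega>)"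

definition \<tau> :: "nat \<Rightarrow> 'a \<Rightarrow> nat" where "\<tau> n \<omega> = (\<Sum>i<n. R (Suc i) \<omega>)"

definition Z :: "nat \<Rightarrow> 'a \<Rightarrow> real" where "Z k \<omega> = (\<Sum>i\<in>{\<tau> (k - 1) \<omega><..\<tau> k \<omega>}. x i \<omega>)"

definition \<phi> :: "real \<Rightarrow> complex" where "\<phi> = char (distr M borel (x 1))"

lemma X_rv: "i \<ge> 1 \<Longrightarrow> random_variable (count_space UNIV) (X i)"
  using X(1) unfolding class_S_steps_def indep_vars_def2 by simp

lemma R_rv: "i \<ge> 1 \<Longrightarrow> random_variable (count_space UNIV) (R i)"
  using R unfolding indep_vars_def2 by simp

lemma expectation_R:
  fixes g :: "nat \<Rightarrow> 'd::{banach, second_countable_topology}"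
  assumes "i \<ge> 1" shows "expectation (\<lambda>\<omega>. g (R i \<omega>)) = expectation (\<lambda>\<omega>. g (R 1 \<omega>))"
  using integral_distr[OF R_rv[OF assms], of g] integral_distr[OF R_rv[of 1], of g] R_distr[OF assms] by simp

lemma R_Suc_rv [measurable]: "random_variable (count_space UNIV) (R (Suc i))"
  by (rule R_rv) simp

lemma \<tau>_mono: "i \<le> j \<Longrightarrow> \<tau> i \<omega> \<le> \<tau> j \<omega>"
  unfolding \<tau>_def by (intro sum_mono2) auto

lemma \<tau>_rv [measurable]: "random_variable (count_space UNIV) (\<tau> n)"
  unfolding \<tau>_def by measurable

lemma partial_sums_R: "partial_sums R n \<omega> = \<tau> n \<omega>"
  unfolding partial_sums_def \<tau>_def using sum.atLeast1_atMost_eq[of "\<lambda>i. R i \<omega>" n] by simp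

lemma x_rv: "i \<ge> 1 \<Longrightarrow> random_variable borel (x i)"
  unfolding x_def by (rule measurable_compose[OF X_rv]) auto

lemma x_indep: "indep_vars (\<lambda>_. borel) x {1..}"
  unfolding x_def
  by (rule indep_vars_compose2[where X=X]) (use X(1) in \<open>auto simp: class_S_steps_def\<close>)

lemma X_distr: "i \<ge> 1 \<Longrightarrow> distr M (count_space UNIV) (X i) = measure_pmf p"
  using X(1) unfolding class_S_steps_def by simp

lemma integrable_X:
  fixes h :: "int \<Rightarrow> real"
  assumes i: "i \<ge> 1" shows "integrable M (\<lambda>\<omega>. h (X i \<omega>))"
proof -
  have "integrable (measure_pmf p) h"
    using X(1) unfolding class_S_steps_def by (intro integrable_measure_pmf_finite) simp
  then show ?thesis
    unfolding X_distr[OF i, symmetric] by (subst (asm) integrable_distr_eq[OF X_rv[OF i]]) auto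
qed

lemma expectation_X:
  fixes h :: "int \<Rightarrow> real"
  assumes "i \<ge> 1" shows "expectation (\<lambda>\<omega>. h (X i \<omega>)) = expectation (\<lambda>\<omega>. h (X 1 \<omega>))"
proof -
  have "expectation (\<lambda>\<omega>. h (X j \<omega>)) = measure_pmf.expectation p h" if "j \<ge> 1" for j
    unfolding X_distr[OF that, symmetric] by (rule integral_distr[symmetric, OF X_rv[OF that]]) simp
  from this[OF assms] this[of 1] show ?thesis by simp
qed

lemma x_moments:
  assumes i: "i \<ge> 1"
  shows "integrable M (x i)" "expectation (x i) = 0" "integrable M (\<lambda>\<omega>. (x i \<omega>)\<^sup>2)" "expectation (\<lambda>\<omega>. (x i \<omega>)\<^sup>2) = 1"
proof -
  show "integrable M (x i)" unfolding x_def using integrable_X[OF i, of real_of_int] by simp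
  show "expectation (x i) = 0" unfolding x_def using expectation_X[OF i, of real_of_int] X(2) by simp
  show "integrable M (\<lambda>\<omega>. (x i \<omega>)\<^sup>2)" unfolding x_def using integrable_X[OF i, of "\<lambda>z. (real_of_int z)\<^sup>2"] by simp
  show "expectation (\<lambda>\<omega>. (x i \<omega>)\<^sup>2) = 1"
    unfolding x_def using expectation_X[OF i, of "\<lambda>z. (real_of_int z)\<^sup>2"] X(2,3) by simp
qed

lemma x_distr:
  assumes i: "i \<ge> 1" shows "distr M borel (x i) = distr M borel (x 1)"
proof -
  have "distr M borel (x j) = distr (measure_pmf p) borel real_of_int" if "j \<ge> 1" for j
    unfolding X_distr[OF that, symmetric] using X_rv[OF that]
    by (subst distr_distr) (auto simp: comp_def x_def[abs_def])
  from this[OF i] this[of 1] show ?thesis by simp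
qed

section \<open>Sums of the \<open>x i\<close> over blocks of indices\<close>

lemma block_rv: "random_variable borel (\<lambda>\<omega>. \<Sum>i\<in>{u<..v}. x i \<omega>)"
  by (intro borel_measurable_sum x_rv) auto

lemma char_block: "char (distr M borel (\<lambda>\<omega>. \<Sum>i\<in>{u<..v}. x i \<omega>)) \<theta> = \<phi> \<theta> ^ (v - u)"
proof -
  have "char (distr M borel (\<lambda>\<omega>. \<Sum>i\<in>{u<..v}. x i \<omega>)) \<theta> = (\<Prod>i\<in>{u<..v}. char (distr M borel (x i)) \<theta>)"
    by (intro char_distr_sum indep_vars_subset[OF x_indep]) auto
  also have "\<dots> = (\<Prod>i\<in>{u<..v}. \<phi> \<theta>)"
    unfolding \<phi>_def by (intro prod.cong refl arg_cong2[where f=char] x_distr) auto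
  finally show ?thesis by simp
qed

lemma distr_block: "distr M borel (\<lambda>\<omega>. \<Sum>i\<in>{u<..v}. x i \<omega>) = distr M borel (\<lambda>\<omega>. \<Sum>i\<in>{0<..v - u}. x i \<omega>)"
  by (rule Levy_uniqueness) (auto intro!: real_distribution_distr block_rv simp: char_block)

lemma expectation_block:
  fixes g :: "real \<Rightarrow> 'd::{banach, second_countable_topology}"
  assumes g: "g \<in> borel_measurable borel"
  shows "expectation (\<lambda>\<omega>. g (\<Sum>i\<in>{u<..v}. x i \<omega>)) = expectation (\<lambda>\<omega>. g (\<Sum>i\<in>{0<..v - u}. x i \<omega>))"
  using integral_distr[OF block_rv g, of u v] integral_distr[OF block_rv g, of 0 "v - u"] distr_block[of u v] by simp

text \<open>The four facts are proved in one induction, because the cross term with the new summand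
  vanishes by independence, integrability and mean zero.\<close>

lemma block_second_moment:
  assumes "finite A" "A \<subseteq> {1..}"
  shows "integrable M (\<lambda>\<omega>. (\<Sum>i\<in>A. x i \<omega>)\<^sup>2) \<and> expectation (\<lambda>\<omega>. (\<Sum>i\<in>A. x i \<omega>)\<^sup>2) = real (card A) \<and>
    expectation (\<lambda>\<omega>. \<Sum>i\<in>A. x i \<omega>) = 0 \<and> integrable M (\<lambda>\<omega>. \<Sum>i\<in>A. x i \<omega>)"
  using assms
proof (induction A rule: finite_induct)
  case (insert k A)
  note m = x_moments[of k]
  have k: "k \<ge> 1" using insert.prems by auto
  have IH: "integrable M (\<lambda>\<omega>. (\<Sum>i\<in>A. x i \<omega>)\<^sup>2)" "expectation (\<lambda>\<omega>. (\<Sum>i\<in>A. x i \<omega>)\<^sup>2) = real (card A)"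
    "expectation (\<lambda>\<omega>. \<Sum>i\<in>A. x i \<omega>) = 0" "integrable M (\<lambda>\<omega>. \<Sum>i\<in>A. x i \<omega>)"
    using insert.IH insert.prems by auto
  have ind: "indep_var borel (x k) borel (\<lambda>\<omega>. \<Sum>i\<in>A. x i \<omega>)"
    using insert by (intro indep_vars_sum indep_vars_subset[OF x_indep]) auto
  note im = indep_var_integrable[OF ind m(1)[OF k] IH(4)]
  note em = indep_var_lebesgue_integral[OF ind m(1)[OF k] IH(4)]
  have "expectation (\<lambda>\<omega>. (x k \<omega> + (\<Sum>i\<in>A. x i \<omega>))\<^sup>2)
      = expectation (\<lambda>\<omega>. (x k \<omega>)\<^sup>2 + ((\<Sum>i\<in>A. x i \<omega>)\<^sup>2 + 2 * (x k \<omega> * (\<Sum>i\<in>A. x i \<omega>))))"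
    by (rule Bochner_Integration.integral_cong) (simp_all add: power2_sum)
  also have "\<dots> = expectation (\<lambda>\<omega>. (x k \<omega>)\<^sup>2) + (expectation (\<lambda>\<omega>. (\<Sum>i\<in>A. x i \<omega>)\<^sup>2) + expectation (\<lambda>\<omega>. 2 * (x k \<omega> * (\<Sum>i\<in>A. x i \<omega>))))"
    using m(3)[OF k] IH im by simp
  also have "\<dots> = 1 + real (card A)" using m(4)[OF k] IH em by simp
  finally have "expectation (\<lambda>\<omega>. (x k \<omega> + (\<Sum>i\<in>A. x i \<omega>))\<^sup>2) = 1 + real (card A)" .
  moreover have "integrable M (\<lambda>\<omega>. (x k \<omega> + (\<Sum>i\<in>A. x i \<omega>))\<^sup>2)"
  proof -
    have "integrable M (\<lambda>\<omega>. (x k \<omega>)\<^sup>2 + ((\<Sum>i\<in>A. x i \<omega>)\<^sup>2 + 2 * (x k \<omega> * (\<Sum>i\<in>A. x i \<omega>))))"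
      using m(3)[OF k] IH im by simp
    then show ?thesis by (simp add: power2_sum algebra_simps)
  qed
  ultimately show ?case using insert m(1,2)[OF k] IH by simp
qed (simp add: prob_space)

lemma block_tail:
  assumes a: "a > 0"
  shows "prob {\<omega> \<in> space M. a \<le> \<bar>\<Sum>i\<in>{u<..v}. x i \<omega>\<bar>} \<le> real (v - u) / a\<^sup>2"
proof -
  have sub: "{u<..v} \<subseteq> {1..}" by auto
  have m: "integrable M (\<lambda>\<omega>. (\<Sum>i\<in>{u<..v}. x i \<omega>)\<^sup>2)" "expectation (\<lambda>\<omega>. (\<Sum>i\<in>{u<..v}. x i \<omega>)\<^sup>2) = real (v - u)"
    "expectation (\<lambda>\<omega>. \<Sum>i\<in>{u<..v}. x i \<omega>) = 0"
    using block_second_moment[OF _ sub] by simp_all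
  show ?thesis using Chebyshev_inequality[OF block_rv m(1) a] m by simp
qed

lemma restrict_sum_block: "(\<Sum>i\<in>{u<..v}. real_of_int ((\<lambda>i\<in>{1..}. X i \<omega>) i)) = (\<Sum>i\<in>{u<..v}. x i \<omega>)"
  by (intro sum.cong) (auto simp: x_def)

lemma block_PiM_measurable:
  "(\<lambda>y. \<Sum>i\<in>{u<..v::nat}. real_of_int (y i)) \<in> borel_measurable (PiM {1..} (\<lambda>_. count_space UNIV))"
  by (intro borel_measurable_sum measurable_compose[OF measurable_component_singleton]) auto

section \<open>The steps of the walk at random times\<close>

lemma Z_rv: "random_variable borel (Z k)"
proof -
  have "random_variable borel (\<lambda>\<omega>. \<Sum>i\<in>{u<..\<tau> k \<omega>}. x i \<omega>)" for u
    by (rule measurable_compose_countable[where g="\<tau> k"]) (auto intro: block_rv)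
  then show ?thesis
    unfolding Z_def by (rule measurable_compose_countable[where g="\<tau> (k - 1)"]) auto
qed

lemma sum_Z: "i \<le> j \<Longrightarrow> (\<Sum>k\<in>{i<..j}. Z k \<omega>) = (\<Sum>l\<in>{\<tau> i \<omega><..\<tau> j \<omega>}. x l \<omega>)"
proof (induction j rule: dec_induct)
  case (step j)
  have "{i<..Suc j} = insert (Suc j) {i<..j}" using step by auto
  moreover have "{\<tau> i \<omega><..\<tau> (Suc j) \<omega>} = {\<tau> i \<omega><..\<tau> j \<omega>} \<union> {\<tau> j \<omega><..\<tau> (Suc j) \<omega>}"
    using \<tau>_mono[of i j \<omega>] \<tau>_mono[of j "Suc j" \<omega>] step by auto
  ultimately show ?case using step.IH by (simp add: Z_def sum.union_disjoint add.commute)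
qed simp

lemma partial_sums_X_\<tau>: "real_of_int (partial_sums X (partial_sums R n \<omega>) \<omega>) = (\<Sum>k\<in>{0<..n}. Z k \<omega>)"
proof -
  have "real_of_int (partial_sums X (partial_sums R n \<omega>) \<omega>) = (\<Sum>i\<in>{1..\<tau> n \<omega>}. x i \<omega>)"
    unfolding partial_sums_R unfolding partial_sums_def x_def by simp
  also have "{1..\<tau> n \<omega>} = {\<tau> 0 \<omega><..\<tau> n \<omega>}" by (auto simp: \<tau>_def)
  finally show ?thesis using sum_Z[of 0 n \<omega>] by simp
qed

lemma expectation_prod_Z_R:
  fixes g :: "nat \<Rightarrow> real \<Rightarrow> 'd::{real_normed_field, banach, second_countable_topology}"
  assumes g [measurable]: "\<And>k. g k \<in> borel_measurable borel" and g1: "\<And>k z. norm (g k z) \<le> 1"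
  shows "expectation (\<lambda>\<omega>. \<Prod>k<n. g k (Z (Suc k) \<omega>)) =
    (\<Prod>k<n. expectation (\<lambda>\<omega>. expectation (\<lambda>\<omega>'. g k (\<Sum>i\<in>{0<..R (Suc k) \<omega>}. x i \<omega>'))))"
proof -
  define s where "s = (\<lambda>(r::nat list) k. \<Sum>i<k. r ! i)"
  \<comment> \<open>\<open>indep_vars_block_sums\<close> takes a sequence of block ends on all
    naturals. Beyond the end of the list the entries \<open>r ! i\<close> are unspecified but still
    natural numbers, so monotonicity persists.\<close>
  have s_mono: "mono (s r)" for r unfolding s_def mono_def by (auto intro: sum_mono2)
  define f where "f = (\<lambda>r y. \<Prod>k<n. g k (\<Sum>i\<in>{s r k<..s r (Suc k)}. real_of_int (y i)))"
  define G where "G = (\<lambda>y::nat \<Rightarrow> nat. map y [1..<Suc n])"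
  have Gm: "G \<in> measurable (PiM {1..} (\<lambda>_. count_space UNIV)) (count_space UNIV)"
    unfolding measurable_count_space_eq2_countable
  proof (intro conjI ballI)
    fix l
    have "G y = l \<longleftrightarrow> length l = n \<and> (\<forall>i\<in>{..<n}. y (Suc i) = l ! i)" for y
      unfolding G_def by (subst list_eq_iff_nth_eq) (auto simp del: upt_Suc)
    then have "G -` {l} \<inter> space (PiM {1..} (\<lambda>_. count_space UNIV)) =
      {y \<in> space (PiM {1..} (\<lambda>_. count_space UNIV)). length l = n \<and> (\<forall>i\<in>{..<n}. y (Suc i) = l ! i)}"
      by auto
    also have "\<dots> \<in> sets (PiM {1..} (\<lambda>_. count_space UNIV))"
    proof (intro sets.sets_Collect_conj sets.sets_Collect_finite_All)
      fix i
      have [measurable]: "(\<lambda>y. y (Suc i)) \<in> measurable (PiM {1..} (\<lambda>_. count_space UNIV)) (count_space UNIV)"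
        by (rule measurable_component_singleton) simp
      show "{y \<in> space (PiM {1..} (\<lambda>_. count_space UNIV)). y (Suc i) = l ! i} \<in> sets (PiM {1..} (\<lambda>_. count_space UNIV))"
        by measurable
    qed auto
    finally show "G -` {l} \<inter> space (PiM {1..} (\<lambda>_. count_space UNIV)) \<in> sets (PiM {1..} (\<lambda>_. count_space UNIV))" .
  qed simp
  have fm: "f r \<in> borel_measurable (PiM {1..} (\<lambda>_. count_space UNIV))" for r
    unfolding f_def by (intro borel_measurable_prod measurable_compose[OF block_PiM_measurable g])
  have f1: "norm (f r y) \<le> 1" for r y
    unfolding f_def prod_norm[symmetric] using g1 by (intro prod_le_1) auto
  have nth: "G (\<lambda>j\<in>{1..}. R j \<omega>) ! i = R (Suc i) \<omega>" if "i < n" for i \<omega>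
    using that unfolding G_def by (simp del: upt_Suc)
  have sG: "s (G (\<lambda>j\<in>{1..}. R j \<omega>)) k = \<tau> k \<omega>" if "k \<le> n" for k \<omega>
    unfolding s_def \<tau>_def using nth that by (intro sum.cong) auto
  have left: "f (G (\<lambda>j\<in>{1..}. R j \<omega>)) (\<lambda>i\<in>{1..}. X i \<omega>) = (\<Prod>k<n. g k (Z (Suc k) \<omega>))" for \<omega>
    unfolding f_def restrict_sum_block Z_def using sG by (intro prod.cong) auto
  have h: "expectation (\<lambda>\<omega>'. f r (\<lambda>i\<in>{1..}. X i \<omega>')) = (\<Prod>k<n. expectation (\<lambda>\<omega>'. g k (\<Sum>i\<in>{0<..r ! k}. x i \<omega>')))" for r
  proof -
    have ind: "indep_vars (\<lambda>_. borel) (\<lambda>k \<omega>'. g k (\<Sum>i\<in>{s r k<..s r (Suc k)}. x i \<omega>')) {..<n}"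
      by (rule indep_vars_subset[OF indep_vars_compose2[OF indep_vars_block_sums[OF x_indep s_mono]]]) auto
    have "expectation (\<lambda>\<omega>'. f r (\<lambda>i\<in>{1..}. X i \<omega>')) = expectation (\<lambda>\<omega>'. \<Prod>k<n. g k (\<Sum>i\<in>{s r k<..s r (Suc k)}. x i \<omega>'))"
      unfolding f_def restrict_sum_block ..
    also have "\<dots> = (\<Prod>k<n. expectation (\<lambda>\<omega>'. g k (\<Sum>i\<in>{s r k<..s r (Suc k)}. x i \<omega>')))"
      using g1 by (intro indep_vars_lebesgue_integral[OF _ ind] integrable_const_bound[of _ 1] measurable_compose[OF block_rv g]) auto
    also have "\<dots> = (\<Prod>k<n. expectation (\<lambda>\<omega>'. g k (\<Sum>i\<in>{0<..r ! k}. x i \<omega>')))"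
    proof (rule prod.cong[OF refl])
      fix k
      have "s r (Suc k) - s r k = r ! k" unfolding s_def by simp
      then show "expectation (\<lambda>\<omega>'. g k (\<Sum>i\<in>{s r k<..s r (Suc k)}. x i \<omega>')) = expectation (\<lambda>\<omega>'. g k (\<Sum>i\<in>{0<..r ! k}. x i \<omega>'))"
        using expectation_block[OF g[of k], of "s r k" "s r (Suc k)"] by simp
    qed
    finally show ?thesis .
  qed
  define H where "H = (\<lambda>k m. expectation (\<lambda>\<omega>'. g k (\<Sum>i\<in>{0<..m::nat}. x i \<omega>')))"
  have H1: "norm (H k m) \<le> 1" for k m
  proof -
    have "norm (H k m) \<le> expectation (\<lambda>\<omega>'. norm (g k (\<Sum>i\<in>{0<..m}. x i \<omega>')))"
      unfolding H_def by (rule integral_norm_bound)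
    also have "\<dots> \<le> expectation (\<lambda>_. 1)"
      using g1 by (intro integral_mono integrable_const_bound[of _ 1] measurable_compose[OF measurable_compose[OF block_rv g]]) auto
    finally show ?thesis by (simp add: prob_space)
  qed
  have "expectation (\<lambda>\<omega>. \<Prod>k<n. g k (Z (Suc k) \<omega>)) = expectation (\<lambda>\<omega>. f (G (\<lambda>j\<in>{1..}. R j \<omega>)) (\<lambda>i\<in>{1..}. X i \<omega>))"
    unfolding left ..
  also have "\<dots> = expectation (\<lambda>\<omega>. expectation (\<lambda>\<omega>'. f (G (\<lambda>j\<in>{1..}. R j \<omega>)) (\<lambda>i\<in>{1..}. X i \<omega>')))"
    by (rule expectation_freeze_processes[OF XR X_rv R_rv Gm fm f1]) auto
  also have "\<dots> = expectation (\<lambda>\<omega>. \<Prod>k<n. H k (R (Suc k) \<omega>))"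
    unfolding h H_def using nth by (intro Bochner_Integration.integral_cong prod.cong) auto
  also have "\<dots> = (\<Prod>k<n. expectation (\<lambda>\<omega>. H k (R (Suc k) \<omega>)))"
  proof (rule indep_vars_lebesgue_integral)
    have "indep_vars (\<lambda>k. PiM {Suc k} (\<lambda>_. count_space UNIV)) (\<lambda>k \<omega>. restrict (\<lambda>i. R i \<omega>) {Suc k}) {..<n}"
      by (rule indep_vars_restrict[OF R]) (auto simp: disjoint_family_on_def)
    then have "indep_vars (\<lambda>_. borel) (\<lambda>k \<omega>. H k ((\<lambda>i\<in>{Suc k}. R i \<omega>) (Suc k))) {..<n}"
      by (rule indep_vars_compose2[where Y="\<lambda>k z. H k (z (Suc k))"]) (auto intro!: measurable_compose[OF measurable_component_singleton])
    then show "indep_vars (\<lambda>_. borel) (\<lambda>k \<omega>. H k (R (Suc k) \<omega>)) {..<n}" by simp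
    show "integrable M (\<lambda>\<omega>. H k (R (Suc k) \<omega>))" for k
      using H1 by (intro integrable_const_bound[of _ 1] measurable_compose[OF R_Suc_rv]) auto
  qed simp
  finally show ?thesis unfolding H_def .
qed

lemma expectation_Z_R:
  fixes g :: "real \<Rightarrow> 'd::{real_normed_field, banach, second_countable_topology}"
  assumes g: "g \<in> borel_measurable borel" "\<And>z. norm (g z) \<le> 1"
  shows "expectation (\<lambda>\<omega>. g (Z (Suc k) \<omega>)) = expectation (\<lambda>\<omega>. expectation (\<lambda>\<omega>'. g (\<Sum>i\<in>{0<..R (Suc k) \<omega>}. x i \<omega>')))"
proof -
  \<comment> \<open>Constant factors 1 reduce the product formula to a formula for a single
    step.\<close>
  define g' where "g' = (\<lambda>j. if j = k then g else (\<lambda>_. 1))"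
  have "(\<Prod>j<Suc k. g' j (Z (Suc j) \<omega>)) = g (Z (Suc k) \<omega>)" for \<omega>
    unfolding g'_def by simp
  moreover have "(\<Prod>j<Suc k. expectation (\<lambda>\<omega>. expectation (\<lambda>\<omega>'. g' j (\<Sum>i\<in>{0<..R (Suc j) \<omega>}. x i \<omega>'))))
      = expectation (\<lambda>\<omega>. expectation (\<lambda>\<omega>'. g (\<Sum>i\<in>{0<..R (Suc k) \<omega>}. x i \<omega>')))"
    unfolding g'_def by (simp add: prob_space)
  moreover have "g' j \<in> borel_measurable borel" "norm (g' j z) \<le> 1" for j z
    unfolding g'_def using g by auto
  ultimately show ?thesis using expectation_prod_Z_R[of g' "Suc k"] by simp
qed

lemma Z_indep: "indep_vars (\<lambda>_. borel) Z {1..}"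
proof -
  have "indep_vars (\<lambda>_. borel) (\<lambda>k. Z (Suc k)) UNIV"
  proof (rule indep_vars_if_expectation_prod)
    fix n and g :: "nat \<Rightarrow> real \<Rightarrow> real"
    assume g: "\<And>i. continuous_on UNIV (g i)" "\<And>i x. \<bar>g i x\<bar> \<le> 1"
    have gm: "g i \<in> borel_measurable borel" for i using g(1) by (rule borel_measurable_continuous_onI)
    show "expectation (\<lambda>\<omega>. \<Prod>i<n. g i (Z (Suc i) \<omega>)) = (\<Prod>i<n. expectation (\<lambda>\<omega>. g i (Z (Suc i) \<omega>)))"
      using expectation_prod_Z_R[of g n] expectation_Z_R[of "g _"] g(2) gm by simp
  qed (rule Z_rv)
  \<comment> \<open>One-element sums carry out the index shift from all naturals to {1..}.\<close>
  then have "indep_vars (\<lambda>_. borel) (\<lambda>k \<omega>. \<Sum>i\<in>{k - 1}. Z (Suc i) \<omega>) {1..}"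
    by (rule indep_vars_sums) (auto simp: disjoint_family_on_def)
  then have "indep_vars (\<lambda>_. borel) (\<lambda>k. Z (Suc (k - 1))) {1..}" by simp
  then show ?thesis by (rule indep_vars_cong[THEN iffD1, rotated -1]) auto
qed

lemma char_Z: "k \<ge> 1 \<Longrightarrow> char (distr M borel (Z k)) \<theta> = expectation (\<lambda>\<omega>. \<phi> \<theta> ^ R k \<omega>)"
proof -
  assume "k \<ge> 1"
  then obtain j where j: "k = Suc j" by (cases k) auto
  have h: "expectation (\<lambda>\<omega>'. iexp (\<theta> * (\<Sum>i\<in>{0<..m}. x i \<omega>'))) = \<phi> \<theta> ^ m" for m
    using char_block[of 0 m \<theta>] unfolding char_def by (subst (asm) integral_distr[OF block_rv]) auto
  have "char (distr M borel (Z k)) \<theta> = expectation (\<lambda>\<omega>. iexp (\<theta> * Z (Suc j) \<omega>))"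
    unfolding char_def j by (rule integral_distr[OF Z_rv]) simp
  also have "\<dots> = expectation (\<lambda>\<omega>. expectation (\<lambda>\<omega>'. iexp (\<theta> * (\<Sum>i\<in>{0<..R (Suc j) \<omega>}. x i \<omega>'))))"
    by (rule expectation_Z_R) auto
  finally show ?thesis unfolding j h .
qed

text \<open>Given R, Chebyshev's inequality and the trivial bound 1 combine to min 1 (L / a^2),
  where L is the sum of the R k over the block. By \<open>min_one_le_exp\<close> this is at most 2 *
  (1 - q ^ L) with q = exp (- 1 / a^2), whose mean the generating function gives exactly.
  Bernoulli's inequality then makes the bound linear in j - i.\<close>

lemma Z_tail:
  assumes a: "a > 0" and ij: "i \<le> j"
  shows "prob {\<omega> \<in> space M. a \<le> \<bar>\<Sum>k\<in>{i<..j}. Z k \<omega>\<bar>} \<le> 2 * (real (j - i) * \<psi> (1 - exp (- 1 / a\<^sup>2)))"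
proof -
  define f :: "nat \<times> nat \<Rightarrow> (nat \<Rightarrow> int) \<Rightarrow> real" where
    "f = (\<lambda>(u, v) y. indicator {a..} \<bar>\<Sum>i\<in>{u<..v}. real_of_int (y i)\<bar>)"
  define G where "G = (\<lambda>y::nat \<Rightarrow> nat. (\<Sum>k<i. y (Suc k), \<Sum>k<j. y (Suc k)))"
  let ?E = "\<lambda>\<omega>. expectation (\<lambda>\<omega>'. f (G (\<lambda>k\<in>{1..}. R k \<omega>)) (\<lambda>i\<in>{1..}. X i \<omega>'))"
  have Gm: "G \<in> measurable (PiM {1..} (\<lambda>_. count_space UNIV)) (count_space UNIV)"
  proof -
    have [measurable]: "(\<lambda>y. y (Suc k)) \<in> measurable (PiM {1..} (\<lambda>_. count_space UNIV)) (count_space UNIV)" for k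
      by (rule measurable_component_singleton) simp
    have "G \<in> measurable (PiM {1..} (\<lambda>_. count_space UNIV)) (count_space UNIV \<Otimes>\<^sub>M count_space UNIV)"
      unfolding G_def by measurable
    then show ?thesis by (simp add: pair_measure_countable)
  qed
  have fe: "f (u, v) (\<lambda>i\<in>{1..}. X i \<omega>) = indicator {a..} \<bar>\<Sum>i\<in>{u<..v}. x i \<omega>\<bar>" for u v \<omega>
    by (simp only: f_def prod.case restrict_sum_block)
  have fm: "f r \<in> borel_measurable (PiM {1..} (\<lambda>_. count_space UNIV))" for r
    unfolding f_def using block_PiM_measurable[of "fst r" "snd r"] by (cases r) (simp, measurable)
  have f1: "norm (f r y) \<le> 1" for r y unfolding f_def by (auto simp: indicator_def split: prod.split)
  have GR: "G (\<lambda>k\<in>{1..}. R k \<omega>) = (\<tau> i \<omega>, \<tau> j \<omega>)" for \<omega> unfolding G_def \<tau>_def by simp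
  let ?q = "exp (- 1 / a\<^sup>2)"
  have q: "0 \<le> ?q" "?q \<le> 1" by auto
  have diff: "\<tau> j \<omega> - \<tau> i \<omega> = (\<Sum>k\<in>{i<..j}. R k \<omega>)" for \<omega>
  proof -
    have "\<tau> j \<omega> = \<tau> i \<omega> + (\<Sum>k\<in>{i<..j}. R k \<omega>)"
    proof -
      have "\<tau> m \<omega> = (\<Sum>k\<in>{0<..m}. R k \<omega>)" for m
        using partial_sums_R[of m \<omega>] unfolding partial_sums_def
        by (simp add: atLeastSucAtMost_greaterThanAtMost)
      moreover have "{0<..j} = {0<..i} \<union> {i<..j}" using ij by auto
      ultimately show ?thesis by (simp add: sum.union_disjoint)
    qed
    then show ?thesis by simp
  qed
  have tail: "expectation (\<lambda>\<omega>'. f (u, v) (\<lambda>i\<in>{1..}. X i \<omega>')) \<le> 2 * (1 - ?q ^ (v - u))" for u v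
  proof -
    have "expectation (\<lambda>\<omega>'. f (u, v) (\<lambda>i\<in>{1..}. X i \<omega>')) = expectation (indicator {\<omega> \<in> space M. a \<le> \<bar>\<Sum>i\<in>{u<..v}. x i \<omega>\<bar>})"
      unfolding fe by (rule Bochner_Integration.integral_cong) (auto simp: indicator_def)
    also have "\<dots> = prob {\<omega> \<in> space M. a \<le> \<bar>\<Sum>i\<in>{u<..v}. x i \<omega>\<bar>}"
      using block_rv[of u v] by simp
    also have "\<dots> \<le> min 1 (real (v - u) / a\<^sup>2)" using block_tail[OF a, of u v] by simp
    also have "\<dots> \<le> 2 * (1 - exp (- (real (v - u) / a\<^sup>2)))" by (rule min_one_le_exp) simp
    also have "exp (- (real (v - u) / a\<^sup>2)) = ?q ^ (v - u)"
      by (simp add: exp_of_nat_mult[symmetric])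
    finally show ?thesis .
  qed
  have iv: "integrable M (\<lambda>\<omega>. ?q ^ (\<Sum>k\<in>{i<..j}. R k \<omega>))"
    unfolding diff[symmetric] using q by (intro integrable_const_bound[of _ 1]) (auto simp: power_le_one)
  have "prob {\<omega> \<in> space M. a \<le> \<bar>\<Sum>k\<in>{i<..j}. Z k \<omega>\<bar>} = expectation (indicator {\<omega> \<in> space M. a \<le> \<bar>\<Sum>k\<in>{i<..j}. Z k \<omega>\<bar>})"
    using Z_rv by simp
  also have "\<dots> = expectation (\<lambda>\<omega>. f (G (\<lambda>k\<in>{1..}. R k \<omega>)) (\<lambda>i\<in>{1..}. X i \<omega>))"
    unfolding GR fe by (rule Bochner_Integration.integral_cong) (auto simp: sum_Z[OF ij] indicator_def)
  also have "\<dots> = expectation (\<lambda>\<omega>. ?E \<omega>)"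
    by (rule expectation_freeze_processes[OF XR X_rv R_rv Gm fm f1]) auto
  also have "\<dots> \<le> expectation (\<lambda>\<omega>. 2 * (1 - ?q ^ (\<Sum>k\<in>{i<..j}. R k \<omega>)))"
  proof (rule integral_mono)
    show "integrable M (\<lambda>\<omega>. ?E \<omega>)"
    proof (rule integrable_const_bound[of _ 2])
      show "(\<lambda>\<omega>. ?E \<omega>) \<in> borel_measurable M"
        by (rule measurable_compose[OF measurable_compose[OF measurable_restrict Gm]]) (auto intro: R_rv)
      show "AE \<omega> in M. norm (?E \<omega>) \<le> 2"
      proof (rule AE_I2)
        fix \<omega>
        have "0 \<le> f r y" for r y unfolding f_def by (auto split: prod.split)
        then have "0 \<le> ?E \<omega>" by simp
        moreover have "?E \<omega> \<le> 2"
          unfolding GR by (rule order_trans[OF tail]) simp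
        ultimately show "norm (?E \<omega>) \<le> 2"
          by (simp only: real_norm_def abs_of_nonneg)
      qed
    qed
    show "integrable M (\<lambda>\<omega>. 2 * (1 - ?q ^ (\<Sum>k\<in>{i<..j}. R k \<omega>)))" using iv by simp
    show "?E \<omega> \<le> 2 * (1 - ?q ^ (\<Sum>k\<in>{i<..j}. R k \<omega>))" for \<omega>
      unfolding GR diff[symmetric] by (rule tail)
  qed
  also have "\<dots> = 2 * (1 - expectation (\<lambda>\<omega>. ?q ^ (\<Sum>k\<in>{i<..j}. R k \<omega>)))"
    using iv by (simp add: prob_space)
  also have "expectation (\<lambda>\<omega>. ?q ^ (\<Sum>k\<in>{i<..j}. R k \<omega>)) = (1 - \<psi> (1 - ?q)) ^ (j - i)"
  proof -
    have "expectation (\<lambda>\<omega>. ?q ^ (\<Sum>k\<in>{i<..j}. R k \<omega>)) = expectation (\<lambda>\<omega>. \<Prod>k\<in>{i<..j}. ?q ^ R k \<omega>)"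
      by (simp add: power_sum)
    also have "\<dots> = (\<Prod>k\<in>{i<..j}. expectation (\<lambda>\<omega>. ?q ^ R k \<omega>))"
    proof (rule indep_vars_lebesgue_integral)
      show "indep_vars (\<lambda>_. borel) (\<lambda>k \<omega>. ?q ^ R k \<omega>) {i<..j}"
        by (rule indep_vars_subset[OF indep_vars_compose2[OF R]]) auto
      show "integrable M (\<lambda>\<omega>. ?q ^ R k \<omega>)" if "k \<in> {i<..j}" for k
        using that q by (intro integrable_const_bound[of _ 1] measurable_compose[OF R_rv]) (auto simp: power_le_one)
    qed simp
    also have "\<dots> = (\<Prod>k\<in>{i<..j}. 1 - \<psi> (1 - ?q))" using R_gf q by (intro prod.cong) auto
    finally show ?thesis by simp
  qed
  also have "2 * (1 - (1 - \<psi> (1 - ?q)) ^ (j - i)) \<le> 2 * (real (j - i) * \<psi> (1 - ?q))"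
  proof -
    \<comment> \<open>A generating function is nonnegative, so \<psi> (1 - q) \<le> 1, as
      Bernoulli's inequality demands.\<close>
    have "0 \<le> expectation (\<lambda>\<omega>. ?q ^ R 1 \<omega>)" by simp
    then have "- 1 \<le> - \<psi> (1 - ?q)" unfolding R_gf[OF order_refl q] by simp
    then show ?thesis using Bernoulli_inequality[of "- \<psi> (1 - ?q)" "j - i"] by simp
  qed
  finally show ?thesis .
qed

end

section \<open>Scaling limit of the subordinated walk\<close>

text \<open>Comparison with the real numbers w n = exp (- \<kappa> / n), whose powers are explicit,
  avoids the complex logarithm: in the unit disc the powers differ by at most L n * norm (z n - w
  n), and n * (z n - w n) tends to 0.\<close>

lemma complex_power_tendsto_exp:
  fixes z :: "nat \<Rightarrow> complex" and \<kappa> t :: real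
  assumes z: "(\<lambda>n. of_nat n * (1 - z n)) \<longlonglongrightarrow> of_real \<kappa>" "\<And>n. norm (z n) \<le> 1"
    and L: "(\<lambda>n. real (L n) / real n) \<longlonglongrightarrow> t" and \<kappa>: "\<kappa> \<ge> 0"
  shows "(\<lambda>n. z n ^ L n) \<longlonglongrightarrow> of_real (exp (- (t * \<kappa>)))"
proof -
  define w where "w = (\<lambda>n. exp (- \<kappa> / real n))"
  have w1: "norm (of_real (w n) :: complex) \<le> 1" for n using \<kappa> by (simp add: w_def)
  have "(\<lambda>n. real n * (1 - w n)) \<longlonglongrightarrow> \<kappa>" unfolding w_def by real_asymp
  then have "(\<lambda>n. of_real (real n * (1 - w n)) :: complex) \<longlonglongrightarrow> of_real \<kappa>" by (rule tendsto_of_real)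
  from tendsto_diff[OF this z(1)] have "(\<lambda>n. of_nat n * (z n - of_real (w n))) \<longlonglongrightarrow> 0"
    by (simp add: algebra_simps)
  from tendsto_mult[OF L tendsto_norm[OF this]]
  have "(\<lambda>n. real (L n) / real n * norm (of_nat n * (z n - of_real (w n)))) \<longlonglongrightarrow> 0" by simp
  then have "(\<lambda>n. z n ^ L n - of_real (w n) ^ L n) \<longlonglongrightarrow> 0"
  proof (rule Lim_null_comparison[rotated])
    show "\<forall>\<^sub>F n in sequentially. norm (z n ^ L n - of_real (w n) ^ L n) \<le> real (L n) / real n * norm (of_nat n * (z n - of_real (w n)))"
      using eventually_gt_at_top[of 0]
    proof eventually_elim
      case (elim n)
      have "norm (z n ^ L n - of_real (w n) ^ L n) \<le> real (L n) * norm (z n - of_real (w n))"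
        by (rule norm_power_diff[OF z(2) w1])
      also have "\<dots> = real (L n) / real n * norm (of_nat n * (z n - of_real (w n)))"
        using elim by (simp add: norm_mult)
      finally show ?case .
    qed
  qed
  moreover have "(\<lambda>n. of_real (w n) ^ L n :: complex) \<longlonglongrightarrow> of_real (exp (- (t * \<kappa>)))"
  proof -
    have "(\<lambda>n. exp (- (real (L n) / real n * \<kappa>))) \<longlonglongrightarrow> exp (- (t * \<kappa>))"
      by (intro tendsto_intros L)
    moreover have "w n ^ L n = exp (- (real (L n) / real n * \<kappa>))" for n
      unfolding w_def by (simp add: exp_of_nat_mult[symmetric])
    ultimately have "(\<lambda>n. w n ^ L n) \<longlonglongrightarrow> exp (- (t * \<kappa>))" by simp
    from tendsto_of_real[OF this] show ?thesis by simp
  qed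
  ultimately show ?thesis using tendsto_add by fastforce
qed

lemma powr_minus_half:
  fixes y :: real
  assumes "y > 0" shows "y powr (- 1 / 2) = 1 / sqrt y"
proof -
  have "y powr (- 1 / 2) = y powr (- (1 / 2))" by (rule arg_cong[where f="\<lambda>a. y powr a"]) simp
  also have "\<dots> = 1 / sqrt y" using assms by (simp only: powr_minus_divide powr_half_sqrt less_imp_le)
  finally show ?thesis .
qed

locale scaled_walk = subordinated_walk M X p R \<psi> + regular_scaling \<psi> \<beta> b
  for M :: "'a measure" and X :: "nat \<Rightarrow> 'a \<Rightarrow> int" and p :: "int pmf" and R :: "nat \<Rightarrow> 'a \<Rightarrow> nat"
    and \<psi> :: "real \<Rightarrow> real" and \<beta> :: real and b :: "nat \<Rightarrow> real"
begin

section \<open>Characteristic functions under the scaling\<close>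

lemma norm_\<phi>_le_1: "norm (\<phi> \<theta>) \<le> 1"
  unfolding \<phi>_def by (rule real_distribution.cmod_char_le_1[OF real_distribution_distr[OF x_rv]]) simp

text \<open>Finite support gives a third absolute moment, hence an error cubic in \<theta>; at
  \<theta> / sqrt (b n) it is of smaller order than 1 / b n.\<close>

lemma \<phi>_expansion: "norm (\<phi> \<theta> - of_real (1 - \<theta>\<^sup>2 / 2)) \<le> \<bar>\<theta>\<bar> ^ 3 * expectation (\<lambda>\<omega>. \<bar>x 1 \<omega>\<bar> ^ 3) / 6"
proof -
  have i3: "integrable M (\<lambda>\<omega>. \<bar>x 1 \<omega>\<bar> ^ 3)"
    unfolding x_def using integrable_X[of 1 "\<lambda>z. \<bar>real_of_int z\<bar> ^ 3"] by simp
  have m: "random_variable borel (x 1)" "integrable M (x 1)" "integrable M (\<lambda>\<omega>. (x 1 \<omega>)\<^sup>2)" "expectation (x 1) = 0" "variance (x 1) = 1"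
    using x_rv[of 1] x_moments[of 1] by auto
  have "cmod (\<phi> \<theta> - (1 - of_real (\<theta>\<^sup>2) * 1 / 2)) \<le> (\<theta>\<^sup>2 / 6) * expectation (\<lambda>\<omega>. min (6 * (x 1 \<omega>)\<^sup>2) (\<bar>\<theta>\<bar> * \<bar>x 1 \<omega>\<bar> ^ 3))"
    using char_approx3'[OF m refl, of \<theta>] by (simp add: \<phi>_def)
  also have "expectation (\<lambda>\<omega>. min (6 * (x 1 \<omega>)\<^sup>2) (\<bar>\<theta>\<bar> * \<bar>x 1 \<omega>\<bar> ^ 3)) \<le> expectation (\<lambda>\<omega>. \<bar>\<theta>\<bar> * \<bar>x 1 \<omega>\<bar> ^ 3)"
    using i3 m by (intro integral_mono integrable_min integrable_mult_right) auto
  also have "\<dots> = \<bar>\<theta>\<bar> * expectation (\<lambda>\<omega>. \<bar>x 1 \<omega>\<bar> ^ 3)" by simp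
  finally have "cmod (\<phi> \<theta> - (1 - of_real (\<theta>\<^sup>2) * 1 / 2)) \<le> (\<theta>\<^sup>2 / 6) * (\<bar>\<theta>\<bar> * expectation (\<lambda>\<omega>. \<bar>x 1 \<omega>\<bar> ^ 3))"
    by (simp add: mult_left_mono)
  also have "\<dots> = \<bar>\<theta>\<bar> ^ 3 * expectation (\<lambda>\<omega>. \<bar>x 1 \<omega>\<bar> ^ 3) / 6"
    by (simp add: power3_eq_cube power2_eq_square abs_mult_self_eq)
  finally show ?thesis by simp
qed

text \<open>Both numbers agree with 1 - \<theta>^2 / (2 * b n) up to o (1 / b n). The exponential is
  preferred because it is real and lies in [0, 1], where the generating function of R is
  known.\<close>

lemma \<phi>_near_gaussian:
  "(\<lambda>n. b n * norm (\<phi> (\<theta> / sqrt (b n)) - of_real (exp (- (\<theta>\<^sup>2 / 2) / b n)))) \<longlonglongrightarrow> 0"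
proof -
  define C where "C = \<bar>\<theta>\<bar> ^ 3 * expectation (\<lambda>\<omega>. \<bar>x 1 \<omega>\<bar> ^ 3) / 6"
  define c where "c = \<theta>\<^sup>2 / 2"
  have "((\<lambda>y::real. C / sqrt y + y * (exp (- c / y) - (1 - c / y))) \<longlongrightarrow> 0) at_top" by real_asymp
  then have "(\<lambda>n. C / sqrt (b n) + b n * (exp (- c / b n) - (1 - c / b n))) \<longlonglongrightarrow> 0"
    by (rule filterlim_compose[OF _ b_at_top])
  then show ?thesis
  proof (rule Lim_null_comparison[rotated])
    show "\<forall>\<^sub>F n in sequentially. norm (b n * norm (\<phi> (\<theta> / sqrt (b n)) - of_real (exp (- (\<theta>\<^sup>2 / 2) / b n))))
        \<le> C / sqrt (b n) + b n * (exp (- c / b n) - (1 - c / b n))"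
      using eventually_ge_at_top[of 1]
    proof eventually_elim
      case (elim n)
      then have bp: "b n > 0" by (rule b_pos)
      let ?t = "\<theta> / sqrt (b n)"
      have t2: "?t\<^sup>2 / 2 = c / b n" using bp by (simp add: power_divide c_def)
      have "\<phi> ?t - of_real (exp (- c / b n)) = (\<phi> ?t - of_real (1 - ?t\<^sup>2 / 2)) + of_real (1 - c / b n - exp (- c / b n))"
        unfolding t2 by simp
      then have "norm (\<phi> ?t - of_real (exp (- c / b n))) \<le> norm (\<phi> ?t - of_real (1 - ?t\<^sup>2 / 2)) + norm (of_real (1 - c / b n - exp (- c / b n)) :: complex)"
        using norm_triangle_ineq by metis
      also have "norm (of_real (1 - c / b n - exp (- c / b n)) :: complex) = exp (- c / b n) - (1 - c / b n)"
        using exp_ge_add_one_self[of "- c / b n"] unfolding norm_of_real by simp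
      also have "norm (\<phi> ?t - of_real (1 - ?t\<^sup>2 / 2)) \<le> \<bar>?t\<bar> ^ 3 * expectation (\<lambda>\<omega>. \<bar>x 1 \<omega>\<bar> ^ 3) / 6"
        by (rule \<phi>_expansion)
      also have "\<dots> = C / (b n * sqrt (b n))"
        using bp by (simp add: C_def power_divide power3_eq_cube)
      finally have "b n * norm (\<phi> ?t - of_real (exp (- c / b n))) \<le> b n * (C / (b n * sqrt (b n)) + (exp (- c / b n) - (1 - c / b n)))"
        using bp by (intro mult_left_mono) auto
      also have "\<dots> = C / sqrt (b n) + b n * (exp (- c / b n) - (1 - c / b n))"
        using bp by (simp add: distrib_left)
      finally show ?case using bp by (simp add: c_def)
    qed
  qed
qed

text \<open>At the real number w n the generating function and regular variation give the limit.
  Replacing z n by w n costs, for a given k = R 1, at most a multiple of min 1 (k * d / b n) with d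
  as small as desired, which is bounded by 4 * (1 - exp (- d / b n) ^ k). After averaging and
  multiplying by n this is close to 4 * d powr \<beta>.\<close>

lemma expectation_power_R_tendsto:
  "(\<lambda>n. of_nat n * (1 - expectation (\<lambda>\<omega>. \<phi> (\<theta> / sqrt (b n)) ^ R 1 \<omega>))) \<longlonglongrightarrow> of_real ((\<theta>\<^sup>2 / 2) powr \<beta>)"
proof (cases "\<theta> = 0")
  case True
  have "\<phi> 0 = 1" unfolding \<phi>_def using prob_space.prob_space[OF prob_space_distr[OF x_rv[of 1]]] by (simp add: char_def)
  then show ?thesis using True \<beta> by (simp add: prob_space)
next
  case False
  define c where "c = \<theta>\<^sup>2 / 2"
  have c: "c > 0" using False by (simp add: c_def)
  define z where "z = (\<lambda>n. \<phi> (\<theta> / sqrt (b n)))"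
  define w where "w = (\<lambda>n. exp (- c / b n))"
  let ?w = "\<lambda>n. expectation (\<lambda>\<omega>. of_real (w n) ^ R 1 \<omega> :: complex)" and ?z = "\<lambda>n. expectation (\<lambda>\<omega>. z n ^ R 1 \<omega>)"
  have R1: "random_variable (count_space UNIV) (R 1)" by (rule R_rv) simp
  have z1: "norm (z n) \<le> 1" for n unfolding z_def by (rule norm_\<phi>_le_1)
  have w01: "0 \<le> w n" "w n \<le> 1" if "n \<ge> 1" for n unfolding w_def using c b_pos[OF that] by auto
  have iz: "integrable M (\<lambda>\<omega>. z n ^ R 1 \<omega>)" for n
    using z1 by (intro integrable_const_bound[of _ 1] measurable_compose[OF R1]) (auto simp: norm_power power_le_one)
  have iw: "integrable M (\<lambda>\<omega>. of_real (w n) ^ R 1 \<omega> :: complex)" if "n \<ge> 1" for n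
    using w01[OF that] by (intro integrable_const_bound[of _ 1] measurable_compose[OF R1]) (auto simp: norm_power power_le_one)
  have "(\<lambda>n. of_nat n * (?w n - ?z n) :: complex) \<longlonglongrightarrow> 0"
  proof (rule tendstoI)
    fix e :: real assume e: "e > 0"
    \<comment> \<open>Chosen so that the limit 4 * d powr \<beta> below equals e / 2.\<close>
    define d where "d = (e / 8) powr (1 / \<beta>)"
    have d: "d > 0" using e by (simp add: d_def)
    have db: "d powr \<beta> = e / 8" using e \<beta> by (simp add: d_def powr_powr)
    have lim: "(\<lambda>n. 4 * (real n * \<psi> (1 - exp (- d / b n)))) \<longlonglongrightarrow> 4 * d powr \<beta>"
      by (intro tendsto_intros scaled_\<psi>_exp_tendsto d)
    have "\<forall>\<^sub>F n in sequentially. 4 * (real n * \<psi> (1 - exp (- d / b n))) < e"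
      by (rule order_tendstoD(2)[OF lim]) (use e in \<open>simp add: db\<close>)
    moreover have "\<forall>\<^sub>F n in sequentially. b n * norm (z n - of_real (w n)) < d"
      using order_tendstoD(2)[OF \<phi>_near_gaussian d] unfolding z_def w_def c_def by simp
    ultimately show "\<forall>\<^sub>F n in sequentially. dist (of_nat n * (?w n - ?z n) :: complex) 0 < e"
      using eventually_ge_at_top[of 1]
    proof eventually_elim
      case (elim n)
      have bp: "b n > 0" using elim(3) by (rule b_pos)
      let ?q = "exp (- d / b n)"
      have q: "0 \<le> ?q" "?q \<le> 1" using d bp by auto
      have iq: "integrable M (\<lambda>\<omega>. ?q ^ R 1 \<omega>)"
        using q by (intro integrable_const_bound[of _ 1] measurable_compose[OF R1]) (auto simp: power_le_one)
      have zw: "norm (of_real (w n) ^ k - z n ^ k) \<le> 4 * (1 - ?q ^ k)" for k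
      proof -
        have nw: "norm (of_real (w n) :: complex) \<le> 1" using w01[OF elim(3)] by simp
        have "norm (of_real (w n) ^ k - z n ^ k) \<le> real k * norm (of_real (w n) - z n)"
          by (rule norm_power_diff[OF nw z1])
        also have "\<dots> \<le> real k * (d / b n)"
          using elim(2) bp by (intro mult_left_mono) (auto simp: field_simps norm_minus_commute)
        \<comment> \<open>The factor 2 is inserted to match the trivial bound 2 that follows, so
          that the two combine to 2 * min 1 (k * (d / b n)).\<close>
        finally have "norm (of_real (w n) ^ k - z n ^ k) \<le> 2 * (real k * (d / b n))"
          using d bp by (smt (verit) divide_nonneg_nonneg mult_nonneg_nonneg of_nat_0_le_iff)
        moreover have "norm (of_real (w n) ^ k - z n ^ k) \<le> 2"
        proof -
          have "norm (of_real (w n) ^ k - z n ^ k) \<le> norm (of_real (w n) ^ k :: complex) + norm (z n ^ k)"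
            by (rule norm_triangle_ineq4)
          also have "\<dots> \<le> 1 + 1" using nw z1[of n] unfolding norm_power by (intro add_mono power_le_one) auto
          finally show ?thesis by simp
        qed
        ultimately have "norm (of_real (w n) ^ k - z n ^ k) \<le> 2 * min 1 (real k * (d / b n))" by simp
        also have "\<dots> \<le> 2 * (2 * (1 - exp (- (real k * (d / b n)))))"
          using d bp by (intro mult_left_mono min_one_le_exp) auto
        also have "exp (- (real k * (d / b n))) = ?q ^ k" by (simp add: exp_of_nat_mult[symmetric])
        finally show ?thesis by simp
      qed
      have "norm (?w n - ?z n)
          = norm (expectation (\<lambda>\<omega>. of_real (w n) ^ R 1 \<omega> - z n ^ R 1 \<omega>))"
        using iz iw[OF elim(3)] by simp
      also have "\<dots> \<le> expectation (\<lambda>\<omega>. norm (of_real (w n) ^ R 1 \<omega> - z n ^ R 1 \<omega>))"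
        by (rule integral_norm_bound)
      also have "\<dots> \<le> expectation (\<lambda>\<omega>. 4 * (1 - ?q ^ R 1 \<omega>))"
        using zw iz iw[OF elim(3)] iq by (intro integral_mono integrable_norm Bochner_Integration.integrable_diff integrable_mult_right) auto
      also have "\<dots> = 4 * (1 - expectation (\<lambda>\<omega>. ?q ^ R 1 \<omega>))" using iq by (simp add: prob_space)
      also have "\<dots> = 4 * \<psi> (1 - ?q)" unfolding R_gf[OF order_refl q] by simp
      finally have "real n * norm (?w n - ?z n) \<le> real n * (4 * \<psi> (1 - ?q))"
        by (intro mult_left_mono) auto
      then show ?case using elim(1) by (simp add: norm_mult)
    qed
  qed
  moreover have "(\<lambda>n. of_nat n * (1 - ?w n) :: complex) \<longlonglongrightarrow> of_real (c powr \<beta>)"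
  proof -
    have "(\<lambda>n. of_real (real n * \<psi> (1 - w n)) :: complex) \<longlonglongrightarrow> of_real (c powr \<beta>)"
      unfolding w_def by (intro tendsto_of_real scaled_\<psi>_exp_tendsto c)
    moreover have "\<forall>\<^sub>F n in sequentially. of_real (real n * \<psi> (1 - w n)) = (of_nat n * (1 - ?w n) :: complex)"
      using eventually_ge_at_top[of 1]
    proof eventually_elim
      case (elim n)
      have "expectation (\<lambda>\<omega>. of_real (w n) ^ R 1 \<omega> :: complex) = expectation (\<lambda>\<omega>. of_real (w n ^ R 1 \<omega>))" by simp
      also have "\<dots> = of_real (expectation (\<lambda>\<omega>. w n ^ R 1 \<omega>))"
        using w01[OF elim] by (intro integral_of_real integrable_const_bound[of _ 1] measurable_compose[OF R1]) (auto simp: power_le_one)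
      also have "\<dots> = of_real (1 - \<psi> (1 - w n))" unfolding R_gf[OF order_refl w01[OF elim]] ..
      finally show ?case by simp
    qed
    ultimately show ?thesis by (rule Lim_transform_eventually)
  qed
  ultimately have "(\<lambda>n. of_nat n * (?w n - ?z n)
      + of_nat n * (1 - ?w n) :: complex) \<longlonglongrightarrow> 0 + of_real (c powr \<beta>)"
    by (rule tendsto_add)
  then show ?thesis unfolding z_def c_def by (simp add: algebra_simps)
qed

section \<open>Rescaled paths and their increments over grid cells\<close>

definition walk :: "nat \<Rightarrow> nat \<Rightarrow> 'a \<Rightarrow> real" where
  "walk n r \<omega> = b n powr (- 1 / 2) * (\<Sum>k\<in>{0<..r}. Z k \<omega>)"

text \<open>The integer part [n * t] is \<open>grid_index n t\<close>, so for n > 0 the path is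
  itself a step path, of mesh 1 / n. Two meshes coexist from here on: 1 / n of the walk and the
  coarser, fixed 1 / m of the approximation.\<close>

definition walk_path :: "nat \<Rightarrow> 'a \<Rightarrow> real \<Rightarrow> real" where
  "walk_path n \<omega> = (\<lambda>t\<in>{0..}. walk n (grid_index n t) \<omega>)"

lemma walk_rv [measurable]: "random_variable borel (walk n r)"
  unfolding walk_def by (intro borel_measurable_times borel_measurable_const borel_measurable_sum Z_rv)

lemma walk_diff: "i \<le> j \<Longrightarrow> walk n j \<omega> - walk n i \<omega> = (\<Sum>k\<in>{i<..j}. b n powr (- 1 / 2) * Z k \<omega>)"
proof -
  assume "i \<le> j"
  then have "{0<..j} = {0<..i} \<union> {i<..j}" by auto
  then have "(\<Sum>k\<in>{0<..j}. Z k \<omega>) = (\<Sum>k\<in>{0<..i}. Z k \<omega>) + (\<Sum>k\<in>{i<..j}. Z k \<omega>)"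
    by (simp add: sum.union_disjoint)
  then show ?thesis unfolding walk_def sum_distrib_left[symmetric] by (simp add: algebra_simps)
qed

lemma scaled_Z_indep: "indep_vars (\<lambda>_. borel) (\<lambda>k \<omega>. b n powr (- 1 / 2) * Z k \<omega>) {1..}"
  by (rule indep_vars_compose2[OF Z_indep]) auto

lemma walk_path_in_skorohod: "walk_path n \<omega> \<in> skorohod_space"
proof (cases "n = 0")
  case True
  \<comment> \<open>For n = 0 the integer part is constantly 0 and the path is constant, hence a
    step path of any mesh.\<close>
  then have "walk_path n \<omega> = step_path 1 (\<lambda>_. walk n 0 \<omega>)"
    by (auto simp: walk_path_def step_path_def grid_index_def fun_eq_iff)
  then show ?thesis by simp
next
  case False
  have "walk_path n \<omega> = step_path n (\<lambda>r. walk n r \<omega>)" by (simp add: walk_path_def step_path_def)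
  then show ?thesis using False by simp
qed

lemma walk_path_measurable: "t \<ge> 0 \<Longrightarrow> random_variable borel (\<lambda>\<omega>. walk_path n \<omega> t)"
  by (simp add: walk_path_def)

definition grid_time :: "nat \<Rightarrow> nat \<Rightarrow> nat \<Rightarrow> nat" where
  "grid_time n m i = grid_index n (real i / real m)"

lemma grid_time_mono: "mono (grid_time n m)"
  unfolding grid_time_def mono_def by (intro allI impI grid_index_mono divide_right_mono) auto

lemma walk_path_grid: "walk_path n \<omega> (real i / real m) = walk n (grid_time n m i) \<omega>"
  by (simp add: walk_path_def grid_time_def)

abbreviation walk_increment :: "nat \<Rightarrow> nat \<Rightarrow> nat \<Rightarrow> 'a \<Rightarrow> real" where
  "walk_increment n m i \<omega> \<equiv> walk_path n \<omega> (real (Suc i) / real m) - walk_path n \<omega> (real i / real m)"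

lemma walk_increments_indep:
  "indep_vars (\<lambda>_. borel) (walk_increment n m) UNIV"
proof -
  have "walk_increment n m i \<omega>
      = (\<Sum>k\<in>{grid_time n m i<..grid_time n m (Suc i)}. b n powr (- 1 / 2) * Z k \<omega>)" for i \<omega>
    unfolding walk_path_grid by (rule walk_diff) (simp add: grid_time_mono monoD)
  then show ?thesis using indep_vars_block_sums[OF scaled_Z_indep grid_time_mono, of n n m] by simp
qed

lemma grid_time_increment_tendsto:
  assumes m: "m > 0"
  shows "(\<lambda>n. real (grid_time n m (Suc i) - grid_time n m i) / real n) \<longlonglongrightarrow> 1 / real m"
proof -
  have "(\<lambda>n. real (grid_time n m i) / real n) \<longlonglongrightarrow> real i / real m" for i
  proof -
    have lim: "(\<lambda>n. real_of_int \<lfloor>real n * t\<rfloor> / real n) \<longlonglongrightarrow> t" for t :: real by real_asymp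
    have eq: "real (grid_time n m i) = real_of_int \<lfloor>real n * (real i / real m)\<rfloor>" for n
      unfolding grid_time_def grid_index_def by (simp add: of_nat_nat)
    show ?thesis unfolding eq by (rule lim)
  qed
  from tendsto_diff[OF this[of "Suc i"] this[of i]]
  have "(\<lambda>n. real (grid_time n m (Suc i)) / real n - real (grid_time n m i) / real n) \<longlonglongrightarrow> 1 / real m"
    using m by (simp add: add_divide_distrib diff_divide_distrib[symmetric])
  moreover have "real (grid_time n m (Suc i) - grid_time n m i) / real n = real (grid_time n m (Suc i)) / real n - real (grid_time n m i) / real n" for n
    using monoD[OF grid_time_mono, of i "Suc i" n m] by (simp add: of_nat_diff diff_divide_distrib)
  ultimately show ?thesis by simp
qed

text \<open>A cell holds about n / m steps, all with the same characteristic function z n at the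
  rescaled argument, and n * (1 - z n) tends to (\<theta>^2 / 2) powr \<beta>.\<close>

lemma walk_increments_char_tendsto:
  assumes m: "m > 0"
  shows "(\<lambda>n. char (distr M borel (walk_increment n m i)) \<theta>)
    \<longlonglongrightarrow> of_real (exp (- (1 / real m * (\<theta>\<^sup>2 / 2) powr \<beta>)))"
proof -
  define z where "z = (\<lambda>n. expectation (\<lambda>\<omega>. \<phi> (\<theta> / sqrt (b n)) ^ R 1 \<omega>))"
  have R1: "random_variable (count_space UNIV) (R 1)" by (rule R_rv) simp
  have z1: "norm (z n) \<le> 1" for n
  proof -
    have "norm (z n) \<le> expectation (\<lambda>\<omega>. norm (\<phi> (\<theta> / sqrt (b n)) ^ R 1 \<omega>))"
      unfolding z_def by (rule integral_norm_bound)
    also have "\<dots> \<le> expectation (\<lambda>_. 1)"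
      using norm_\<phi>_le_1 by (intro integral_mono integrable_const_bound[of _ 1] measurable_compose[OF R1])
        (auto simp: norm_power power_le_one)
    finally show ?thesis by (simp add: prob_space)
  qed
  have char1: "char (distr M borel (\<lambda>\<omega>. b n powr (- 1 / 2) * Z k \<omega>)) \<theta> = z n" if k: "k \<ge> 1" and n: "n \<ge> 1" for k n
  proof -
    have sq: "\<theta> * (b n powr (- 1 / 2)) = \<theta> / sqrt (b n)"
      using powr_minus_half[OF b_pos[OF n]] by simp
    have "char (distr M borel (\<lambda>\<omega>. b n powr (- 1 / 2) * Z k \<omega>)) \<theta> = expectation (\<lambda>\<omega>. iexp (\<theta> * (b n powr (- 1 / 2) * Z k \<omega>)))"
      unfolding char_def using Z_rv by (subst integral_distr) auto
    also have "\<dots> = expectation (\<lambda>\<omega>. iexp (\<theta> / sqrt (b n) * Z k \<omega>))"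
      by (simp only: mult.assoc[symmetric] sq)
    also have "\<dots> = char (distr M borel (Z k)) (\<theta> / sqrt (b n))"
      unfolding char_def using Z_rv by (subst integral_distr) auto
    also have "\<dots> = expectation (\<lambda>\<omega>. \<phi> (\<theta> / sqrt (b n)) ^ R k \<omega>)" by (rule char_Z[OF k])
    also have "\<dots> = z n"
      unfolding z_def by (rule expectation_R[OF k])
    finally show ?thesis .
  qed
  have eq: "char (distr M borel (walk_increment n m i)) \<theta>
      = z n ^ (grid_time n m (Suc i) - grid_time n m i)" if n: "n \<ge> 1" for n
  proof -
    have "walk_increment n m i \<omega>
        = (\<Sum>k\<in>{grid_time n m i<..grid_time n m (Suc i)}. b n powr (- 1 / 2) * Z k \<omega>)" for \<omega>
      unfolding walk_path_grid by (rule walk_diff) (simp add: grid_time_mono monoD)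
    then have "char (distr M borel (walk_increment n m i)) \<theta>
        = (\<Prod>k\<in>{grid_time n m i<..grid_time n m (Suc i)}. char (distr M borel (\<lambda>\<omega>. b n powr (- 1 / 2) * Z k \<omega>)) \<theta>)"
      by (simp only:) (rule char_distr_sum[OF indep_vars_subset[OF scaled_Z_indep]], auto)
    also have "\<dots> = (\<Prod>k\<in>{grid_time n m i<..grid_time n m (Suc i)}. z n)"
      by (intro prod.cong refl char1 n) auto
    finally show ?thesis by simp
  qed
  have ev: "\<forall>\<^sub>F n in sequentially. z n ^ (grid_time n m (Suc i) - grid_time n m i) =
      char (distr M borel (walk_increment n m i)) \<theta>"
    using eventually_ge_at_top[of 1] by (rule eventually_mono) (rule eq[symmetric])
  have "(\<lambda>n. z n ^ (grid_time n m (Suc i) - grid_time n m i)) \<longlonglongrightarrow> of_real (exp (- (1 / real m * (\<theta>\<^sup>2 / 2) powr \<beta>)))"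
    by (rule complex_power_tendsto_exp[OF _ z1 grid_time_increment_tendsto[OF m]])
      (use expectation_power_R_tendsto in \<open>auto simp: z_def\<close>)
  then show ?thesis using ev by (rule Lim_transform_eventually)
qed

text \<open>The break point of a cell is u = r / n with r the first crossing of level e, or the
  right end if there is none. Before u the path is within e of its value at the left end. From u on,
  both the current value and the value at the right end are within e / 2 of the value at r. This is
  why \<open>two_fluctuations\<close> is later used with c = e / 4.\<close>

lemma walk_path_one_jump_cells:
  assumes m: "m > 0" and n: "n > 0" and e: "e > 0"
    and small: "\<And>j r s. j < K \<Longrightarrow> r \<in> {grid_time n m j..grid_time n m (Suc j)} \<Longrightarrow>
      first_crossing (\<lambda>k \<omega>. b n powr (- 1 / 2) * Z k \<omega>) (grid_time n m j) e r \<omega> \<Longrightarrow>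
      s \<in> {r..grid_time n m (Suc j)} \<Longrightarrow> \<bar>\<Sum>k\<in>{r<..s}. b n powr (- 1 / 2) * Z k \<omega>\<bar> < e / 2"
  shows "one_jump_cells m K e (walk_path n \<omega>)"
  unfolding one_jump_cells_def
proof (intro allI impI)
  fix j assume j: "j < K"
  let ?a = "grid_time n m j" and ?b = "grid_time n m (Suc j)"
  let ?l = "real j / real m" and ?r = "real (Suc j) / real m"
  let ?Z = "\<lambda>k \<omega>. b n powr (- 1 / 2) * Z k \<omega>"
  have lr: "0 \<le> ?l" "?l < ?r" using m by (auto simp: divide_strict_right_mono)
  have ab: "?a \<le> ?b" using grid_time_mono by (simp add: monoD)
  have path: "walk_path n \<omega> s = walk n (grid_index n s) \<omega>" if "s \<ge> ?l" for s
    using order_trans[OF lr(1) that] by (simp add: walk_path_def)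
  have idx: "grid_index n s \<in> {?a..?b}" if "?l \<le> s" "s \<le> ?r" for s
    using that by (auto simp: grid_time_def intro: grid_index_mono)
  show "\<exists>u>?l. u \<le> ?r \<and> (\<forall>s\<in>{?l..<u}. \<bar>walk_path n \<omega> s - walk_path n \<omega> ?l\<bar> < e) \<and>
      (\<forall>s\<in>{u..?r}. \<bar>walk_path n \<omega> s - walk_path n \<omega> ?r\<bar> < e)"
  proof (cases "\<exists>r\<in>{?a..?b}. first_crossing ?Z ?a e r \<omega>")
    case False
    have "\<bar>walk_path n \<omega> s - walk_path n \<omega> ?l\<bar> < e" if s: "s \<in> {?l..<?r}" for s
    proof -
      have "grid_index n s \<in> {?a..?b}" using s by (intro idx) auto
      then have "\<bar>\<Sum>k\<in>{?a<..grid_index n s}. ?Z k \<omega>\<bar> < e"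
        using False first_crossing_exists[of "grid_index n s" ?a ?b e ?Z \<omega>] by (meson not_le)
      then show ?thesis
        using s path[of s] walk_diff[of ?a "grid_index n s" n \<omega>] idx[of s] by (auto simp: walk_path_grid)
    qed
    moreover have "\<bar>walk_path n \<omega> s - walk_path n \<omega> ?r\<bar> < e" if "s \<in> {?r..?r}" for s using that e by simp
    ultimately show ?thesis using lr by blast
  next
    case True
    then obtain r where r: "r \<in> {?a..?b}" and fc: "first_crossing ?Z ?a e r \<omega>" by blast
    \<comment> \<open>The empty sum does not reach e > 0. So r is at least ?a + 1, which puts u
      strictly to the right of the left end of the cell.\<close>
    have "r \<noteq> ?a" using fc e unfolding first_crossing_def by auto
    then have ra: "?a < r" using r by auto
    define u where "u = real r / real n"
    have "?l < u"
    proof -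
      have "real n * ?l < real ?a + 1"
        unfolding grid_time_def using grid_index_bounds(2)[OF n lr(1)] n by (simp add: field_simps)
      also have "\<dots> \<le> real r" using ra by simp
      finally show ?thesis unfolding u_def using n by (simp add: field_simps)
    qed
    moreover have "u \<le> ?r"
    proof -
      have "real r \<le> real ?b" using r by simp
      also have "\<dots> \<le> real n * ?r"
        unfolding grid_time_def using grid_index_bounds(1)[OF n, of ?r] n lr by (simp add: field_simps)
      finally show ?thesis unfolding u_def using n by (simp add: field_simps)
    qed
    moreover have "\<bar>walk_path n \<omega> s - walk_path n \<omega> ?l\<bar> < e" if s: "s \<in> {?l..<u}" for s
    proof -
      have s0: "s \<ge> 0" using s by (intro order_trans[OF lr(1)]) auto
      have "real (grid_index n s) / real n < real r / real n"
        using grid_index_bounds(1)[OF n s0] s unfolding u_def by simp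
      then have "grid_index n s < r" using n by (simp add: divide_less_cancel)
      moreover have "?a \<le> grid_index n s" using idx[of s] s \<open>u \<le> ?r\<close> by auto
      ultimately have "\<bar>\<Sum>k\<in>{?a<..grid_index n s}. ?Z k \<omega>\<bar> < e"
        using fc unfolding first_crossing_def by auto
      then show ?thesis
        using s path[of s] walk_diff[of ?a "grid_index n s" n \<omega>] \<open>?a \<le> grid_index n s\<close> by (auto simp: walk_path_grid)
    qed
    moreover have "\<bar>walk_path n \<omega> s - walk_path n \<omega> ?r\<bar> < e" if s: "s \<in> {u..?r}" for s
    proof -
      have s0: "s \<ge> ?l" using s \<open>?l < u\<close> by auto
      then have s1: "s \<ge> 0" by (rule order_trans[OF lr(1)])
      have "real r / real n < real (Suc (grid_index n s)) / real n"
        using grid_index_bounds(2)[OF n s1] s unfolding u_def by simp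
      then have "r \<le> grid_index n s" using n by (simp add: divide_less_cancel)
      moreover have "grid_index n s \<le> ?b" using idx[of s] s0 s by auto
      ultimately have gs: "grid_index n s \<in> {r..?b}" by simp
      have "\<bar>walk n (grid_index n s) \<omega> - walk n r \<omega>\<bar> < e / 2"
        using small[OF j r fc gs] walk_diff[of r "grid_index n s" n \<omega>] gs by simp
      moreover have "\<bar>walk n ?b \<omega> - walk n r \<omega>\<bar> < e / 2"
        using small[OF j r fc, of ?b] walk_diff[of r ?b n \<omega>] r by simp
      ultimately show ?thesis using path[OF s0] unfolding walk_path_grid by linarith
    qed
    ultimately show ?thesis by blast
  qed
qed

lemma walk_path_jumps:
  assumes e: "e > 0" and d: "d > 0"
  shows "\<forall>\<^sub>F m in sequentially. \<forall>\<^sub>F n in sequentially.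
      \<exists>F\<in>events. prob F < d \<and> (\<forall>\<omega>\<in>space M - F. one_jump_cells m (m * K) e (walk_path n \<omega>))"
proof -
  \<comment> \<open>The level e / 4 for the rescaled walk is e / 4 * sqrt (b n) for the unscaled
    one, and \<open>Z_tail\<close> involves the inverse of its square, \<kappa> / b n.\<close>
  define \<kappa> where "\<kappa> = 16 / e\<^sup>2"
  have \<kappa>: "\<kappa> > 0" using e by (simp add: \<kappa>_def)
  define C where "C = \<kappa> powr \<beta>"
  \<comment> \<open>The bound of \<open>Z_tail\<close> for any final piece of a cell. A cell
    contains at most n / m + 1 steps, the 1 coming from the integer parts at its two ends.\<close>
  define q where "q = (\<lambda>m n. 2 * ((real n / real m + 1) * \<psi> (1 - exp (- \<kappa> / b n))))"
  have q_lim: "(\<lambda>n. q m n) \<longlonglongrightarrow> 2 * (1 / real m * C)" for m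
  proof -
    have "(\<lambda>n. 2 * ((1 / real m + 1 / real n) * (real n * \<psi> (1 - exp (- \<kappa> / b n))))) \<longlonglongrightarrow> 2 * ((1 / real m + 0) * C)"
      unfolding C_def by (intro tendsto_intros scaled_\<psi>_exp_tendsto \<kappa> lim_1_over_n)
    moreover have "\<forall>\<^sub>F n in sequentially. 2 * ((1 / real m + 1 / real n) * (real n * \<psi> (1 - exp (- \<kappa> / b n)))) = q m n"
      using eventually_gt_at_top[of 0] by eventually_elim (simp add: q_def algebra_simps)
    ultimately show ?thesis by (simp add: tendsto_cong)
  qed
  have "(\<lambda>m. 2 * (1 / real m * C)) \<longlonglongrightarrow> 0" by real_asymp
  then have e1: "\<forall>\<^sub>F m in sequentially. 2 * (1 / real m * C) < 1 / 2" by (rule order_tendstoD) simp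
  \<comment> \<open>For large n each of the m * K cells fails with probability about (4 * C / m)^2
    at most; the total is of order 1 / m.\<close>
  have "(\<lambda>m. 16 * real K * C\<^sup>2 * (1 / real m)) \<longlonglongrightarrow> 16 * real K * C\<^sup>2 * 0"
    by (intro tendsto_intros lim_1_over_n)
  moreover have "\<forall>\<^sub>F m in sequentially. 16 * real K * C\<^sup>2 * (1 / real m) = real (m * K) * (2 * (2 * (1 / real m * C)))\<^sup>2"
    using eventually_gt_at_top[of 0] by eventually_elim (simp add: power2_eq_square field_simps)
  ultimately have "(\<lambda>m. real (m * K) * (2 * (2 * (1 / real m * C)))\<^sup>2) \<longlonglongrightarrow> 0"
    by (simp add: tendsto_cong)
  then have e2: "\<forall>\<^sub>F m in sequentially. real (m * K) * (2 * (2 * (1 / real m * C)))\<^sup>2 < d" using d by (rule order_tendstoD)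
  show ?thesis
    using e1 e2 eventually_gt_at_top[of 0]
  proof eventually_elim
    case (elim m)
    have m: "m > 0" by (rule elim(3))
    have "(\<lambda>n. real (m * K) * (2 * q m n)\<^sup>2) \<longlonglongrightarrow> real (m * K) * (2 * (2 * (1 / real m * C)))\<^sup>2"
      by (intro tendsto_intros q_lim)
    then have "\<forall>\<^sub>F n in sequentially. real (m * K) * (2 * q m n)\<^sup>2 < d" using elim(2) by (rule order_tendstoD)
    then show ?case
      using order_tendstoD(2)[OF q_lim elim(1)] eventually_gt_at_top[of 0]
    proof eventually_elim
      case (elim n)
      have n: "n > 0" "n \<ge> 1" using elim(3) by auto
      have bp: "b n > 0" by (rule b_pos[OF n(2)])
      let ?Z = "\<lambda>k \<omega>. b n powr (- 1 / 2) * Z k \<omega>"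
      have sq: "b n powr (- 1 / 2) = 1 / sqrt (b n)"
        by (rule powr_minus_half[OF bp])
      have len: "real (grid_time n m (Suc j) - grid_time n m j) \<le> real n / real m + 1" for j
      proof -
        have "real (grid_time n m (Suc j)) \<le> real n * (real (Suc j) / real m)"
          unfolding grid_time_def using grid_index_bounds(1)[OF n(1), of "real (Suc j) / real m"] n by (simp add: field_simps)
        moreover have "real n * (real j / real m) < real (grid_time n m j) + 1"
          unfolding grid_time_def using grid_index_bounds(2)[OF n(1), of "real j / real m"] n by (simp add: field_simps)
        moreover have "real n * (real (Suc j) / real m) = real n * (real j / real m) + real n / real m"
          by (simp add: field_simps add_divide_distrib)
        ultimately show ?thesis using monoD[OF grid_time_mono, of j "Suc j" n m] by (simp add: of_nat_diff)
      qed
      have tail: "prob {\<omega> \<in> space M. e / 4 \<le> \<bar>\<Sum>k\<in>{i<..grid_time n m (Suc j)}. ?Z k \<omega>\<bar>} \<le> q m n"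
        if i: "grid_time n m j \<le> i" "i \<le> grid_time n m (Suc j)" for i j
      proof -
        have a: "e / 4 * sqrt (b n) > 0" using e bp by simp
        have "{\<omega> \<in> space M. e / 4 \<le> \<bar>\<Sum>k\<in>{i<..grid_time n m (Suc j)}. ?Z k \<omega>\<bar>}
            = {\<omega> \<in> space M. e / 4 * sqrt (b n) \<le> \<bar>\<Sum>k\<in>{i<..grid_time n m (Suc j)}. Z k \<omega>\<bar>}"
          unfolding sum_distrib_left[symmetric] sq using bp by (auto simp: abs_mult field_simps)
        then have "prob {\<omega> \<in> space M. e / 4 \<le> \<bar>\<Sum>k\<in>{i<..grid_time n m (Suc j)}. ?Z k \<omega>\<bar>}
            \<le> 2 * (real (grid_time n m (Suc j) - i) * \<psi> (1 - exp (- 1 / (e / 4 * sqrt (b n))\<^sup>2)))"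
          using Z_tail[OF a i(2)] by simp
        also have "- 1 / (e / 4 * sqrt (b n))\<^sup>2 = - \<kappa> / b n"
          using bp e by (simp add: \<kappa>_def power_mult_distrib power_divide field_simps)
        also have "2 * (real (grid_time n m (Suc j) - i) * \<psi> (1 - exp (- \<kappa> / b n))) \<le> q m n"
        proof -
          have "real (grid_time n m (Suc j) - i) \<le> real (grid_time n m (Suc j) - grid_time n m j)" using i by simp
          also have "\<dots> \<le> real n / real m + 1" by (rule len)
          finally show ?thesis unfolding q_def
            using \<kappa> bp by (intro mult_left_mono mult_right_mono \<psi>_nonneg) auto
        qed
        finally show ?thesis .
      qed
      have "\<exists>F\<in>events. prob F \<le> (2 * q m n)\<^sup>2 \<and>
          (\<forall>\<omega>\<in>space M - F. \<forall>r\<in>{grid_time n m j..grid_time n m (Suc j)}. first_crossing ?Z (grid_time n m j) (4 * (e / 4)) r \<omega> \<longrightarrow>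
            (\<forall>s\<in>{r..grid_time n m (Suc j)}. \<bar>\<Sum>k\<in>{r<..s}. ?Z k \<omega>\<bar> < 2 * (e / 4)))" for j
        using elim(2) e by (intro two_fluctuations scaled_Z_indep tail monoD[OF grid_time_mono]) auto
      then obtain F where F: "\<And>j. F j \<in> events" "\<And>j. prob (F j) \<le> (2 * q m n)\<^sup>2"
        "\<And>j \<omega> r s. \<omega> \<in> space M - F j \<Longrightarrow> r \<in> {grid_time n m j..grid_time n m (Suc j)} \<Longrightarrow>
          first_crossing ?Z (grid_time n m j) (4 * (e / 4)) r \<omega> \<Longrightarrow>
          s \<in> {r..grid_time n m (Suc j)} \<Longrightarrow> \<bar>\<Sum>k\<in>{r<..s}. ?Z k \<omega>\<bar> < 2 * (e / 4)"
        by metis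
      show ?case
      proof (intro bexI conjI ballI)
        show "(\<Union>j\<in>{..<m * K}. F j) \<in> events" using F(1) by auto
        have "prob (\<Union>j\<in>{..<m * K}. F j) \<le> (\<Sum>j\<in>{..<m * K}. prob (F j))"
          using F(1) by (intro finite_measure_subadditive_finite) auto
        also have "\<dots> \<le> (\<Sum>j\<in>{..<m * K}. (2 * q m n)\<^sup>2)" by (intro sum_mono F(2))
        finally show "prob (\<Union>j\<in>{..<m * K}. F j) < d" using elim(1) by simp
        fix \<omega> assume \<omega>: "\<omega> \<in> space M - (\<Union>j\<in>{..<m * K}. F j)"
        show "one_jump_cells m (m * K) e (walk_path n \<omega>)"
        proof (rule walk_path_one_jump_cells[OF m n(1) e])
          fix j r s assume j: "j < m * K" and r: "r \<in> {grid_time n m j..grid_time n m (Suc j)}"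
            "first_crossing ?Z (grid_time n m j) e r \<omega>" "s \<in> {r..grid_time n m (Suc j)}"
          have "\<omega> \<in> space M - F j" using \<omega> j by blast
          from F(3)[OF this r(1) _ r(3)] r(2) show "\<bar>\<Sum>k\<in>{r<..s}. ?Z k \<omega>\<bar> < e / 2" by simp
        qed
      qed
    qed
  qed
qed

end

section \<open>Subordinated Brownian motion\<close>

lemma ceiling_approximation_tendsto:
  fixes s :: real
  assumes "s \<ge> 0"
  shows "(\<lambda>k. real (nat \<lceil>real (Suc k) * s\<rceil>) / real (Suc k)) \<longlonglongrightarrow> s"
proof (rule tendsto_sandwich[where f="\<lambda>_. s" and h="\<lambda>k. s + 1 / real (Suc k)"])
  have "(\<lambda>k. s + 1 / real (Suc k)) \<longlonglongrightarrow> s + 0" by (intro tendsto_intros LIMSEQ_Suc lim_1_over_n)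
  then show "(\<lambda>k. s + 1 / real (Suc k)) \<longlonglongrightarrow> s" by simp
  show "\<forall>\<^sub>F k in sequentially. s \<le> real (nat \<lceil>real (Suc k) * s\<rceil>) / real (Suc k)"
  proof (intro always_eventually allI)
    fix k
    have "real (Suc k) * s / real (Suc k) \<le> real (nat \<lceil>real (Suc k) * s\<rceil>) / real (Suc k)"
      by (intro divide_right_mono real_nat_ceiling_ge) auto
    then show "s \<le> real (nat \<lceil>real (Suc k) * s\<rceil>) / real (Suc k)" by (simp del: of_nat_Suc)
  qed
  show "\<forall>\<^sub>F k in sequentially. real (nat \<lceil>real (Suc k) * s\<rceil>) / real (Suc k) \<le> s + 1 / real (Suc k)"
  proof (intro always_eventually allI)
    fix k
    have "real (nat \<lceil>real (Suc k) * s\<rceil>) \<le> real (Suc k) * s + 1" using assms by (simp add: of_nat_nat)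
    then have "real (nat \<lceil>real (Suc k) * s\<rceil>) / real (Suc k) \<le> (real (Suc k) * s + 1) / real (Suc k)"
      by (intro divide_right_mono) auto
    also have "\<dots> = s + 1 / real (Suc k)" by (simp add: add_divide_distrib del: of_nat_Suc)
    finally show "real (nat \<lceil>real (Suc k) * s\<rceil>) / real (Suc k) \<le> s + 1 / real (Suc k)" .
  qed
qed simp

locale subordinated_brownian_motion = prob_space N for N :: "'b measure" +
  fixes B \<sigma> :: "real \<Rightarrow> 'b \<Rightarrow> real" and \<beta> :: real
  assumes B: "brownian_motion B" and \<sigma>: "stable_subordinator \<sigma> \<beta>"
    and B\<sigma>: "indep_processes {0..} borel B {0..} borel \<sigma>"
begin

definition Y :: "real \<Rightarrow> 'b \<Rightarrow> real" where "Y t \<omega> = B (\<sigma> t \<omega>) \<omega>"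

lemma B_rv: "t \<ge> 0 \<Longrightarrow> random_variable borel (B t)"
  using B unfolding brownian_motion_def by simp

lemma B_continuous: "\<omega> \<in> space N \<Longrightarrow> continuous_on {0..} (\<lambda>t. B t \<omega>)"
  using B unfolding brownian_motion_def by simp

lemma B_0: "\<omega> \<in> space N \<Longrightarrow> B 0 \<omega> = 0"
  using B unfolding brownian_motion_def by simp

lemma \<sigma>_rv: "t \<ge> 0 \<Longrightarrow> random_variable borel (\<sigma> t)"
  using \<sigma> unfolding stable_subordinator_def levy_process_def by simp

lemma \<sigma>_0: "\<omega> \<in> space N \<Longrightarrow> \<sigma> 0 \<omega> = 0"
  using \<sigma> unfolding stable_subordinator_def levy_process_def by simp

lemma \<sigma>_mono:
  assumes "\<omega> \<in> space N" "0 \<le> s" "s \<le> t" shows "\<sigma> s \<omega> \<le> \<sigma> t \<omega>"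
proof -
  have "mono_on {0..} (\<lambda>t. \<sigma> t \<omega>)" using \<sigma> assms(1) unfolding stable_subordinator_def by blast
  from mono_onD[OF this, of s t] show ?thesis using assms by simp
qed

lemma \<sigma>_nonneg: "\<omega> \<in> space N \<Longrightarrow> 0 \<le> t \<Longrightarrow> 0 \<le> \<sigma> t \<omega>"
  using \<sigma>_mono[of \<omega> 0 t] \<sigma>_0 by simp

lemma \<sigma>_skorohod: "\<omega> \<in> space N \<Longrightarrow> (\<lambda>t\<in>{0..}. \<sigma> t \<omega>) \<in> skorohod_space"
  using \<sigma> unfolding stable_subordinator_def levy_process_def by simp

lemma B_tendsto:
  assumes "\<omega> \<in> space N" "(f \<longlongrightarrow> l) F" "l \<ge> 0" "\<forall>\<^sub>F s in F. f s \<ge> 0"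
  shows "((\<lambda>s. B (f s) \<omega>) \<longlongrightarrow> B l \<omega>) F"
  using continuous_on_tendsto_compose[OF B_continuous[OF assms(1)] assms(2)] assms(3,4) by simp

text \<open>A continuous function of a path with one-sided limits again has them. The left limit of
  \<sigma> has to be shown nonnegative first, as the paths of B are continuous on the half-line
  only.\<close>

lemma Y_in_skorohod:
  assumes \<omega>: "\<omega> \<in> space N" shows "(\<lambda>t\<in>{0..}. Y t \<omega>) \<in> skorohod_space"
  unfolding skorohod_space_def
proof (intro CollectI conjI allI impI)
  let ?s = "\<lambda>t\<in>{0..}. \<sigma> t \<omega>"
  have s0: "?s t \<ge> 0" if "t \<ge> 0" for t using \<sigma>_nonneg[OF \<omega>] that by simp
  show "(\<lambda>t\<in>{0..}. Y t \<omega>) \<in> extensional {0..}" by simp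
  fix t :: real
  show "((\<lambda>t\<in>{0..}. Y t \<omega>) \<longlongrightarrow> (\<lambda>t\<in>{0..}. Y t \<omega>) t) (at_right t)" if t: "t \<ge> 0"
  proof -
    have ev: "\<forall>\<^sub>F r in at_right t. r \<ge> 0"
      using eventually_at_right_less[of t] by eventually_elim (use t in simp)
    have "(?s \<longlongrightarrow> ?s t) (at_right t)" using \<sigma>_skorohod[OF \<omega>] t unfolding skorohod_space_def by blast
    moreover have "\<forall>\<^sub>F r in at_right t. ?s r \<ge> 0" using ev by eventually_elim (rule s0)
    ultimately have "((\<lambda>r. B (?s r) \<omega>) \<longlongrightarrow> B (?s t) \<omega>) (at_right t)"
      using s0[OF t] by (intro B_tendsto[OF \<omega>])
    moreover have "\<forall>\<^sub>F r in at_right t. B (?s r) \<omega> = (\<lambda>t\<in>{0..}. Y t \<omega>) r"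
      using ev by eventually_elim (simp add: Y_def)
    ultimately have "((\<lambda>t\<in>{0..}. Y t \<omega>) \<longlongrightarrow> B (?s t) \<omega>) (at_right t)" by (rule Lim_transform_eventually)
    then show ?thesis using t by (simp add: Y_def)
  qed
  show "\<exists>l. ((\<lambda>t\<in>{0..}. Y t \<omega>) \<longlongrightarrow> l) (at_left t)" if t: "t > 0"
  proof -
    obtain l where l: "(?s \<longlongrightarrow> l) (at_left t)" using \<sigma>_skorohod[OF \<omega>] t unfolding skorohod_space_def by blast
    have ev: "\<forall>\<^sub>F r in at_left t. r \<ge> 0"
      using eventually_at_left_real[OF t] by eventually_elim simp
    have ev': "\<forall>\<^sub>F r in at_left t. ?s r \<ge> 0" using ev by eventually_elim (rule s0)
    have "l \<ge> 0" by (rule tendsto_lowerbound[OF l ev']) simp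
    then have "((\<lambda>r. B (?s r) \<omega>) \<longlongrightarrow> B l \<omega>) (at_left t)" using l ev' by (intro B_tendsto[OF \<omega>])
    moreover have "\<forall>\<^sub>F r in at_left t. B (?s r) \<omega> = (\<lambda>t\<in>{0..}. Y t \<omega>) r"
      using ev by eventually_elim (simp add: Y_def)
    ultimately have "((\<lambda>t\<in>{0..}. Y t \<omega>) \<longlongrightarrow> B l \<omega>) (at_left t)" by (rule Lim_transform_eventually)
    then show ?thesis by blast
  qed
qed

definition \<sigma>_approx :: "nat \<Rightarrow> real \<Rightarrow> 'b \<Rightarrow> real" where
  "\<sigma>_approx k t \<omega> = real (nat \<lceil>real (Suc k) * \<sigma> t \<omega>\<rceil>) / real (Suc k)"

lemma \<sigma>_approx_nonneg: "\<sigma>_approx k t \<omega> \<ge> 0"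
  by (simp add: \<sigma>_approx_def)

lemma \<sigma>_approx_mono: "\<omega> \<in> space N \<Longrightarrow> 0 \<le> s \<Longrightarrow> s \<le> t \<Longrightarrow> \<sigma>_approx k s \<omega> \<le> \<sigma>_approx k t \<omega>"
  unfolding \<sigma>_approx_def using \<sigma>_mono[of \<omega> s t]
  by (intro divide_right_mono of_nat_mono nat_mono ceiling_mono mult_left_mono) auto

lemma \<sigma>_approx_tendsto: "\<omega> \<in> space N \<Longrightarrow> t \<ge> 0 \<Longrightarrow> (\<lambda>k. \<sigma>_approx k t \<omega>) \<longlonglongrightarrow> \<sigma> t \<omega>"
  unfolding \<sigma>_approx_def by (intro ceiling_approximation_tendsto \<sigma>_nonneg)

lemma B_\<sigma>_approx_tendsto: "\<omega> \<in> space N \<Longrightarrow> t \<ge> 0 \<Longrightarrow> (\<lambda>k. B (\<sigma>_approx k t \<omega>) \<omega>) \<longlonglongrightarrow> Y t \<omega>"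
  unfolding Y_def
  by (rule B_tendsto[OF _ \<sigma>_approx_tendsto \<sigma>_nonneg always_eventually]) (simp_all add: \<sigma>_approx_nonneg)

lemma \<sigma>_approx_index_rv: "t \<ge> 0 \<Longrightarrow> random_variable (count_space UNIV) (\<lambda>\<omega>. nat \<lceil>real (Suc k) * \<sigma> t \<omega>\<rceil>)"
  using \<sigma>_rv[of t] by measurable

text \<open>With countably many possible times, measurability of each \<open>B t\<close> is enough;
  \<open>Y\<close> inherits it as a pointwise limit.\<close>

lemma B_\<sigma>_approx_rv: "t \<ge> 0 \<Longrightarrow> random_variable borel (\<lambda>\<omega>. B (\<sigma>_approx k t \<omega>) \<omega>)"
  unfolding \<sigma>_approx_def
  by (rule measurable_compose_countable[where f="\<lambda>i \<omega>. B (real i / real (Suc k)) \<omega>", OF B_rv \<sigma>_approx_index_rv]) auto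

lemma Y_rv: "t \<ge> 0 \<Longrightarrow> random_variable borel (Y t)"
  by (rule borel_measurable_LIMSEQ_real[OF B_\<sigma>_approx_tendsto B_\<sigma>_approx_rv])

text \<open>The mean of g under the centred normal law of variance |v| (the point mass at 0 if v =
  0). The absolute value gives a function that is continuous on the whole line.\<close>

definition gauss_mean :: "(real \<Rightarrow> 'd::{banach, second_countable_topology}) \<Rightarrow> real \<Rightarrow> 'd" where
  "gauss_mean g v = expectation (\<lambda>\<omega>. g (B \<bar>v\<bar> \<omega>))"

lemma gauss_mean_increment:
  fixes g :: "real \<Rightarrow> 'd::{banach, second_countable_topology}"
  assumes g [measurable]: "g \<in> borel_measurable borel" and st: "0 \<le> s" "s \<le> t"
  shows "expectation (\<lambda>\<omega>. g (B t \<omega> - B s \<omega>)) = gauss_mean g (t - s)"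
proof (cases "s = t")
  case True
  then show ?thesis unfolding gauss_mean_def by (intro Bochner_Integration.integral_cong) (auto simp: B_0)
next
  case False
  then have "s < t" using st by simp
  have d: "distributed N lborel (\<lambda>\<omega>. B t \<omega> - B s \<omega>) (normal_density 0 (sqrt (t - s)))"
    using B st \<open>s < t\<close> unfolding brownian_motion_def by blast
  have d0: "distributed N lborel (\<lambda>\<omega>. B (t - s) \<omega> - B 0 \<omega>) (normal_density 0 (sqrt (t - s - 0)))"
    using B \<open>s < t\<close> unfolding brownian_motion_def by (metis diff_gt_0_iff_gt order_refl)
  have m: "(\<lambda>\<omega>. B t \<omega> - B s \<omega>) \<in> measurable N lborel" "(\<lambda>\<omega>. B (t - s) \<omega> - B 0 \<omega>) \<in> measurable N lborel"
    and "distr N lborel (\<lambda>\<omega>. B t \<omega> - B s \<omega>) = distr N lborel (\<lambda>\<omega>. B (t - s) \<omega> - B 0 \<omega>)"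
    using d d0 unfolding distributed_def by auto
  then have "expectation (\<lambda>\<omega>. g (B t \<omega> - B s \<omega>)) = expectation (\<lambda>\<omega>. g (B (t - s) \<omega> - B 0 \<omega>))"
    using integral_distr[OF m(1), of g] integral_distr[OF m(2), of g] by simp
  also have "\<dots> = gauss_mean g (t - s)"
    unfolding gauss_mean_def using st by (intro Bochner_Integration.integral_cong) (auto simp: B_0)
  finally show ?thesis .
qed

text \<open>Dominated convergence along the continuous paths of B, rather than a computation with
  normal densities.\<close>

lemma gauss_mean_continuous:
  fixes g :: "real \<Rightarrow> 'd::{banach, second_countable_topology}"
  assumes g: "continuous_on UNIV g" and g1: "\<And>x. norm (g x) \<le> 1"
  shows "continuous_on UNIV (gauss_mean g)"
proof -
  have gm [measurable]: "g \<in> borel_measurable borel" using g by (rule borel_measurable_continuous_onI)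
  have "isCont (gauss_mean g) v" for v
    unfolding continuous_at_sequentially comp_def
  proof (intro allI impI)
    fix w assume w: "w \<longlonglongrightarrow> v"
    show "(\<lambda>n. gauss_mean g (w n)) \<longlonglongrightarrow> gauss_mean g v"
      unfolding gauss_mean_def
    proof (rule integral_dominated_convergence[where w="\<lambda>_. 1"])
      show "AE \<omega> in N. (\<lambda>n. g (B \<bar>w n\<bar> \<omega>)) \<longlonglongrightarrow> g (B \<bar>v\<bar> \<omega>)"
      proof (rule AE_I2)
        fix \<omega> assume "\<omega> \<in> space N"
        then have "(\<lambda>n. B \<bar>w n\<bar> \<omega>) \<longlonglongrightarrow> B \<bar>v\<bar> \<omega>"
          using w by (intro B_tendsto tendsto_rabs) auto
        then show "(\<lambda>n. g (B \<bar>w n\<bar> \<omega>)) \<longlonglongrightarrow> g (B \<bar>v\<bar> \<omega>)"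
          by (intro continuous_on_tendsto_compose[OF g]) auto
      qed
    qed (use g1 in \<open>auto intro!: measurable_compose[OF B_rv gm]\<close>)
  qed
  then show ?thesis by (simp add: continuous_on_eq_continuous_at)
qed

lemma gauss_mean_bound:
  fixes g :: "real \<Rightarrow> 'd::{banach, second_countable_topology}"
  assumes gm: "g \<in> borel_measurable borel" and g1: "\<And>x. norm (g x) \<le> 1"
  shows "norm (gauss_mean g v) \<le> 1"
proof -
  have "norm (gauss_mean g v) \<le> expectation (\<lambda>\<omega>. norm (g (B \<bar>v\<bar> \<omega>)))"
    unfolding gauss_mean_def by (rule integral_norm_bound)
  also have "\<dots> \<le> expectation (\<lambda>_. 1)"
    using g1 measurable_compose[OF B_rv gm, of "\<bar>v\<bar>"] by (intro integral_mono integrable_const_bound[of _ 1]) auto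
  finally show ?thesis by (simp add: prob_space)
qed

text \<open>Given \<sigma>, the increments of B at the times \<sigma> (t i) are independent and
  normal, with the increments of \<sigma> as variances. This is proved for the rounded times, frozen
  as a list of integers, and passes to the limit because each g i and each
  \<open>gauss_mean (g i)\<close> is bounded and continuous. The independent increments of \<sigma>
  then split the expectation.\<close>

lemma expectation_prod_Y_\<sigma>:
  fixes g :: "nat \<Rightarrow> real \<Rightarrow> 'd::{real_normed_field, banach, second_countable_topology}"
  assumes g: "\<And>i. continuous_on UNIV (g i)" and g1: "\<And>i x. norm (g i x) \<le> 1"
    and t: "mono t" "0 \<le> t 0"
  shows "expectation (\<lambda>\<omega>. \<Prod>i<n. g i (Y (t (Suc i)) \<omega> - Y (t i) \<omega>)) =
    (\<Prod>i<n. expectation (\<lambda>\<omega>. gauss_mean (g i) (\<sigma> (t (Suc i)) \<omega> - \<sigma> (t i) \<omega>)))"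
proof -
  let ?dB = "\<lambda>k i \<omega>. B (\<sigma>_approx k (t (Suc i)) \<omega>) \<omega> - B (\<sigma>_approx k (t i) \<omega>) \<omega>" and ?d\<sigma> = "\<lambda>k i \<omega>. \<sigma>_approx k (t (Suc i)) \<omega> - \<sigma>_approx k (t i) \<omega>"
  let ?Y = "\<lambda>i \<omega>. Y (t (Suc i)) \<omega> - Y (t i) \<omega>" and ?\<sigma> = "\<lambda>i \<omega>. \<sigma> (t (Suc i)) \<omega> - \<sigma> (t i) \<omega>"
  have gm [measurable]: "g i \<in> borel_measurable borel" for i using g by (rule borel_measurable_continuous_onI)
  have t0: "0 \<le> t i" for i using t monoD[OF t(1), of 0 i] by simp
  have tS: "t i \<le> t j" if "i \<le> j" for i j using monoD[OF t(1) that] .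
  have gc: "continuous_on UNIV (gauss_mean (g i))" for i by (rule gauss_mean_continuous[OF g g1])
  have gb: "norm (gauss_mean (g i) v) \<le> 1" for i v by (rule gauss_mean_bound[OF gm g1])
  have gmm [measurable]: "gauss_mean (g i) \<in> borel_measurable borel" for i using gc by (rule borel_measurable_continuous_onI)
  have discrete: "expectation (\<lambda>\<omega>. \<Prod>i<n. g i (?dB k i \<omega>)) =
      expectation (\<lambda>\<omega>. \<Prod>i<n. gauss_mean (g i) (?d\<sigma> k i \<omega>))" for k
  proof -
    define G where "G = (\<lambda>y::real \<Rightarrow> real. map (\<lambda>i. nat \<lceil>real (Suc k) * y (t i)\<rceil>) [0..<Suc n])"
    define u where "u = (\<lambda>(r::nat list) i. real (r ! i) / real (Suc k))"
    define f where "f = (\<lambda>r y. \<Prod>i<n. g i (y (u r (Suc i)) - y (u r i)))"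
    have Gm: "G \<in> measurable (PiM {0..} (\<lambda>_. borel)) (count_space UNIV)"
      unfolding measurable_count_space_eq2_countable
    proof (intro conjI ballI)
      fix l
      have "G y = l \<longleftrightarrow> length l = Suc n \<and> (\<forall>i\<in>{..n}. nat \<lceil>real (Suc k) * y (t i)\<rceil> = l ! i)" for y
        unfolding G_def by (subst list_eq_iff_nth_eq) (auto simp del: upt_Suc simp: less_Suc_eq_le)
      then have "G -` {l} \<inter> space (PiM {0..} (\<lambda>_. borel)) = {y \<in> space (PiM {0..} (\<lambda>_. borel)).
          length l = Suc n \<and> (\<forall>i\<in>{..n}. nat \<lceil>real (Suc k) * y (t i)\<rceil> = l ! i)}" by auto
      also have "\<dots> \<in> sets (PiM {0..} (\<lambda>_. borel))"
      proof (intro sets.sets_Collect_conj sets.sets_Collect_finite_All)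
        fix i
        have [measurable]: "(\<lambda>y. y (t i)) \<in> borel_measurable (PiM {0..} (\<lambda>_. borel))"
          by (rule measurable_component_singleton) (use t0 in simp)
        show "{y \<in> space (PiM {0..} (\<lambda>_. borel)). nat \<lceil>real (Suc k) * y (t i)\<rceil> = l ! i} \<in> sets (PiM {0..} (\<lambda>_. borel))"
          by measurable
      qed auto
      finally show "G -` {l} \<inter> space (PiM {0..} (\<lambda>_. borel)) \<in> sets (PiM {0..} (\<lambda>_. borel))" .
    qed simp
    have u0: "u r i \<ge> 0" for r i unfolding u_def by simp
    have [measurable]: "(\<lambda>y. y (u r i)) \<in> borel_measurable (PiM {0..} (\<lambda>_. borel))" for r i
      by (rule measurable_component_singleton) (use u0 in simp)
    have fm: "f r \<in> borel_measurable (PiM {0..} (\<lambda>_. borel))" for r unfolding f_def by measurable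
    have f1: "norm (f r y) \<le> 1" for r y
      unfolding f_def prod_norm[symmetric] using g1 by (intro prod_le_1) auto
    have uG: "u (G (\<lambda>s\<in>{0..}. \<sigma> s \<omega>)) i = \<sigma>_approx k (t i) \<omega>" if "i \<le> n" for i \<omega>
    proof -
      have "G (\<lambda>s\<in>{0..}. \<sigma> s \<omega>) ! i = nat \<lceil>real (Suc k) * \<sigma> (t i) \<omega>\<rceil>"
        using that t0 unfolding G_def by (subst nth_map) (auto simp del: upt_Suc)
      then show ?thesis unfolding u_def \<sigma>_approx_def by simp
    qed
    have fB: "f r (\<lambda>s\<in>{0..}. B s \<omega>) = (\<Prod>i<n. g i (B (u r (Suc i)) \<omega> - B (u r i) \<omega>))" for r \<omega>
      unfolding f_def using u0 by simp
    have h: "expectation (\<lambda>\<omega>'. f r (\<lambda>s\<in>{0..}. B s \<omega>')) = (\<Prod>i<n. gauss_mean (g i) (u r (Suc i) - u r i))"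
      if r: "\<And>i. i < n \<Longrightarrow> u r i \<le> u r (Suc i)" for r
    proof -
      \<comment> \<open>\<open>indep_increments\<close> speaks of monotone sequences on all
        naturals, whereas only the first n + 1 frozen times are known to be ordered; the sequence is
        continued as a constant.\<close>
      define t' where "t' = (\<lambda>i. u r (min i n))"
      have "t' i \<le> t' (Suc i)" for i unfolding t'_def using r[of i] by (cases "i < n") (auto simp: min_def)
      then have "mono t'" by (rule incseq_SucI)
      moreover have "0 \<le> t' 0" unfolding t'_def by (rule u0)
      ultimately have "indep_vars (\<lambda>_. borel) (\<lambda>i \<omega>. B (t' (Suc i)) \<omega> - B (t' i) \<omega>) {..<n}"
        using B unfolding brownian_motion_def indep_increments_def by blast
      then have "indep_vars (\<lambda>_. borel) (\<lambda>i \<omega>. B (u r (Suc i)) \<omega> - B (u r i) \<omega>) {..<n}"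
        by (rule indep_vars_cong[THEN iffD1, rotated -1]) (auto simp: t'_def)
      then have ind: "indep_vars (\<lambda>_. borel) (\<lambda>i \<omega>. g i (B (u r (Suc i)) \<omega> - B (u r i) \<omega>)) {..<n}"
        by (rule indep_vars_compose2) simp
      have [measurable]: "random_variable borel (B (u r i))" for i by (rule B_rv[OF u0])
      have "expectation (\<lambda>\<omega>'. f r (\<lambda>s\<in>{0..}. B s \<omega>')) = (\<Prod>i<n. expectation (\<lambda>\<omega>. g i (B (u r (Suc i)) \<omega> - B (u r i) \<omega>)))"
        unfolding fB using g1 by (intro indep_vars_lebesgue_integral[OF _ ind] integrable_const_bound[of _ 1]) auto
      also have "\<dots> = (\<Prod>i<n. gauss_mean (g i) (u r (Suc i) - u r i))"
        using u0 r by (intro prod.cong gauss_mean_increment) auto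
      finally show ?thesis .
    qed
    have "expectation (\<lambda>\<omega>. \<Prod>i<n. g i (?dB k i \<omega>))
        = expectation (\<lambda>\<omega>. f (G (\<lambda>s\<in>{0..}. \<sigma> s \<omega>)) (\<lambda>s\<in>{0..}. B s \<omega>))"
      unfolding fB using uG by (intro Bochner_Integration.integral_cong prod.cong) auto
    also have "\<dots> = expectation (\<lambda>\<omega>. expectation (\<lambda>\<omega>'. f (G (\<lambda>s\<in>{0..}. \<sigma> s \<omega>)) (\<lambda>s\<in>{0..}. B s \<omega>')))"
      by (rule expectation_freeze_processes[OF B\<sigma> B_rv \<sigma>_rv Gm fm f1]) auto
    also have "\<dots> = expectation (\<lambda>\<omega>. \<Prod>i<n. gauss_mean (g i) (?d\<sigma> k i \<omega>))"
    proof (rule Bochner_Integration.integral_cong[OF refl])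
      fix \<omega> assume \<omega>: "\<omega> \<in> space N"
      let ?r = "G (\<lambda>s\<in>{0..}. \<sigma> s \<omega>)"
      have "u ?r i \<le> u ?r (Suc i)" if "i < n" for i
        using that uG[of i \<omega>] uG[of "Suc i" \<omega>] \<sigma>_approx_mono[OF \<omega> t0 tS, of i "Suc i"] by simp
      from h[OF this] show "expectation (\<lambda>\<omega>'. f ?r (\<lambda>s\<in>{0..}. B s \<omega>')) = (\<Prod>i<n. gauss_mean (g i) (?d\<sigma> k i \<omega>))"
        using uG by simp
    qed
    finally show ?thesis .
  qed
  have [measurable]: "random_variable borel (\<lambda>\<omega>. B (\<sigma>_approx k (t i) \<omega>) \<omega>)" "random_variable borel (Y (t i))"
    "random_variable borel (\<sigma> (t i))" for k i
    using B_\<sigma>_approx_rv Y_rv \<sigma>_rv t0 by auto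
  have [measurable]: "random_variable borel (\<sigma>_approx k (t i))" for k i
    unfolding \<sigma>_approx_def[abs_def] by measurable
  have L: "(\<lambda>k. expectation (\<lambda>\<omega>. \<Prod>i<n. g i (?dB k i \<omega>)))
      \<longlonglongrightarrow> expectation (\<lambda>\<omega>. \<Prod>i<n. g i (?Y i \<omega>))"
  proof (rule integral_dominated_convergence[where w="\<lambda>_. 1"])
    show "AE \<omega> in N. (\<lambda>k. \<Prod>i<n. g i (?dB k i \<omega>))
        \<longlonglongrightarrow> (\<Prod>i<n. g i (?Y i \<omega>))"
    proof (intro AE_I2 tendsto_prod)
      fix \<omega> i assume "\<omega> \<in> space N"
      then have "(\<lambda>k. ?dB k i \<omega>) \<longlonglongrightarrow> ?Y i \<omega>"
        by (intro tendsto_diff B_\<sigma>_approx_tendsto t0)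
      then show "(\<lambda>k. g i (?dB k i \<omega>)) \<longlonglongrightarrow> g i (?Y i \<omega>)"
        by (intro continuous_on_tendsto_compose[OF g]) auto
    qed
    show "AE \<omega> in N. norm (\<Prod>i<n. g i (?dB k i \<omega>)) \<le> 1" for k
      unfolding prod_norm[symmetric] using g1 by (intro AE_I2 prod_le_1) auto
  qed auto
  have "(\<lambda>k. expectation (\<lambda>\<omega>. \<Prod>i<n. gauss_mean (g i) (?d\<sigma> k i \<omega>)))
      \<longlonglongrightarrow> expectation (\<lambda>\<omega>. \<Prod>i<n. gauss_mean (g i) (?\<sigma> i \<omega>))"
  proof (rule integral_dominated_convergence[where w="\<lambda>_. 1"])
    show "AE \<omega> in N. (\<lambda>k. \<Prod>i<n. gauss_mean (g i) (?d\<sigma> k i \<omega>))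
        \<longlonglongrightarrow> (\<Prod>i<n. gauss_mean (g i) (?\<sigma> i \<omega>))"
    proof (intro AE_I2 tendsto_prod)
      fix \<omega> i assume "\<omega> \<in> space N"
      then have "(\<lambda>k. ?d\<sigma> k i \<omega>) \<longlonglongrightarrow> ?\<sigma> i \<omega>"
        by (intro tendsto_diff \<sigma>_approx_tendsto t0)
      then show "(\<lambda>k. gauss_mean (g i) (?d\<sigma> k i \<omega>)) \<longlonglongrightarrow> gauss_mean (g i) (?\<sigma> i \<omega>)"
        by (intro continuous_on_tendsto_compose[OF gc]) auto
    qed
    show "AE \<omega> in N. norm (\<Prod>i<n. gauss_mean (g i) (?d\<sigma> k i \<omega>)) \<le> 1" for k
      unfolding prod_norm[symmetric] using gb by (intro AE_I2 prod_le_1) auto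
  qed auto
  with L have "expectation (\<lambda>\<omega>. \<Prod>i<n. g i (?Y i \<omega>))
      = expectation (\<lambda>\<omega>. \<Prod>i<n. gauss_mean (g i) (?\<sigma> i \<omega>))"
    unfolding discrete by (rule LIMSEQ_unique)
  also have "\<dots> = (\<Prod>i<n. expectation (\<lambda>\<omega>. gauss_mean (g i) (?\<sigma> i \<omega>)))"
  proof (rule indep_vars_lebesgue_integral)
    have "indep_vars (\<lambda>_. borel) (\<lambda>i \<omega>. ?\<sigma> i \<omega>) {..<n}"
      using \<sigma> t unfolding stable_subordinator_def levy_process_def indep_increments_def by blast
    then show "indep_vars (\<lambda>_. borel) (\<lambda>i \<omega>. gauss_mean (g i) (?\<sigma> i \<omega>)) {..<n}"
      by (rule indep_vars_compose2) simp
    show "integrable N (\<lambda>\<omega>. gauss_mean (g i) (?\<sigma> i \<omega>))" for i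
      using gb by (intro integrable_const_bound[of _ 1]) auto
  qed simp
  finally show ?thesis .
qed

lemma expectation_Y_\<sigma>:
  fixes g :: "real \<Rightarrow> 'd::{real_normed_field, banach, second_countable_topology}"
  assumes g: "continuous_on UNIV g" "\<And>x. norm (g x) \<le> 1" and t: "mono t" "0 \<le> t 0"
  shows "expectation (\<lambda>\<omega>. g (Y (t (Suc i)) \<omega> - Y (t i) \<omega>)) = expectation (\<lambda>\<omega>. gauss_mean g (\<sigma> (t (Suc i)) \<omega> - \<sigma> (t i) \<omega>))"
proof -
  \<comment> \<open>Constant factors 1 single out one increment in the product formula.\<close>
  define g' where "g' = (\<lambda>j. if j = i then g else (\<lambda>_. 1))"
  have "(\<Prod>j<Suc i. g' j (Y (t (Suc j)) \<omega> - Y (t j) \<omega>)) = g (Y (t (Suc i)) \<omega> - Y (t i) \<omega>)" for \<omega>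
    unfolding g'_def by simp
  moreover have "(\<Prod>j<Suc i. expectation (\<lambda>\<omega>. gauss_mean (g' j) (\<sigma> (t (Suc j)) \<omega> - \<sigma> (t j) \<omega>)))
      = expectation (\<lambda>\<omega>. gauss_mean g (\<sigma> (t (Suc i)) \<omega> - \<sigma> (t i) \<omega>))"
    unfolding g'_def gauss_mean_def by (simp add: prob_space)
  moreover have "continuous_on UNIV (g' j)" "norm (g' j x) \<le> 1" for j x unfolding g'_def using g by auto
  ultimately show ?thesis using expectation_prod_Y_\<sigma>[of g' t "Suc i"] t by simp
qed

lemma Y_increments_indep:
  assumes t: "mono t" "0 \<le> t 0"
  shows "indep_vars (\<lambda>_. borel) (\<lambda>i \<omega>. Y (t (Suc i)) \<omega> - Y (t i) \<omega>) UNIV"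
proof (rule indep_vars_if_expectation_prod)
  have t0: "0 \<le> t i" for i using t monoD[OF t(1), of 0 i] by simp
  show "random_variable borel (\<lambda>\<omega>. Y (t (Suc i)) \<omega> - Y (t i) \<omega>)" for i
    by (intro borel_measurable_diff Y_rv t0)
  fix n and g :: "nat \<Rightarrow> real \<Rightarrow> real"
  assume g: "\<And>i. continuous_on UNIV (g i)" "\<And>i x. \<bar>g i x\<bar> \<le> 1"
  show "expectation (\<lambda>\<omega>. \<Prod>i<n. g i (Y (t (Suc i)) \<omega> - Y (t i) \<omega>)) = (\<Prod>i<n. expectation (\<lambda>\<omega>. g i (Y (t (Suc i)) \<omega> - Y (t i) \<omega>)))"
    using expectation_prod_Y_\<sigma>[of g t n] expectation_Y_\<sigma>[of "g _" t] g t by simp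
qed

lemma gauss_mean_iexp: "v \<ge> 0 \<Longrightarrow> gauss_mean (\<lambda>x. iexp (\<theta> * x)) v = of_real (exp (- (\<theta>\<^sup>2 / 2) * v))"
\<comment> \<open>\<open>brownian_motion\<close> provides a density for positive time differences
  only.\<close>
proof (cases "v = 0")
  case True
  have "gauss_mean (\<lambda>x. iexp (\<theta> * x)) 0 = expectation (\<lambda>_. 1)"
    unfolding gauss_mean_def by (intro Bochner_Integration.integral_cong) (auto simp: B_0)
  then show ?thesis using True by (simp add: prob_space)
next
  case False
  assume "v \<ge> 0"
  then have v: "v > 0" using False by simp
  have "distributed N lborel (\<lambda>\<omega>. B v \<omega> - B 0 \<omega>) (normal_density 0 (sqrt (v - 0)))"
    using B v unfolding brownian_motion_def by blast
  then have d: "distributed N lborel (\<lambda>\<omega>. (B v \<omega> - B 0 \<omega> - 0) / sqrt v) std_normal_density"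
    using v by (subst normal_standard_normal_convert[symmetric]) auto
  have "distr N borel (\<lambda>\<omega>. (B v \<omega> - B 0 \<omega> - 0) / sqrt v) = distr N lborel (\<lambda>\<omega>. (B v \<omega> - B 0 \<omega> - 0) / sqrt v)"
    by (rule distr_cong) auto
  also have "\<dots> = std_normal_distribution" using d unfolding distributed_def by simp
  finally have std: "distr N borel (\<lambda>\<omega>. (B v \<omega> - B 0 \<omega> - 0) / sqrt v) = std_normal_distribution" .
  have rv: "random_variable borel (\<lambda>\<omega>. (B v \<omega> - B 0 \<omega> - 0) / sqrt v)"
    by (intro borel_measurable_divide borel_measurable_diff borel_measurable_const B_rv) (use v in auto)
  have "gauss_mean (\<lambda>x. iexp (\<theta> * x)) v = expectation (\<lambda>\<omega>. iexp (\<theta> * sqrt v * ((B v \<omega> - B 0 \<omega> - 0) / sqrt v)))"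
    unfolding gauss_mean_def using v by (intro Bochner_Integration.integral_cong) (auto simp: B_0)
  also have "\<dots> = char (distr N borel (\<lambda>\<omega>. (B v \<omega> - B 0 \<omega> - 0) / sqrt v)) (\<theta> * sqrt v)"
    unfolding char_def by (rule integral_distr[OF rv, symmetric]) simp
  also have "\<dots> = of_real (exp (- (\<theta> * sqrt v)\<^sup>2 / 2))" unfolding std char_std_normal_distribution ..
  also have "- (\<theta> * sqrt v)\<^sup>2 / 2 = - (\<theta>\<^sup>2 / 2) * v" using v by (simp add: power_mult_distrib)
  finally show ?thesis .
qed

text \<open>Conditioning on \<sigma> turns the characteristic function into the Laplace transform of
  an increment of \<sigma> at \<theta>^2 / 2, and stationarity replaces that increment by \<sigma>
  (t - s).\<close>

lemma Y_increment_char: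
  assumes t: "0 \<le> s" "s \<le> t"
  shows "char (distr N borel (\<lambda>\<omega>. Y t \<omega> - Y s \<omega>)) \<theta> = of_real (exp (- ((t - s) * (\<theta>\<^sup>2 / 2) powr \<beta>)))"
proof -
  \<comment> \<open>Only the increment of index 0 is used; the constant continuation makes it a
    monotone sequence of times.\<close>
  define t' where "t' = (\<lambda>i::nat. if i = 0 then s else t)"
  have t': "mono t'" "0 \<le> t' 0" using t by (auto simp: t'_def mono_def)
  have "char (distr N borel (\<lambda>\<omega>. Y t \<omega> - Y s \<omega>)) \<theta> = expectation (\<lambda>\<omega>. iexp (\<theta> * (Y t \<omega> - Y s \<omega>)))"
    unfolding char_def using Y_rv[of s] Y_rv[of t] t by (subst integral_distr) auto
  also have "\<dots> = expectation (\<lambda>\<omega>. gauss_mean (\<lambda>x. iexp (\<theta> * x)) (\<sigma> t \<omega> - \<sigma> s \<omega>))"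
  proof -
    have c: "continuous_on UNIV (\<lambda>x. iexp (\<theta> * x))" by (intro continuous_intros)
    show ?thesis using expectation_Y_\<sigma>[OF c _ t', of 0] by (simp add: t'_def)
  qed
  also have "\<dots> = expectation (\<lambda>\<omega>. of_real (exp (- (\<theta>\<^sup>2 / 2) * (\<sigma> t \<omega> - \<sigma> s \<omega>))))"
    using \<sigma>_mono t by (intro Bochner_Integration.integral_cong gauss_mean_iexp) auto
  also have "\<dots> = of_real (expectation (\<lambda>\<omega>. exp (- (\<theta>\<^sup>2 / 2) * (\<sigma> t \<omega> - \<sigma> s \<omega>))))"
  proof (rule integral_of_real, rule integrable_const_bound[of _ 1])
    show "AE \<omega> in N. norm (exp (- (\<theta>\<^sup>2 / 2) * (\<sigma> t \<omega> - \<sigma> s \<omega>))) \<le> 1"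
      using \<sigma>_mono t by (intro AE_I2) auto
    show "random_variable borel (\<lambda>\<omega>. exp (- (\<theta>\<^sup>2 / 2) * (\<sigma> t \<omega> - \<sigma> s \<omega>)))"
    proof -
      have [measurable]: "random_variable borel (\<sigma> s)" "random_variable borel (\<sigma> t)" using t by (auto intro!: \<sigma>_rv)
      show ?thesis by measurable
    qed
  qed
  also have "expectation (\<lambda>\<omega>. exp (- (\<theta>\<^sup>2 / 2) * (\<sigma> t \<omega> - \<sigma> s \<omega>))) = expectation (\<lambda>\<omega>. exp (- (\<theta>\<^sup>2 / 2) * \<sigma> (t - s) \<omega>))"
  proof -
    have "distr N borel (\<lambda>\<omega>. \<sigma> (s + (t - s)) \<omega> - \<sigma> s \<omega>) = distr N borel (\<sigma> (t - s))"
      using \<sigma> t unfolding stable_subordinator_def levy_process_def by (meson diff_ge_0_iff_ge)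
    then have d: "distr N borel (\<lambda>\<omega>. \<sigma> t \<omega> - \<sigma> s \<omega>) = distr N borel (\<sigma> (t - s))" by simp
    have 1: "random_variable borel (\<lambda>\<omega>. \<sigma> t \<omega> - \<sigma> s \<omega>)" using t by (intro borel_measurable_diff \<sigma>_rv) auto
    have 2: "random_variable borel (\<sigma> (t - s))" using t by (intro \<sigma>_rv) auto
    have e: "(\<lambda>x. exp (- (\<theta>\<^sup>2 / 2) * x)) \<in> borel_measurable borel" by measurable
    show ?thesis using integral_distr[OF 1 e] integral_distr[OF 2 e] d by simp
  qed
  also have "\<dots> = exp (- (t - s) * (\<theta>\<^sup>2 / 2) powr \<beta>)"
  proof -
    have "\<forall>t\<ge>0. \<forall>u\<ge>0. expectation (\<lambda>\<omega>. exp (- u * \<sigma> t \<omega>)) = exp (- t * u powr \<beta>)"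
      using \<sigma> unfolding stable_subordinator_def by blast
    from this[rule_format, of "t - s" "\<theta>\<^sup>2 / 2"] t show ?thesis by (simp only: diff_ge_0_iff_ge) simp
  qed
  finally show ?thesis unfolding mult_minus_left .
qed

end

section \<open>The functional limit theorem\<close>

lemma (in prob_space) distr_nat_eqI:
  fixes S T :: "'a \<Rightarrow> nat"
  assumes S: "random_variable (count_space UNIV) S" and T: "random_variable (count_space UNIV) T"
    and eq: "\<And>k. prob {\<omega> \<in> space M. S \<omega> = k} = prob {\<omega> \<in> space M. T \<omega> = k}"
  shows "distr M (count_space UNIV) S = distr M (count_space UNIV) T"
proof (rule measure_eqI_countable[where A=UNIV])
  fix k :: nat
  have "emeasure (distr M (count_space UNIV) U) {k} = prob {\<omega> \<in> space M. U \<omega> = k}"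
    if "random_variable (count_space UNIV) U" for U
    using that by (simp add: emeasure_distr emeasure_eq_measure vimage_def Int_def conj_commute)
  then show "emeasure (distr M (count_space UNIV) S) {k} = emeasure (distr M (count_space UNIV) T) {k}"
    using S T eq by simp
qed auto

theorem theorem4p1:
  fixes \<alpha> :: real
    and \<psi> :: "real \<Rightarrow> real" and killing drift :: real and \<nu> :: "real measure"
    and M :: "'a measure" and X :: "nat \<Rightarrow> 'a \<Rightarrow> int" and p :: "int pmf" and R :: "nat \<Rightarrow> 'a \<Rightarrow> nat"
    and N :: "'b measure" and B \<sigma> :: "real \<Rightarrow> 'b \<Rightarrow> real"
    and b :: "nat \<Rightarrow> real"
  assumes \<alpha>: "0 < \<alpha>" "\<alpha> < 2"
    and \<psi>: "bernstein_function \<psi>" "bernstein_representation \<psi> killing drift \<nu>"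
      "regularly_varying_at_zero \<psi> (\<alpha> / 2)" "\<psi> 0 = 0" "\<psi> 1 = 1"
    and M: "prob_space M"
    and X: "prob_space.class_S_steps M X p"
      "prob_space.expectation M (\<lambda>\<omega>. real_of_int (X 1 \<omega>)) = 0"
      "prob_space.variance M (\<lambda>\<omega>. real_of_int (X 1 \<omega>)) = 1"
    and R: "prob_space.discrete_subordinator_steps M R (bernstein_coeff drift \<nu>)"
    and XR: "prob_space.indep_processes M {1..} (count_space UNIV) X {1..} (count_space UNIV) R"
    and N: "prob_space N"
    and B: "prob_space.brownian_motion N B"
    and \<sigma>: "prob_space.stable_subordinator N \<sigma> (\<alpha> / 2)"
    and B\<sigma>: "prob_space.indep_processes N {0..} borel B {0..} borel \<sigma>"
    and b: "\<And>n. n \<ge> 1 \<Longrightarrow> 0 < b n" "(\<lambda>n. real n * \<psi> (inverse (b n))) \<longlonglongrightarrow> 1"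
  shows "converges_in_law skorohod_J1
     (\<lambda>_. M)
     (\<lambda>n \<omega>. \<lambda>t\<in>{0..}. b n powr (- 1 / 2) *
        real_of_int (partial_sums X (partial_sums R (nat \<lfloor>real n * t\<rfloor>) \<omega>) \<omega>))
     N
     (\<lambda>\<omega>. \<lambda>t\<in>{0..}. B (\<sigma> t \<omega>) \<omega>)"
proof -
  interpret M: prob_space M by (rule M)
  interpret N: prob_space N by (rule N)
  have R_indep: "M.indep_vars (\<lambda>_. count_space UNIV) R {1..}"
    and Rp: "\<And>i k. i \<ge> 1 \<Longrightarrow> k \<ge> 1 \<Longrightarrow> M.prob {\<omega> \<in> space M. R i \<omega> = k} = bernstein_coeff drift \<nu> k"
    using R unfolding M.discrete_subordinator_steps_def by auto
  have R_rv: "M.random_variable (count_space UNIV) (R i)" if "i \<ge> 1" for i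
    using R_indep that unfolding M.indep_vars_def2 by simp
  note step = M.subordinator_step[OF \<psi>(2,4,5) R_rv Rp]
  \<comment> \<open>For k \<ge> 1 the laws agree by assumption, and at 0 both have no mass.\<close>
  have R_law: "M.prob {\<omega> \<in> space M. R i \<omega> = k} = M.prob {\<omega> \<in> space M. R 1 \<omega> = k}" if "i \<ge> 1" for i k
    using that step(1)[of i] step(1)[of 1] Rp[of i k] Rp[of 1 k] by (cases "k = 0") auto
  interpret W: subordinated_walk M X p R \<psi>
  proof
    show "M.expectation (\<lambda>\<omega>. s ^ R i \<omega>) = 1 - \<psi> (1 - s)" if "i \<ge> 1" "0 \<le> s" "s \<le> 1" for i s
      using step(2)[of i] that by simp
    show "distr M (count_space UNIV) (R i) = distr M (count_space UNIV) (R 1)" if "i \<ge> 1" for i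
      by (rule M.distr_nat_eqI[OF R_rv[OF that] R_rv[OF order_refl] R_law[OF that]])
  qed (use X R_indep XR in auto)
  interpret S: regular_scaling \<psi> "\<alpha> / 2" b
    using bernstein_mono[OF \<psi>(2)] \<psi> \<alpha> b by unfold_locales auto
  interpret W: scaled_walk M X p R \<psi> "\<alpha> / 2" b ..
  interpret L: subordinated_brownian_motion N B \<sigma> "\<alpha> / 2"
    using B \<sigma> B\<sigma> by unfold_locales auto
  have "converges_in_law skorohod_J1 (\<lambda>_. M) W.walk_path N (\<lambda>\<omega>. \<lambda>t\<in>{0..}. L.Y t \<omega>)"
  proof (rule converges_in_law_skorohod_J1[OF M N])
    show "W.walk_path n \<omega> \<in> skorohod_space" for n \<omega> by (rule W.walk_path_in_skorohod)
    show "(\<lambda>\<omega>. W.walk_path n \<omega> t) \<in> borel_measurable M" if "t \<ge> 0" for n t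
      using that by (rule W.walk_path_measurable)
    show "(\<lambda>t\<in>{0..}. L.Y t \<omega>) \<in> skorohod_space" if "\<omega> \<in> space N" for \<omega>
      using that by (rule L.Y_in_skorohod)
    show "(\<lambda>\<omega>. (\<lambda>t\<in>{0..}. L.Y t \<omega>) t) \<in> borel_measurable N" if "t \<ge> 0" for t
      using L.Y_rv[OF that] that by simp
    show "\<forall>\<^sub>F m in sequentially. \<forall>\<^sub>F n in sequentially. \<exists>F\<in>sets M. M.prob F < d \<and>
        (\<forall>\<omega>\<in>space M - F. one_jump_cells m (m * K) e (W.walk_path n \<omega>))" if "e > 0" "d > 0" for K e d
      using that by (rule W.walk_path_jumps)
    fix m G c assume m: "m > (0::nat)" and G: "open G"
      and c: "c < N.prob {\<omega> \<in> space N. grid_values m (\<lambda>t\<in>{0..}. L.Y t \<omega>) \<in> G}"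
    define V where "V = (\<lambda>n i \<omega>. W.walk_path n \<omega> (real (Suc i) / real m) - W.walk_path n \<omega> (real i / real m))"
    define U where "U = (\<lambda>i \<omega>. L.Y (real (Suc i) / real m) \<omega> - L.Y (real i / real m) \<omega>)"
    \<comment> \<open>Both paths start at 0, so their grid values are the cumulative sums of their
      grid increments. This map is continuous in the product topology, and an open set of values
      becomes an open set of increments, to which independence applies.\<close>
    define S where "S = (\<lambda>(v::nat \<Rightarrow> real) j. \<Sum>i<j. v i)"
    have grid: "grid_values m f = S (\<lambda>i. f (real (Suc i) / real m) - f (real i / real m))" if "f 0 = 0" for f
      unfolding S_def grid_values_def fun_eq_iff
      using sum_lessThan_telescope[of "\<lambda>i. f (real i / real m)"] that by simp
    have VS: "grid_values m (W.walk_path n \<omega>) = S (\<lambda>i. V n i \<omega>)" for n \<omega>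
      unfolding V_def by (rule grid) (simp add: W.walk_path_def W.walk_def grid_index_def)
    have US: "grid_values m (\<lambda>t\<in>{0..}. L.Y t \<omega>) = S (\<lambda>i. U i \<omega>)" if "\<omega> \<in> space N" for \<omega>
      using grid[of "\<lambda>t\<in>{0..}. L.Y t \<omega>"] L.\<sigma>_0[OF that] L.B_0[OF that] unfolding U_def by (simp add: L.Y_def)
    have "continuous_on UNIV S"
      unfolding S_def by (intro continuous_on_coordinatewise_then_product continuous_on_sum continuous_on_product_coordinates)
    then have SG: "open (S -` G)" using G by (rule open_vimage[rotated])
    have mono: "mono (\<lambda>i. real i / real m)" by (intro monoI divide_right_mono) auto
    have "\<forall>\<^sub>F n in sequentially. c < M.prob {\<omega> \<in> space M. (\<lambda>i. V n i \<omega>) \<in> S -` G}"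
    proof (rule indep_char_tendsto_liminf_open[OF M N _ _ _ SG])
      show "M.indep_vars (\<lambda>_. borel) (V n) UNIV" for n
        unfolding V_def by (rule W.walk_increments_indep)
      show "N.indep_vars (\<lambda>_. borel) U UNIV"
        unfolding U_def by (rule L.Y_increments_indep[OF mono]) simp
      show "(\<lambda>n. char (distr M borel (V n i)) \<theta>) \<longlonglongrightarrow> char (distr N borel (U i)) \<theta>" for i \<theta>
      proof -
        have "char (distr N borel (U i)) \<theta> = of_real (exp (- (1 / real m * (\<theta>\<^sup>2 / 2) powr (\<alpha> / 2))))"
          unfolding U_def using m
          by (subst L.Y_increment_char) (auto simp: divide_right_mono diff_divide_distrib[symmetric])
        then show ?thesis using W.walk_increments_char_tendsto[OF m, of i \<theta>] unfolding V_def by simp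
      qed
      have "{\<omega> \<in> space N. (\<lambda>i. U i \<omega>) \<in> S -` G} = {\<omega> \<in> space N. grid_values m (\<lambda>t\<in>{0..}. L.Y t \<omega>) \<in> G}"
        using US by auto
      then show "c < N.prob {\<omega> \<in> space N. (\<lambda>i. U i \<omega>) \<in> S -` G}" using c by simp
    qed
    then show "\<forall>\<^sub>F n in sequentially. c < M.prob {\<omega> \<in> space M. grid_values m (W.walk_path n \<omega>) \<in> G}"
      unfolding VS by simp
  qed
  then show ?thesis
    unfolding W.walk_path_def W.walk_def L.Y_def grid_index_def W.partial_sums_X_\<tau> .
qed

end
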